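(* Any Drinfeld co-twist $\mathcal{F}$ on a co-quasitriangular Hopf algebra $(\mathcal{H},\mathcal{R})$ in $\mathrm{SupLat}$ induces a Drinfeld twist on its remnant skew brace $R(\mathcal{H})$.
   Context: $\mathrm{SupLat}$ is the category of complete lattices and join-preserving maps, symmetric monoidal with the tensor product $M\otimes N$ universal for maps $M\times N\to L$ preserving joins in each variable; pure tensors are also written $(m,n)$. The unit object is the two-element lattice $\mathcal{P}(1)=\{\emptyset,1\}$ (its elements act as scalars, $1\cdot m=m$, $\emptyset\cdot m=$ bottom element). $\mathcal{P}(S)$ is the power set of $S$, the free complete join-lattice on $S$. Hopf algebras are Hopf algebra objects in $\mathrm{SupLat}$, with unit $1$, product $a.b=ab$, counit $\epsilon$, and Sweedler notation $\Delta(a)=a_{(1)}\otimes a_{(2)}$ (joins suppressed). A co-quasitriangular structure on $\mathcal{H}$ is a convolution-invertible morphism $\mathcal{R}:\mathcal{H}\otimes\mathcal{H}\to\mathcal{P}(1)$, with convolution inverse $\mathcal{R}^{-1}$, satisfying $\mathcal{R}(b_{(1)},a_{(1)})\,a_{(2)}b_{(2)}=b_{(1)}a_{(1)}\,\mathcal{R}(b_{(2)},a_{(2)})$ together with the usual multiplicativity axioms, which in the convention compatible with this relation read $\mathcal{R}(ab,c)=\mathcal{R}(b,c_{(1)})\mathcal{R}(a,c_{(2)})$ and $\mathcal{R}(a,bc)=\mathcal{R}(a_{(1)},b)\mathcal{R}(a_{(2)},c)$. A Drinfeld co-twist on $\mathcal{H}$ is a morphism $\mathcal{F}:\mathcal{H}\otimes\mathcal{H}\to\mathcal{P}(1)$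 for which there is a morphism $\mathcal{F}^{-1}:\mathcal{H}\otimes\mathcal{H}\to\mathcal{P}(1)$ such that for all $a,b,c\in\mathcal{H}$: $\mathcal{F}^{-1}(a_{(1)},b_{(1)})\mathcal{F}(a_{(2)},b_{(2)})=\epsilon(a)\epsilon(b)=\mathcal{F}(a_{(1)},b_{(1)})\mathcal{F}^{-1}(a_{(2)},b_{(2)})$; $\mathcal{F}(a_{(1)}b_{(1)},c)\,\mathcal{F}(a_{(2)},b_{(2)})=\mathcal{F}(a,b_{(1)}c_{(1)})\,\mathcal{F}(b_{(2)},c_{(2)})$; and $\mathcal{F}(a,1)=\epsilon(a)=\mathcal{F}(1,a)$. Remnant: let $D=\bigvee\epsilon^{-1}(\emptyset)$ and let $\mathcal{Q}$ be the quotient of $\mathcal{H}$ identifying $a,b$ whenever $a\vee D=b\vee D$, with projection $\pi:\mathcal{H}\to\mathcal{Q}$, $\pi(a)=\overline a$. Then $\mathcal{Q}$ is a quotient Hopf algebra and $\mathcal{Q}=\mathcal{P}(R(\mathcal{H}))$ for a group $R(\mathcal{H})$, the remnant of $\mathcal{H}$, whose elements are the basis elements of $\mathcal{Q}$, with multiplication induced from $\mathcal{H}$ and identity $\overline1$. A co-quasitriangular structure $\mathcal{R}$ induces a braiding operator $r$ on $R(\mathcal{H})$, given by $r(\overline a,\overline b)=\mathcal{R}(a_{(1)},b_{(1)})\cdot(\pi(b_{(2)}),\pi(a_{(2)}))\cdot\mathcal{R}^{-1}(a_{(3)},b_{(3)})$; the remnant skew brace is the group $R(\mathcal{H})$ with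 this braiding operator. For a map $f:G^2\to G^2$, $f_{12}=f\times\mathrm{id}$, $f_{23}=\mathrm{id}\times f$; for a group $(G,m,e)$, $m_{12}(x,y,z)=(xy,z)$, $m_{23}(x,y,z)=(x,yz)$. A braiding operator on $(G,m,e)$ is a map $r:G^2\to G^2$ with $r(e,g)=(g,e)$, $r(g,e)=(e,g)$, $rm_{12}=m_{23}r_{12}r_{23}$, $rm_{23}=m_{12}r_{23}r_{12}$, $mr=m$. Groups with braiding operators are equivalent to skew braces and the terms are used interchangeably. A Drinfeld twist on a group $(G,m,e)$ with braiding operator $r$ is a triple of invertible maps $F:G^2\to G^2$, $\Phi,\Psi:G^3\to G^3$ with $F_{12}\Psi=F_{23}\Phi$, $\Phi r_{23}=r_{23}\Phi$, $\Psi r_{12}=r_{12}\Psi$, and for all $x,y,z\in G$: $\Psi(x,y,e)=(x,y,e)$, $\Phi(e,x,y)=(e,x,y)$, $F(e,x)=(e,x)$, $F(x,e)=(x,e)$, $m_{23}\Phi(x,y,z)=F(x,yz)$, $m_{12}\Psi(x,y,z)=F(xy,z)$. *)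

theory Defs
  imports "HOL-Algebra.Group"
begin

section \<open>Complete lattices, join-preserving maps and their tensor product\<close>

text \<open>
  The objects of SupLat are the types of class \<^class>\<open>complete_lattice\<close>. The unit object, the
  two-element lattice \<open>P(1)\<close>, is \<^typ>\<open>bool\<close>: \<^const>\<open>False\<close> is the bottom element, joins are
  disjunctions, and multiplication of scalars is conjunction.
  HOL-Algebra hides the lattice operation \<open>sup\<close>, hence the long name \<open>sup_class.sup\<close> below.
\<close>

definition join_preserving :: "('a::complete_lattice \<Rightarrow> 'b::complete_lattice) \<Rightarrow> bool" where
  "join_preserving f \<longleftrightarrow> (\<forall>A. f (Sup A) = Sup (f ` A))"

definition bi_join_preserving ::
    "('a::complete_lattice \<Rightarrow> 'b::complete_lattice \<Rightarrow> 'c::complete_lattice) \<Rightarrow> bool" where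
  "bi_join_preserving f \<longleftrightarrow>
     (\<forall>b. join_preserving (\<lambda>a. f a b)) \<and> (\<forall>a. join_preserving (\<lambda>b. f a b))"

definition scalar :: "bool \<Rightarrow> 'a::complete_lattice \<Rightarrow> 'a"  (infixr \<open>\<bullet>\<close> 71) where
  "s \<bullet> a = (if s then a else bot)"

text \<open>
  An element of the tensor product is represented by the set of all pairs \<open>(a, b)\<close> whose pure
  tensor lies below it. The sets arising in this way are those that are closed under joins in each
  variable and downward closed; the empty families give all pairs with a bottom component.
\<close>

definition bi_ideal :: "('a::complete_lattice \<times> 'b::complete_lattice) set \<Rightarrow> bool" where
  "bi_ideal I \<longleftrightarrow>
     (\<forall>A b. (Sup A, b) \<in> I \<longleftrightarrow> (\<forall>a\<in>A. (a, b) \<in> I)) \<and>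
     (\<forall>a B. (a, Sup B) \<in> I \<longleftrightarrow> (\<forall>b\<in>B. (a, b) \<in> I))"

typedef (overloaded) ('a::complete_lattice, 'b::complete_lattice) tensor =
    "{I :: ('a \<times> 'b) set. bi_ideal I}"
  morphisms pairs_below Abs_tensor
  by (rule exI[of _ UNIV]) (simp add: bi_ideal_def)

setup_lifting type_definition_tensor

lemma bi_ideal_Inter: "(\<And>I. I \<in> \<I> \<Longrightarrow> bi_ideal I) \<Longrightarrow> bi_ideal (\<Inter>\<I>)"
  unfolding bi_ideal_def by (intro conjI allI) (simp, blast)+

instantiation tensor :: (complete_lattice, complete_lattice) complete_lattice
begin

lift_definition less_eq_tensor :: "('a, 'b) tensor \<Rightarrow> ('a, 'b) tensor \<Rightarrow> bool" is "(\<subseteq>)" .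

definition less_tensor :: "('a, 'b) tensor \<Rightarrow> ('a, 'b) tensor \<Rightarrow> bool" where
  "less_tensor s t \<longleftrightarrow> s \<le> t \<and> \<not> t \<le> s"

lift_definition Inf_tensor :: "('a, 'b) tensor set \<Rightarrow> ('a, 'b) tensor" is "\<lambda>\<I>. \<Inter>\<I>"
  by (rule bi_ideal_Inter) auto

definition Sup_tensor :: "('a, 'b) tensor set \<Rightarrow> ('a, 'b) tensor" where
  "Sup_tensor T = Inf {u. \<forall>t\<in>T. t \<le> u}"

definition inf_tensor :: "('a, 'b) tensor \<Rightarrow> ('a, 'b) tensor \<Rightarrow> ('a, 'b) tensor" where
  "inf_tensor s t = Inf {s, t}"

definition sup_tensor :: "('a, 'b) tensor \<Rightarrow> ('a, 'b) tensor \<Rightarrow> ('a, 'b) tensor" where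
  "sup_tensor s t = Sup {s, t}"

definition bot_tensor :: "('a, 'b) tensor" where
  "bot_tensor = Sup {}"

definition top_tensor :: "('a, 'b) tensor" where
  "top_tensor = Inf {}"

instance
proof -
  have refl: "t \<le> t" for t :: "('a, 'b) tensor"
    by transfer simp
  have trans: "s \<le> t \<Longrightarrow> t \<le> u \<Longrightarrow> s \<le> u" for s t u :: "('a, 'b) tensor"
    by transfer blast
  have antisym: "s \<le> t \<Longrightarrow> t \<le> s \<Longrightarrow> s = t" for s t :: "('a, 'b) tensor"
    by transfer blast
  have lower: "Inf T \<le> t" if "t \<in> T" for t :: "('a, 'b) tensor" and T
    using that by transfer blast
  have greatest: "s \<le> Inf T" if "\<And>t. t \<in> T \<Longrightarrow> s \<le> t" for s :: "('a, 'b) tensor" and T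
    using that by transfer blast
  have upper: "t \<le> Sup T" if "t \<in> T" for t :: "('a, 'b) tensor" and T
    unfolding Sup_tensor_def using that by (intro greatest) auto
  have least: "Sup T \<le> u" if "\<And>t. t \<in> T \<Longrightarrow> t \<le> u" for u :: "('a, 'b) tensor" and T
    unfolding Sup_tensor_def using that by (intro lower) auto
  show "OFCLASS(('a, 'b) tensor, complete_lattice_class)"
    by intro_classes
      (auto simp: less_tensor_def inf_tensor_def sup_tensor_def bot_tensor_def top_tensor_def
        intro: refl antisym trans lower greatest upper least)
qed

end

definition pure_tensor ::
    "'a::complete_lattice \<Rightarrow> 'b::complete_lattice \<Rightarrow> ('a, 'b) tensor"  (infixr \<open>\<otimes>\<^sub>S\<close> 72) where
  "a \<otimes>\<^sub>S b = Inf {t. (a, b) \<in> pairs_below t}"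

text \<open>
  The join-preserving extension of a map that preserves joins in each variable. This also gives
  Sweedler notation: if \<open>t\<close> is the join of pure tensors
  \<open>t\<^sub>1 \<otimes>\<^sub>S t\<^sub>2\<close>, then \<open>tensor_lift f t\<close> is the join of the elements \<open>f t\<^sub>1 t\<^sub>2\<close>.
\<close>

definition tensor_lift ::
    "('a::complete_lattice \<Rightarrow> 'b::complete_lattice \<Rightarrow> 'c::complete_lattice) \<Rightarrow> ('a, 'b) tensor \<Rightarrow> 'c" where
  "tensor_lift f t = Sup {f a b | a b. a \<otimes>\<^sub>S b \<le> t}"

lemma in_pairs_below_iff: "(a, b) \<in> pairs_below t \<longleftrightarrow> a \<otimes>\<^sub>S b \<le> t"
proof
  assume "(a, b) \<in> pairs_below t"
  then show "a \<otimes>\<^sub>S b \<le> t"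
    unfolding pure_tensor_def by (intro Inf_lower) simp
next
  assume "a \<otimes>\<^sub>S b \<le> t"
  then have "pairs_below (a \<otimes>\<^sub>S b) \<subseteq> pairs_below t"
    by (simp add: less_eq_tensor.rep_eq)
  moreover have "(a, b) \<in> pairs_below (a \<otimes>\<^sub>S b)"
    unfolding pure_tensor_def by (simp add: Inf_tensor.rep_eq)
  ultimately show "(a, b) \<in> pairs_below t" by blast
qed

lemma tensor_eq_Sup_pure: "t = Sup {a \<otimes>\<^sub>S b | a b. a \<otimes>\<^sub>S b \<le> t}"
proof (rule antisym)
  let ?s = "Sup {a \<otimes>\<^sub>S b | a b. a \<otimes>\<^sub>S b \<le> t}"
  have "(a, b) \<in> pairs_below ?s" if "(a, b) \<in> pairs_below t" for a b
    unfolding in_pairs_below_iff by (rule Sup_upper) (use that in \<open>auto simp: in_pairs_below_iff\<close>)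
  then show "t \<le> ?s" by (auto simp: less_eq_tensor.rep_eq)
  show "?s \<le> t" by (rule Sup_least) auto
qed

lemma pure_tensor_bi_join_preserving: "bi_join_preserving (\<otimes>\<^sub>S)"
proof -
  have bi: "bi_ideal (pairs_below t)" for t :: "('a, 'b) tensor"
    using pairs_below by simp
  have l: "Sup A \<otimes>\<^sub>S b \<le> t \<longleftrightarrow> (\<forall>a\<in>A. a \<otimes>\<^sub>S b \<le> t)" for A :: "'a set" and b :: 'b and t :: "('a, 'b) tensor"
    using bi[of t] unfolding bi_ideal_def in_pairs_below_iff by blast
  have r: "a \<otimes>\<^sub>S Sup B \<le> t \<longleftrightarrow> (\<forall>b\<in>B. a \<otimes>\<^sub>S b \<le> t)" for a :: 'a and B :: "'b set" and t :: "('a, 'b) tensor"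
    using bi[of t] unfolding bi_ideal_def in_pairs_below_iff by blast
  have "Sup A \<otimes>\<^sub>S b = Sup ((\<lambda>a. a \<otimes>\<^sub>S b) ` A)" for A :: "'a set" and b :: 'b
  proof (rule antisym)
    show "Sup A \<otimes>\<^sub>S b \<le> Sup ((\<lambda>a. a \<otimes>\<^sub>S b) ` A)"
      unfolding l by (blast intro: Sup_upper)
    have "\<forall>a\<in>A. a \<otimes>\<^sub>S b \<le> Sup A \<otimes>\<^sub>S b" unfolding l[symmetric] ..
    then show "Sup ((\<lambda>a. a \<otimes>\<^sub>S b) ` A) \<le> Sup A \<otimes>\<^sub>S b" by (simp add: Sup_le_iff)
  qed
  moreover have "a \<otimes>\<^sub>S Sup B = Sup ((\<lambda>b. a \<otimes>\<^sub>S b) ` B)" for a :: 'a and B :: "'b set"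
  proof (rule antisym)
    show "a \<otimes>\<^sub>S Sup B \<le> Sup ((\<lambda>b. a \<otimes>\<^sub>S b) ` B)"
      unfolding r by (blast intro: Sup_upper)
    have "\<forall>b\<in>B. a \<otimes>\<^sub>S b \<le> a \<otimes>\<^sub>S Sup B" unfolding r[symmetric] ..
    then show "Sup ((\<lambda>b. a \<otimes>\<^sub>S b) ` B) \<le> a \<otimes>\<^sub>S Sup B" by (simp add: Sup_le_iff)
  qed
  ultimately show ?thesis
    unfolding bi_join_preserving_def join_preserving_def by blast
qed

lemma tensor_lift_le_iff:
  "tensor_lift f t \<le> c \<longleftrightarrow> (\<forall>(a, b)\<in>pairs_below t. f a b \<le> c)"
  unfolding tensor_lift_def by (fastforce simp: Sup_le_iff in_pairs_below_iff)

text \<open>The universal property of the tensor product.\<close>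

theorem tensor_universal:
  fixes f :: "'a::complete_lattice \<Rightarrow> 'b::complete_lattice \<Rightarrow> 'c::complete_lattice"
  assumes f: "bi_join_preserving f"
  shows "join_preserving (tensor_lift f)"
    and "tensor_lift f (a \<otimes>\<^sub>S b) = f a b"
    and "join_preserving g \<Longrightarrow> (\<And>a b. g (a \<otimes>\<^sub>S b) = f a b) \<Longrightarrow> g = tensor_lift f"
proof -
  define G where "G c = Abs_tensor {(a, b). f a b \<le> c}" for c
  have "bi_ideal {(a, b). f a b \<le> c}" for c
    using f unfolding bi_join_preserving_def join_preserving_def bi_ideal_def
    by (auto simp: Sup_le_iff)
  then have G: "pairs_below (G c) = {(a, b). f a b \<le> c}" for c
    unfolding G_def by (simp add: Abs_tensor_inverse)
  have adj: "tensor_lift f t \<le> c \<longleftrightarrow> t \<le> G c" for t c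
    by (auto simp: tensor_lift_le_iff less_eq_tensor.rep_eq G)
  show "join_preserving (tensor_lift f)"
    unfolding join_preserving_def
  proof
    fix A
    have "tensor_lift f (Sup A) \<le> c \<longleftrightarrow> Sup (tensor_lift f ` A) \<le> c" for c
      by (auto simp: adj Sup_le_iff)
    then show "tensor_lift f (Sup A) = Sup (tensor_lift f ` A)"
      by (meson antisym order_refl)
  qed
  have "tensor_lift f (a \<otimes>\<^sub>S b) \<le> c \<longleftrightarrow> f a b \<le> c" for a b c
    by (simp add: adj in_pairs_below_iff[symmetric] G)
  then show "tensor_lift f (a \<otimes>\<^sub>S b) = f a b" for a b
    by (meson antisym order_refl)
  show "g = tensor_lift f" if g: "join_preserving g" "\<And>a b. g (a \<otimes>\<^sub>S b) = f a b"
  proof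
    fix t
    have "g t = g (Sup {a \<otimes>\<^sub>S b | a b. a \<otimes>\<^sub>S b \<le> t})" using tensor_eq_Sup_pure[of t] by simp
    also have "\<dots> = Sup (g ` {a \<otimes>\<^sub>S b | a b. a \<otimes>\<^sub>S b \<le> t})"
      using g(1) unfolding join_preserving_def by blast
    also have "g ` {a \<otimes>\<^sub>S b | a b. a \<otimes>\<^sub>S b \<le> t} = {f a b | a b. a \<otimes>\<^sub>S b \<le> t}"
      by (auto simp: g(2)[symmetric])
    finally show "g t = tensor_lift f t" by (simp add: tensor_lift_def)
  qed
qed

definition tensor_map ::
    "('a::complete_lattice \<Rightarrow> 'c::complete_lattice) \<Rightarrow> ('b::complete_lattice \<Rightarrow> 'd::complete_lattice) \<Rightarrow>
     ('a, 'b) tensor \<Rightarrow> ('c, 'd) tensor" where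
  "tensor_map f g = tensor_lift (\<lambda>a b. f a \<otimes>\<^sub>S g b)"

definition tensor_assoc ::
    "(('a::complete_lattice, 'b::complete_lattice) tensor, 'c::complete_lattice) tensor \<Rightarrow>
     ('a, ('b, 'c) tensor) tensor" where
  "tensor_assoc = tensor_lift (\<lambda>t c. tensor_lift (\<lambda>a b. a \<otimes>\<^sub>S b \<otimes>\<^sub>S c) t)"


section \<open>Hopf algebras in SupLat\<close>

text \<open>
  Algebra objects with a counit that is a morphism of algebras; the assumptions on \<open>Sup\<close> say that
  multiplication preserves joins in each variable and that the counit preserves joins. These data
  form a type class because the quotient \<open>Q\<close> below depends on them and is to be a type. The
  coalgebra structure and the antipode are added in the locale \<open>suplat_hopf_algebra\<close>.
\<close>

class suplat_augmented_algebra = complete_lattice + monoid_mult +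
  fixes counit :: "'a \<Rightarrow> bool"
  assumes Sup_mult: "Sup A * b = Sup ((\<lambda>a. a * b) ` A)"
    and mult_Sup: "a * Sup B = Sup ((\<lambda>b. a * b) ` B)"
    and counit_Sup: "counit (Sup A) \<longleftrightarrow> (\<exists>a\<in>A. counit a)"
    and counit_mult: "counit (a * b) \<longleftrightarrow> counit a \<and> counit b"
    and counit_one: "counit 1"

locale suplat_hopf_algebra =
  fixes \<Delta> :: "'h::suplat_augmented_algebra \<Rightarrow> ('h, 'h) tensor"
    and S :: "'h \<Rightarrow> 'h"
  assumes comult_join_preserving: "join_preserving \<Delta>"
    and antipode_join_preserving: "join_preserving S"
    and comult_coassoc: "tensor_assoc (tensor_map \<Delta> id (\<Delta> a)) = tensor_map id \<Delta> (\<Delta> a)"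
    and counit_left: "tensor_lift (\<lambda>a1 a2. counit a1 \<bullet> a2) (\<Delta> a) = a"
    and counit_right: "tensor_lift (\<lambda>a1 a2. counit a2 \<bullet> a1) (\<Delta> a) = a"
    and comult_mult:
      "\<Delta> (a * b) =
         tensor_lift (\<lambda>a1 a2. tensor_lift (\<lambda>b1 b2. (a1 * b1) \<otimes>\<^sub>S (a2 * b2)) (\<Delta> b)) (\<Delta> a)"
    and comult_one: "\<Delta> 1 = 1 \<otimes>\<^sub>S 1"
    and antipode_left: "tensor_lift (\<lambda>a1 a2. S a1 * a2) (\<Delta> a) = counit a \<bullet> 1"
    and antipode_right: "tensor_lift (\<lambda>a1 a2. a1 * S a2) (\<Delta> a) = counit a \<bullet> 1"

definition sweedler ::
    "('h::complete_lattice \<Rightarrow> ('h, 'h) tensor) \<Rightarrow> 'h \<Rightarrow> ('h \<Rightarrow> 'h \<Rightarrow> 'c::complete_lattice) \<Rightarrow> 'c" where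
  "sweedler \<Delta> a f = tensor_lift f (\<Delta> a)"

definition sweedler3 ::
    "('h::complete_lattice \<Rightarrow> ('h, 'h) tensor) \<Rightarrow> 'h \<Rightarrow> ('h \<Rightarrow> 'h \<Rightarrow> 'h \<Rightarrow> 'c::complete_lattice) \<Rightarrow> 'c" where
  "sweedler3 \<Delta> a f = sweedler \<Delta> a (\<lambda>a1 x. sweedler \<Delta> x (\<lambda>a2 a3. f a1 a2 a3))"

definition convolution_inverse ::
    "('h::suplat_augmented_algebra \<Rightarrow> ('h, 'h) tensor) \<Rightarrow>
     (('h, 'h) tensor \<Rightarrow> bool) \<Rightarrow> (('h, 'h) tensor \<Rightarrow> bool) \<Rightarrow> bool" where
  "convolution_inverse \<Delta> K K' \<longleftrightarrow>
     (\<forall>a b. sweedler \<Delta> a (\<lambda>a1 a2. sweedler \<Delta> b (\<lambda>b1 b2. K' (a1 \<otimes>\<^sub>S b1) \<and> K (a2 \<otimes>\<^sub>S b2)))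
              = (counit a \<and> counit b)) \<and>
     (\<forall>a b. sweedler \<Delta> a (\<lambda>a1 a2. sweedler \<Delta> b (\<lambda>b1 b2. K (a1 \<otimes>\<^sub>S b1) \<and> K' (a2 \<otimes>\<^sub>S b2)))
              = (counit a \<and> counit b))"

text \<open>
  The convolution inverse (which is unique) of a co-quasitriangular structure or of a co-twist is
  kept as an explicit second argument.
\<close>

definition co_quasitriangular ::
    "('h::suplat_augmented_algebra \<Rightarrow> ('h, 'h) tensor) \<Rightarrow>
     (('h, 'h) tensor \<Rightarrow> bool) \<Rightarrow> (('h, 'h) tensor \<Rightarrow> bool) \<Rightarrow> bool" where
  "co_quasitriangular \<Delta> R R' \<longleftrightarrow>
     join_preserving R \<and> join_preserving R' \<and> convolution_inverse \<Delta> R R' \<and>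
     (\<forall>a b. sweedler \<Delta> a (\<lambda>a1 a2. sweedler \<Delta> b (\<lambda>b1 b2. R (b1 \<otimes>\<^sub>S a1) \<bullet> (a2 * b2)))
          = sweedler \<Delta> a (\<lambda>a1 a2. sweedler \<Delta> b (\<lambda>b1 b2. R (b2 \<otimes>\<^sub>S a2) \<bullet> (b1 * a1)))) \<and>
     (\<forall>a b c. R ((a * b) \<otimes>\<^sub>S c) = sweedler \<Delta> c (\<lambda>c1 c2. R (b \<otimes>\<^sub>S c1) \<and> R (a \<otimes>\<^sub>S c2))) \<and>
     (\<forall>a b c. R (a \<otimes>\<^sub>S (b * c)) = sweedler \<Delta> a (\<lambda>a1 a2. R (a1 \<otimes>\<^sub>S b) \<and> R (a2 \<otimes>\<^sub>S c)))"

definition drinfeld_cotwist ::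
    "('h::suplat_augmented_algebra \<Rightarrow> ('h, 'h) tensor) \<Rightarrow>
     (('h, 'h) tensor \<Rightarrow> bool) \<Rightarrow> (('h, 'h) tensor \<Rightarrow> bool) \<Rightarrow> bool" where
  "drinfeld_cotwist \<Delta> F F' \<longleftrightarrow>
     join_preserving F \<and> join_preserving F' \<and> convolution_inverse \<Delta> F F' \<and>
     (\<forall>a b c. sweedler \<Delta> a (\<lambda>a1 a2. sweedler \<Delta> b (\<lambda>b1 b2. F ((a1 * b1) \<otimes>\<^sub>S c) \<and> F (a2 \<otimes>\<^sub>S b2)))
            = sweedler \<Delta> b (\<lambda>b1 b2. sweedler \<Delta> c (\<lambda>c1 c2. F (a \<otimes>\<^sub>S (b1 * c1)) \<and> F (b2 \<otimes>\<^sub>S c2)))) \<and>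
     (\<forall>a. F (a \<otimes>\<^sub>S 1) = counit a) \<and> (\<forall>a. F (1 \<otimes>\<^sub>S a) = counit a)"


section \<open>The remnant\<close>

definition kernel_top :: "'h::suplat_augmented_algebra" where
  "kernel_top = Sup {a. counit a = bot}"

definition kernel_rel :: "'h::suplat_augmented_algebra \<Rightarrow> 'h \<Rightarrow> bool" where
  "kernel_rel a b \<longleftrightarrow> sup_class.sup a kernel_top = sup_class.sup b kernel_top"

quotient_type (overloaded) 'h remnant_quotient = "'h::suplat_augmented_algebra" / kernel_rel
  morphisms remnant_rep remnant_proj
  by (rule equivpI) (auto simp: kernel_rel_def reflp_def symp_def transp_def)

lemma counit_kernel_top: "\<not> counit (kernel_top :: 'h::suplat_augmented_algebra)"
  by (simp add: kernel_top_def counit_Sup)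

lemma le_kernel_top_iff: "a \<le> kernel_top \<longleftrightarrow> \<not> counit (a :: 'h::suplat_augmented_algebra)"
proof
  assume le: "a \<le> kernel_top"
  then have "Sup {a, kernel_top} = kernel_top" by (simp add: sup.absorb2)
  then have "counit a \<Longrightarrow> counit (kernel_top :: 'h)"
    using counit_Sup[of "{a, kernel_top}"] by auto
  then show "\<not> counit a" using counit_kernel_top by blast
next
  assume "\<not> counit a"
  then show "a \<le> kernel_top" unfolding kernel_top_def by (intro Sup_upper) simp
qed

lemma kernel_rel_mult:
  fixes a b c d :: "'h::suplat_augmented_algebra"
  assumes "kernel_rel a b" "kernel_rel c d"
  shows "kernel_rel (a * c) (b * d)"
proof -
  have dist: "sup_class.sup x y * z = sup_class.sup (x * z) (y * z)"
    "z * sup_class.sup x y = sup_class.sup (z * x) (z * y)" for x y z :: 'h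
    using Sup_mult[of "{x, y}" z] mult_Sup[of z "{x, y}"] by simp_all
  have absorb: "kernel_top * z \<le> kernel_top" "z * kernel_top \<le> kernel_top" for z :: 'h
    by (simp_all add: le_kernel_top_iff counit_mult counit_kernel_top)
  have l: "sup_class.sup (sup_class.sup x kernel_top * z) kernel_top
      = sup_class.sup (x * z) kernel_top" for x z :: 'h
    by (simp add: dist sup.assoc sup.absorb2 absorb)
  have r: "sup_class.sup (z * sup_class.sup x kernel_top) kernel_top
      = sup_class.sup (z * x) kernel_top" for x z :: 'h
    by (simp add: dist sup.assoc sup.absorb2 absorb)
  show ?thesis
    using assms l[of a c] l[of b c] r[of b c] r[of b d] unfolding kernel_rel_def by simp
qed

instantiation remnant_quotient :: (suplat_augmented_algebra) "{complete_lattice, times, one}"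
begin

lift_definition times_remnant_quotient ::
    "'a remnant_quotient \<Rightarrow> 'a remnant_quotient \<Rightarrow> 'a remnant_quotient" is "(*)"
  by (rule kernel_rel_mult)

lift_definition one_remnant_quotient :: "'a remnant_quotient" is 1 .

lift_definition less_eq_remnant_quotient ::
    "'a remnant_quotient \<Rightarrow> 'a remnant_quotient \<Rightarrow> bool"
  is "\<lambda>a b. sup_class.sup a kernel_top \<le> sup_class.sup b kernel_top"
  by (simp add: kernel_rel_def)

definition less_remnant_quotient ::
    "'a remnant_quotient \<Rightarrow> 'a remnant_quotient \<Rightarrow> bool" where
  "less_remnant_quotient x y \<longleftrightarrow> x \<le> y \<and> \<not> y \<le> x"

definition Sup_remnant_quotient :: "'a remnant_quotient set \<Rightarrow> 'a remnant_quotient" where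
  "Sup_remnant_quotient X = remnant_proj (Sup {a. remnant_proj a \<in> X})"

definition Inf_remnant_quotient :: "'a remnant_quotient set \<Rightarrow> 'a remnant_quotient" where
  "Inf_remnant_quotient X = Sup {y. \<forall>x\<in>X. y \<le> x}"

definition sup_remnant_quotient ::
    "'a remnant_quotient \<Rightarrow> 'a remnant_quotient \<Rightarrow> 'a remnant_quotient" where
  "sup_remnant_quotient x y = Sup {x, y}"

definition inf_remnant_quotient ::
    "'a remnant_quotient \<Rightarrow> 'a remnant_quotient \<Rightarrow> 'a remnant_quotient" where
  "inf_remnant_quotient x y = Inf {x, y}"

definition bot_remnant_quotient :: "'a remnant_quotient" where
  "bot_remnant_quotient = Sup {}"

definition top_remnant_quotient :: "'a remnant_quotient" where
  "top_remnant_quotient = Inf {}"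

instance
proof -
  have refl: "x \<le> x" for x :: "'a remnant_quotient"
    by transfer simp
  have trans: "x \<le> y \<Longrightarrow> y \<le> z \<Longrightarrow> x \<le> z" for x y z :: "'a remnant_quotient"
    by transfer (rule order_trans)
  have antisym: "x \<le> y \<Longrightarrow> y \<le> x \<Longrightarrow> x = y" for x y :: "'a remnant_quotient"
    by transfer (unfold kernel_rel_def, rule order.antisym)
  have le: "remnant_proj a \<le> remnant_proj b \<longleftrightarrow> a \<le> sup_class.sup b kernel_top" for a b :: 'a
    by (simp add: less_eq_remnant_quotient.abs_eq)
  have surj: "\<exists>a. x = remnant_proj a" for x :: "'a remnant_quotient"
    by (metis Quotient3_abs_rep Quotient3_remnant_quotient)
  have upper: "x \<le> Sup X" if "x \<in> X" for x :: "'a remnant_quotient" and X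
  proof -
    obtain a where a: "x = remnant_proj a" using surj by blast
    have "a \<le> Sup {a. remnant_proj a \<in> X}" using that a by (intro Sup_upper) simp
    then show ?thesis by (simp add: Sup_remnant_quotient_def a le le_supI1)
  qed
  have least: "Sup X \<le> z" if "\<And>x. x \<in> X \<Longrightarrow> x \<le> z" for z :: "'a remnant_quotient" and X
  proof -
    obtain c where c: "z = remnant_proj c" using surj by blast
    have "Sup {a. remnant_proj a \<in> X} \<le> sup_class.sup c kernel_top"
      by (rule Sup_least) (use that c le in blast)
    then show ?thesis by (simp add: Sup_remnant_quotient_def c le)
  qed
  have lower: "Inf X \<le> x" if "x \<in> X" for x :: "'a remnant_quotient" and X
    unfolding Inf_remnant_quotient_def using that by (intro least) auto
  have greatest: "z \<le> Inf X" if "\<And>x. x \<in> X \<Longrightarrow> z \<le> x" for z :: "'a remnant_quotient" and X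
    unfolding Inf_remnant_quotient_def using that by (intro upper) auto
  show "OFCLASS('a remnant_quotient, complete_lattice_class)"
    by intro_classes
      (auto simp: less_remnant_quotient_def inf_remnant_quotient_def sup_remnant_quotient_def
        bot_remnant_quotient_def top_remnant_quotient_def
        intro: refl antisym trans lower greatest upper least)
qed intro_classes

end

lemma remnant_proj_join_preserving: "join_preserving remnant_proj"
  unfolding join_preserving_def
proof
  fix A :: "'h::suplat_augmented_algebra set"
  have le: "remnant_proj a \<le> remnant_proj b \<longleftrightarrow> a \<le> sup_class.sup b kernel_top" for a b :: 'h
    by (simp add: less_eq_remnant_quotient.abs_eq)
  have surj: "\<exists>a. x = remnant_proj a" for x :: "'h remnant_quotient"
    by (metis Quotient3_abs_rep Quotient3_remnant_quotient)
  have "remnant_proj (Sup A) \<le> z \<longleftrightarrow> Sup (remnant_proj ` A) \<le> z" for z :: "'h remnant_quotient"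
    using surj[of z] by (auto simp: Sup_le_iff le)
  then show "remnant_proj (Sup A) = Sup (remnant_proj ` A)"
    by (meson order.antisym order.refl)
qed

text \<open>
  \<open>L\<close> is the free complete join-lattice \<open>P(B)\<close> on its subset \<open>B\<close> if every element is the join of
  a unique subset of \<open>B\<close>. By the lemma below such a \<open>B\<close> is unique if it exists, so that
  \<open>basis_elements\<close> consists of the elements of that basis.
\<close>

definition free_basis :: "'a::complete_lattice set \<Rightarrow> bool" where
  "free_basis B \<longleftrightarrow> bij_betw Sup (Pow B) UNIV"

definition basis_elements :: "'a::complete_lattice set" where
  "basis_elements = \<Union>{B. free_basis B}"

lemma free_basis_unique:
  fixes B C :: "'a::complete_lattice set"
  assumes "free_basis B" "free_basis C"
  shows "B = C"
proof -
  have "x \<in> B" if B: "free_basis B" and C: "free_basis C" and x: "x \<in> C"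
    for B C :: "'a set" and x
  proof -
    obtain S where S: "S \<subseteq> B" "x = Sup S"
      using B unfolding free_basis_def bij_betw_def by (metis UNIV_I imageE PowD)
    have "\<exists>T. T \<subseteq> C \<and> s = Sup T" for s
      using C unfolding free_basis_def bij_betw_def by (metis UNIV_I imageE PowD)
    then obtain T where T: "\<And>s. T s \<subseteq> C" "\<And>s. s = Sup (T s)" by metis
    have inj: "\<And>U V. U \<subseteq> C \<Longrightarrow> V \<subseteq> C \<Longrightarrow> Sup U = Sup V \<Longrightarrow> U = V"
      using C unfolding free_basis_def bij_betw_def inj_on_def by blast
    have "Sup (\<Union>(T ` S)) = Sup {x}"
    proof (rule antisym)
      show "Sup (\<Union>(T ` S)) \<le> Sup {x}"
      proof (rule Sup_least)
        fix y assume "y \<in> \<Union>(T ` S)"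
        then obtain s where s: "s \<in> S" "y \<in> T s" by blast
        have "y \<le> Sup (T s)" using s(2) by (rule Sup_upper)
        also have "\<dots> = s" using T(2)[of s] by (rule sym)
        also have "s \<le> x" unfolding S(2) using s(1) by (rule Sup_upper)
        finally show "y \<le> Sup {x}" by simp
      qed
      have "s \<le> Sup (\<Union>(T ` S))" if "s \<in> S" for s
      proof -
        have "s = Sup (T s)" by (rule T(2))
        also have "\<dots> \<le> Sup (\<Union>(T ` S))" by (rule Sup_subset_mono) (use that in blast)
        finally show ?thesis .
      qed
      then show "Sup {x} \<le> Sup (\<Union>(T ` S))" using S(2) by (simp add: Sup_le_iff)
    qed
    then have U: "\<Union>(T ` S) = {x}" using T(1) x by (intro inj) auto
    then obtain s where s: "s \<in> S" "x \<in> T s" by blast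
    then have "T s = {x}" using U by blast
    then have "s = x" using T(2)[of s] by simp
    then show "x \<in> B" using s(1) S(1) by blast
  qed
  with assms show ?thesis by blast
qed

definition remnant :: "'h::suplat_augmented_algebra remnant_quotient monoid" where
  "remnant = \<lparr>carrier = basis_elements, mult = (\<lambda>x y. x * y), one = 1\<rparr>"

text \<open>
  A map on pairs or triples of elements of the remnant is induced by an expression in
  representatives with values in \<open>Q \<otimes> Q\<close> or \<open>Q \<otimes> Q \<otimes> Q\<close> if these values are the
  corresponding pure tensors of basis elements, for all choices of representatives.
\<close>

definition induces2 ::
    "('h::suplat_augmented_algebra \<Rightarrow> 'h \<Rightarrow> ('h remnant_quotient, 'h remnant_quotient) tensor) \<Rightarrow>
     ('h remnant_quotient \<times> 'h remnant_quotient \<Rightarrow> 'h remnant_quotient \<times> 'h remnant_quotient) \<Rightarrow>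
     bool" where
  "induces2 T f \<longleftrightarrow>
     (\<forall>a b. remnant_proj a \<in> carrier remnant \<and> remnant_proj b \<in> carrier remnant \<longrightarrow>
        (\<exists>u\<in>carrier remnant. \<exists>v\<in>carrier remnant.
           f (remnant_proj a, remnant_proj b) = (u, v) \<and> T a b = u \<otimes>\<^sub>S v))"

definition induces3 ::
    "('h::suplat_augmented_algebra \<Rightarrow> 'h \<Rightarrow> 'h \<Rightarrow>
        ('h remnant_quotient, ('h remnant_quotient, 'h remnant_quotient) tensor) tensor) \<Rightarrow>
     ('h remnant_quotient \<times> 'h remnant_quotient \<times> 'h remnant_quotient \<Rightarrow>
      'h remnant_quotient \<times> 'h remnant_quotient \<times> 'h remnant_quotient) \<Rightarrow>
     bool" where
  "induces3 T f \<longleftrightarrow>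
     (\<forall>a b c. remnant_proj a \<in> carrier remnant \<and> remnant_proj b \<in> carrier remnant \<and>
        remnant_proj c \<in> carrier remnant \<longrightarrow>
        (\<exists>u\<in>carrier remnant. \<exists>v\<in>carrier remnant. \<exists>w\<in>carrier remnant.
           f (remnant_proj a, remnant_proj b, remnant_proj c) = (u, v, w) \<and>
           T a b c = u \<otimes>\<^sub>S v \<otimes>\<^sub>S w))"

definition braiding_expr ::
    "('h::suplat_augmented_algebra \<Rightarrow> ('h, 'h) tensor) \<Rightarrow>
     (('h, 'h) tensor \<Rightarrow> bool) \<Rightarrow> (('h, 'h) tensor \<Rightarrow> bool) \<Rightarrow>
     'h \<Rightarrow> 'h \<Rightarrow> ('h remnant_quotient, 'h remnant_quotient) tensor" where
  "braiding_expr \<Delta> R R' a b =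
     sweedler3 \<Delta> a (\<lambda>a1 a2 a3. sweedler3 \<Delta> b (\<lambda>b1 b2 b3.
       R (a1 \<otimes>\<^sub>S b1) \<bullet> R' (a3 \<otimes>\<^sub>S b3) \<bullet> (remnant_proj b2 \<otimes>\<^sub>S remnant_proj a2)))"

definition remnant_braiding ::
    "('h::suplat_augmented_algebra \<Rightarrow> ('h, 'h) tensor) \<Rightarrow>
     (('h, 'h) tensor \<Rightarrow> bool) \<Rightarrow> (('h, 'h) tensor \<Rightarrow> bool) \<Rightarrow>
     'h remnant_quotient \<times> 'h remnant_quotient \<Rightarrow> 'h remnant_quotient \<times> 'h remnant_quotient" where
  "remnant_braiding \<Delta> R R' = (\<lambda>(x, y). THE (u, v).
     u \<in> carrier remnant \<and> v \<in> carrier remnant \<and>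
     (\<forall>a b. remnant_proj a = x \<and> remnant_proj b = y \<longrightarrow> braiding_expr \<Delta> R R' a b = u \<otimes>\<^sub>S v))"

text \<open>
  The expressions inducing the components of the twist: conjugation by
  \<open>F (a, b)\<close>, by \<open>F (a, b c)\<close> and by \<open>F (a b, c)\<close>, respectively.
\<close>

definition twist_F_expr ::
    "('h::suplat_augmented_algebra \<Rightarrow> ('h, 'h) tensor) \<Rightarrow>
     (('h, 'h) tensor \<Rightarrow> bool) \<Rightarrow> (('h, 'h) tensor \<Rightarrow> bool) \<Rightarrow>
     'h \<Rightarrow> 'h \<Rightarrow> ('h remnant_quotient, 'h remnant_quotient) tensor" where
  "twist_F_expr \<Delta> F F' a b =
     sweedler3 \<Delta> a (\<lambda>a1 a2 a3. sweedler3 \<Delta> b (\<lambda>b1 b2 b3.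
       F (a1 \<otimes>\<^sub>S b1) \<bullet> F' (a3 \<otimes>\<^sub>S b3) \<bullet> (remnant_proj a2 \<otimes>\<^sub>S remnant_proj b2)))"

definition twist_Phi_expr ::
    "('h::suplat_augmented_algebra \<Rightarrow> ('h, 'h) tensor) \<Rightarrow>
     (('h, 'h) tensor \<Rightarrow> bool) \<Rightarrow> (('h, 'h) tensor \<Rightarrow> bool) \<Rightarrow>
     'h \<Rightarrow> 'h \<Rightarrow> 'h \<Rightarrow>
     ('h remnant_quotient, ('h remnant_quotient, 'h remnant_quotient) tensor) tensor" where
  "twist_Phi_expr \<Delta> F F' a b c =
     sweedler3 \<Delta> a (\<lambda>a1 a2 a3. sweedler3 \<Delta> b (\<lambda>b1 b2 b3. sweedler3 \<Delta> c (\<lambda>c1 c2 c3.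
       F (a1 \<otimes>\<^sub>S (b1 * c1)) \<bullet> F' (a3 \<otimes>\<^sub>S (b3 * c3)) \<bullet>
         (remnant_proj a2 \<otimes>\<^sub>S remnant_proj b2 \<otimes>\<^sub>S remnant_proj c2))))"

definition twist_Psi_expr ::
    "('h::suplat_augmented_algebra \<Rightarrow> ('h, 'h) tensor) \<Rightarrow>
     (('h, 'h) tensor \<Rightarrow> bool) \<Rightarrow> (('h, 'h) tensor \<Rightarrow> bool) \<Rightarrow>
     'h \<Rightarrow> 'h \<Rightarrow> 'h \<Rightarrow>
     ('h remnant_quotient, ('h remnant_quotient, 'h remnant_quotient) tensor) tensor" where
  "twist_Psi_expr \<Delta> F F' a b c =
     sweedler3 \<Delta> a (\<lambda>a1 a2 a3. sweedler3 \<Delta> b (\<lambda>b1 b2 b3. sweedler3 \<Delta> c (\<lambda>c1 c2 c3.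
       F ((a1 * b1) \<otimes>\<^sub>S c1) \<bullet> F' ((a3 * b3) \<otimes>\<^sub>S c3) \<bullet>
         (remnant_proj a2 \<otimes>\<^sub>S remnant_proj b2 \<otimes>\<^sub>S remnant_proj c2))))"


section \<open>Braiding operators and Drinfeld twists on groups\<close>

definition on12 :: "('g \<times> 'g \<Rightarrow> 'g \<times> 'g) \<Rightarrow> 'g \<times> 'g \<times> 'g \<Rightarrow> 'g \<times> 'g \<times> 'g" where
  "on12 f = (\<lambda>(x, y, z). case f (x, y) of (u, v) \<Rightarrow> (u, v, z))"

definition on23 :: "('g \<times> 'g \<Rightarrow> 'g \<times> 'g) \<Rightarrow> 'g \<times> 'g \<times> 'g \<Rightarrow> 'g \<times> 'g \<times> 'g" where
  "on23 f = (\<lambda>(x, y, z). case f (y, z) of (v, w) \<Rightarrow> (x, v, w))"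

definition mult12 :: "('g, 'm) monoid_scheme \<Rightarrow> 'g \<times> 'g \<times> 'g \<Rightarrow> 'g \<times> 'g" where
  "mult12 G = (\<lambda>(x, y, z). (x \<otimes>\<^bsub>G\<^esub> y, z))"

definition mult23 :: "('g, 'm) monoid_scheme \<Rightarrow> 'g \<times> 'g \<times> 'g \<Rightarrow> 'g \<times> 'g" where
  "mult23 G = (\<lambda>(x, y, z). (x, y \<otimes>\<^bsub>G\<^esub> z))"

abbreviation carrier2 :: "('g, 'm) monoid_scheme \<Rightarrow> ('g \<times> 'g) set" where
  "carrier2 G \<equiv> carrier G \<times> carrier G"

abbreviation carrier3 :: "('g, 'm) monoid_scheme \<Rightarrow> ('g \<times> 'g \<times> 'g) set" where
  "carrier3 G \<equiv> carrier G \<times> carrier G \<times> carrier G"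

locale braided_group = group G for G (structure) +
  fixes r :: "'a \<times> 'a \<Rightarrow> 'a \<times> 'a"
  assumes braiding_closed: "r \<in> carrier2 G \<rightarrow> carrier2 G"
    and braiding_one_left: "g \<in> carrier G \<Longrightarrow> r (\<one>, g) = (g, \<one>)"
    and braiding_one_right: "g \<in> carrier G \<Longrightarrow> r (g, \<one>) = (\<one>, g)"
    and braiding_mult12: "t \<in> carrier3 G \<Longrightarrow> r (mult12 G t) = mult23 G (on12 r (on23 r t))"
    and braiding_mult23: "t \<in> carrier3 G \<Longrightarrow> r (mult23 G t) = mult12 G (on23 r (on12 r t))"
    and mult_braiding: "p \<in> carrier2 G \<Longrightarrow> (case r p of (u, v) \<Rightarrow> u \<otimes> v) = (case p of (x, y) \<Rightarrow> x \<otimes> y)"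

locale drinfeld_twist = braided_group G r for G (structure) and r +
  fixes F :: "'a \<times> 'a \<Rightarrow> 'a \<times> 'a"
    and \<Phi> \<Psi> :: "'a \<times> 'a \<times> 'a \<Rightarrow> 'a \<times> 'a \<times> 'a"
  assumes F_invertible: "bij_betw F (carrier2 G) (carrier2 G)"
    and Phi_invertible: "bij_betw \<Phi> (carrier3 G) (carrier3 G)"
    and Psi_invertible: "bij_betw \<Psi> (carrier3 G) (carrier3 G)"
    and twist_cocycle: "t \<in> carrier3 G \<Longrightarrow> on12 F (\<Psi> t) = on23 F (\<Phi> t)"
    and Phi_braiding: "t \<in> carrier3 G \<Longrightarrow> \<Phi> (on23 r t) = on23 r (\<Phi> t)"
    and Psi_braiding: "t \<in> carrier3 G \<Longrightarrow> \<Psi> (on12 r t) = on12 r (\<Psi> t)"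
    and Psi_one: "x \<in> carrier G \<Longrightarrow> y \<in> carrier G \<Longrightarrow> \<Psi> (x, y, \<one>) = (x, y, \<one>)"
    and Phi_one: "x \<in> carrier G \<Longrightarrow> y \<in> carrier G \<Longrightarrow> \<Phi> (\<one>, x, y) = (\<one>, x, y)"
    and F_one_left: "x \<in> carrier G \<Longrightarrow> F (\<one>, x) = (\<one>, x)"
    and F_one_right: "x \<in> carrier G \<Longrightarrow> F (x, \<one>) = (x, \<one>)"
    and mult23_Phi: "t \<in> carrier3 G \<Longrightarrow> mult23 G (\<Phi> t) = F (mult23 G t)"
    and mult12_Psi: "t \<in> carrier3 G \<Longrightarrow> mult12 G (\<Psi> t) = F (mult12 G t)"

end

theory Submission
  imports Defs
begin

text \<open>
  Write \<open>G\<close> for the remnant and consider, for \<open>n = 1, 2, 3\<close>, the maps from \<open>n\<close>-tuples of elements of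
  the Hopf algebra to \<open>P(1)\<close> that preserve joins in each variable. Under convolution they form a
  monoid whose unit is the \<open>n\<close>-fold counit \<open>\<epsilon>\<close>. A functional below \<open>\<epsilon>\<close> vanishes as soon as one
  argument lies in the kernel of the counit, so it factors through the quotient \<open>Q = P(G)\<close> in each
  variable and is the same thing as a subset of \<open>G\<^sup>n\<close>; convolution of such functionals is
  intersection. Let \<open>\<delta>\<^sub>p\<close> be the functional of the point \<open>p\<close>. If \<open>K\<close> is an invertible functional,
  then conjugation by \<open>K\<close> permutes the functionals below \<open>\<epsilon>\<close> and preserves their order, so it permutes the minimal
  nonzero ones: for every point \<open>p\<close> there is exactly one point \<open>q\<close> with
  \<open>\<delta>\<^sub>p * K = K * \<delta>\<^sub>q\<close>. This defines a permutation \<open>point_map K\<close> of \<open>G\<^sup>n\<close>.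

  A Sweedler expression that multiplies by \<open>K\<close> on the first factors and by its inverse on the third
  ones evaluates exactly this permutation (\<open>conjugation_expr2_eq\<close>, \<open>conjugation_expr3_eq\<close>). Hence \<open>R\<close>
  induces the braiding operator up to a flip, and the functionals \<open>\<F>(a, b)\<close>, \<open>\<F>(a, b c)\<close> and
  \<open>\<F>(a b, c)\<close> induce \<open>F\<close>, \<open>\<Phi>\<close> and \<open>\<Psi>\<close>. The identities between these maps are images of
  identities between the functionals, by two principles: a convolution product induces the composite
  map (\<open>point_map_conv\<close>), and pulling a functional back along a coalgebra map, such as the
  multiplication in two adjacent variables, a permutation of the variables or the insertion of the unit,
  is compatible with the map of points (\<open>point_map_natural\<close>). The cocycle identity of the co-twist
  becomes \<open>F\<^sub>1\<^sub>2 \<Psi> = F\<^sub>2\<^sub>3 \<Phi>\<close>, the multiplicativity axioms of \<open>R\<close> become the two hexagon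
  identities of the braiding operator, and the braided commutativity of the product, applied to
  \<open>\<F>(a, -)\<close> and \<open>\<F>(-, c)\<close>, says that \<open>\<Phi>\<close> and \<open>\<Psi>\<close> commute with \<open>r\<^sub>2\<^sub>3\<close> and \<open>r\<^sub>1\<^sub>2\<close>; applied to the
  functionals \<open>\<delta>\<^sub>g\<close> it says that \<open>r\<close> preserves the product of its arguments.

  It remains to see that \<open>Q\<close> is the power set of a group. In \<open>Q\<close> the counit vanishes only at the bottom
  element. The antipode axiom shows that 1 is then an atom, so that every unit is an atom
  (\<open>quotient_unit_atom\<close>); splitting an element into three factors and applying the antipode to the
  outer ones shows that the middle factors are units, so that every element is a join of units
  (\<open>quotient_Sup_units\<close>); and the comultiplication separates units, so that a unit below a join of units
  is one of them (\<open>quotient_unit_prime\<close>). Thus the units of \<open>Q\<close> are a free basis.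
\<close>

section \<open>Join-preserving maps and functionals on tensor products\<close>

lemma join_preserving_mono: "join_preserving f \<Longrightarrow> a \<le> b \<Longrightarrow> f a \<le> f b"
  unfolding join_preserving_def
  by (metis Sup_insert Sup_empty image_insert image_empty sup_bot_right le_iff_sup)

lemma join_preserving_sup:
  assumes "join_preserving f" shows "f (sup_class.sup a b) = sup_class.sup (f a) (f b)"
  using assms[unfolded join_preserving_def, THEN spec, of "{a, b}"] by simp

text \<open>
  The extension of a map to the tensor product is defined as a join, so a join-preserving map can be
  moved inside it.
\<close>

lemma join_preserving_tensor_lift:
  assumes "join_preserving g"
  shows "g (tensor_lift f t) = tensor_lift (\<lambda>a b. g (f a b)) t"
proof -
  have "g ` {f a b |a b. a \<otimes>\<^sub>S b \<le> t} = {g (f a b) |a b. a \<otimes>\<^sub>S b \<le> t}" by auto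
  then show ?thesis using assms unfolding tensor_lift_def join_preserving_def by simp
qed

text \<open>
  Sweedler expressions with truth values are existential statements about the pure tensors below the
  comultiplication. The convolution calculus below works with this form.
\<close>

lemma tensor_lift_bool: "tensor_lift f t \<longleftrightarrow> (\<exists>a b. a \<otimes>\<^sub>S b \<le> t \<and> f a b)"
  unfolding tensor_lift_def by (auto simp: Sup_bool_def)

lemma tensor_lift_le:
  "tensor_lift f t \<le> c \<longleftrightarrow> (\<forall>a b. a \<otimes>\<^sub>S b \<le> t \<longrightarrow> f a b \<le> c)"
  by (auto simp: tensor_lift_le_iff in_pairs_below_iff)

lemma pure_tensor_mono:
  assumes "a \<le> c" "b \<le> d" shows "a \<otimes>\<^sub>S b \<le> c \<otimes>\<^sub>S d"
proof -
  have "a \<otimes>\<^sub>S b \<le> c \<otimes>\<^sub>S b" "c \<otimes>\<^sub>S b \<le> c \<otimes>\<^sub>S d"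
    using pure_tensor_bi_join_preserving assms unfolding bi_join_preserving_def
    by (auto intro: join_preserving_mono[of "\<lambda>x. x \<otimes>\<^sub>S b"] join_preserving_mono[of "\<lambda>x. c \<otimes>\<^sub>S x"])
  then show ?thesis by (rule order_trans)
qed

lemma join_preserving_bool: "join_preserving \<phi> \<longleftrightarrow> (\<forall>A. \<phi> (Sup A) \<longleftrightarrow> (\<exists>a\<in>A. \<phi> a))"
  unfolding join_preserving_def by (auto simp: Sup_bool_def)

lemma counit_join_preserving: "join_preserving counit"
  by (simp add: join_preserving_bool counit_Sup)

lemma join_preserving_comp: "join_preserving f \<Longrightarrow> join_preserving g \<Longrightarrow> join_preserving (\<lambda>x. f (g x))"
  unfolding join_preserving_def by (simp add: image_image)

lemma pure_tensor_join_preserving: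
  "join_preserving (\<lambda>a. a \<otimes>\<^sub>S b)" "join_preserving (\<lambda>b. a \<otimes>\<^sub>S b)"
  using pure_tensor_bi_join_preserving unfolding bi_join_preserving_def by auto

lemma join_preserving_bex:
  assumes "\<And>i. i \<in> I \<Longrightarrow> join_preserving (f i)" shows "join_preserving (\<lambda>a. \<exists>i\<in>I. f i a)"
  using assms by (simp add: join_preserving_bool) blast

lemma bi_join_preserving_bool_and:
  assumes "join_preserving \<phi>" "join_preserving \<psi>" shows "bi_join_preserving (\<lambda>a b. \<phi> a \<and> \<psi> b)"
  using assms by (simp add: bi_join_preserving_def join_preserving_bool)

section \<open>The quotient by the kernel of the counit\<close>

lemma proj_le_iff:
  "remnant_proj a \<le> remnant_proj b \<longleftrightarrow> a \<le> sup_class.sup b (kernel_top :: 'h::suplat_augmented_algebra)"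
  by (simp add: less_eq_remnant_quotient.abs_eq)

lemma proj_surj: obtains a where "x = remnant_proj a"
  by (metis Quotient3_abs_rep Quotient3_remnant_quotient)

lemma proj_rep [simp]: "remnant_proj (remnant_rep x) = x"
  by (metis Quotient3_abs_rep Quotient3_remnant_quotient)

lemma proj_mono: "a \<le> b \<Longrightarrow> remnant_proj a \<le> remnant_proj b"
  by (simp add: proj_le_iff le_supI1)

lemma proj_mult: "remnant_proj a * remnant_proj b = remnant_proj (a * b)"
  by (simp add: times_remnant_quotient.abs_eq)

lemma proj_one: "1 = remnant_proj 1"
  by (simp add: one_remnant_quotient_def)

lemma proj_eq_bot_iff: "remnant_proj a = bot \<longleftrightarrow> \<not> counit a"
proof -
  have "remnant_proj bot = (bot :: 'a remnant_quotient)"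
    using remnant_proj_join_preserving[where ?'a='a] unfolding join_preserving_def
    by (metis Sup_empty image_empty)
  then have "remnant_proj a = bot \<longleftrightarrow> a \<le> kernel_top"
    by (metis bot_unique proj_le_iff sup_bot_left)
  then show ?thesis by (simp add: le_kernel_top_iff)
qed

lemma quotient_mult_assoc: "(x * y) * z = x * (y * (z :: 'h::suplat_augmented_algebra remnant_quotient))"
  by (rule proj_surj[of x], rule proj_surj[of y], rule proj_surj[of z])
    (simp add: proj_mult mult.assoc)

lemma quotient_mult_one:
  "1 * x = x" "x * 1 = (x :: 'h::suplat_augmented_algebra remnant_quotient)"
  by (rule proj_surj[of x]; simp add: proj_mult proj_one)+

lemma quotient_mult_eq_bot_iff:
  "x * y = bot \<longleftrightarrow> x = bot \<or> y = (bot :: 'h::suplat_augmented_algebra remnant_quotient)"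
  by (rule proj_surj[of x], rule proj_surj[of y]) (simp add: proj_mult proj_eq_bot_iff counit_mult)

lemma quotient_one_neq_bot: "1 \<noteq> (bot :: 'h::suplat_augmented_algebra remnant_quotient)"
  by (simp add: proj_one proj_eq_bot_iff counit_one)

lemma mult_sup_distrib:
  fixes x y z :: "'h::suplat_augmented_algebra"
  shows "sup_class.sup x y * z = sup_class.sup (x * z) (y * z)"
    "z * sup_class.sup x y = sup_class.sup (z * x) (z * y)"
  using Sup_mult[of "{x, y}" z] mult_Sup[of z "{x, y}"] by simp_all

lemma mult_kernel_top_le:
  fixes z :: "'h::suplat_augmented_algebra"
  shows "kernel_top * z \<le> kernel_top" "z * kernel_top \<le> kernel_top"
  by (simp_all add: le_kernel_top_iff counit_mult counit_kernel_top)

lemma suplat_mult_right_mono: "(a::'h::suplat_augmented_algebra) \<le> b \<Longrightarrow> a * c \<le> b * c"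
  by (metis le_iff_sup mult_sup_distrib(1))

lemma quotient_mult_right_mono:
  assumes "x \<le> (y :: 'h::suplat_augmented_algebra remnant_quotient)" shows "x * z \<le> y * z"
proof -
  obtain a b c where abc: "x = remnant_proj a" "y = remnant_proj b" "z = remnant_proj c"
    by (metis proj_surj)
  have "a * c \<le> sup_class.sup b kernel_top * c"
    using assms by (intro suplat_mult_right_mono) (simp add: abc proj_le_iff)
  also have "\<dots> \<le> sup_class.sup (b * c) kernel_top"
    by (simp add: mult_sup_distrib mult_kernel_top_le le_supI2)
  finally show ?thesis by (simp add: abc proj_le_iff proj_mult)
qed

definition quotient_units :: "'h::suplat_augmented_algebra remnant_quotient set" where
  "quotient_units = {x. \<exists>y. x * y = 1 \<and> y * x = 1}"

lemma quotient_unit_neq_bot: "x \<in> quotient_units \<Longrightarrow> x \<noteq> bot"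
proof
  assume "x \<in> quotient_units" "x = bot"
  then obtain y where "bot * y = (1 :: 'a remnant_quotient)" unfolding quotient_units_def by auto
  then show False using quotient_one_neq_bot quotient_mult_eq_bot_iff by metis
qed

lemma one_mem_quotient_units: "1 \<in> quotient_units"
  unfolding quotient_units_def by (auto intro!: exI[of _ 1] simp: quotient_mult_one)

lemma quotient_units_mult:
  assumes "x \<in> quotient_units" "y \<in> quotient_units" shows "x * y \<in> quotient_units"
proof -
  obtain x' y' where "x * x' = 1" "x' * x = 1" "y * y' = 1" "y' * y = 1"
    using assms unfolding quotient_units_def by blast
  then have "(x * y) * (y' * x') = 1" "(y' * x') * (x * y) = 1"
    by (metis quotient_mult_assoc quotient_mult_one)+
  then show ?thesis unfolding quotient_units_def by blast
qed

lemma mult_join_preserving: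
  "join_preserving (\<lambda>a. a * (b :: 'h::suplat_augmented_algebra))" "join_preserving (\<lambda>b. a * (b :: 'h::suplat_augmented_algebra))"
  unfolding join_preserving_def by (simp_all add: Sup_mult mult_Sup)

section \<open>The units of the quotient form a free basis\<close>

context suplat_hopf_algebra
begin

text \<open>
  By the counit law, \<open>a\<close> is the join of the elements \<open>\<epsilon>(b) c\<close> over the pure tensors \<open>b \<otimes> c\<close> below
  \<open>\<Delta> a\<close>.
\<close>

lemma split_right_le:
  assumes "b \<otimes>\<^sub>S c \<le> \<Delta> a" "counit b" shows "c \<le> a"
proof -
  have "counit b \<bullet> c \<le> a"
    using assms(1) counit_left[of a] by (metis order_refl tensor_lift_le)
  then show ?thesis using assms(2) by (simp add: scalar_def)
qed

lemma split_left_le: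
  assumes "b \<otimes>\<^sub>S c \<le> \<Delta> a" "counit c" shows "b \<le> a"
proof -
  have "counit c \<bullet> b \<le> a"
    using assms(1) counit_right[of a] by (metis (no_types, lifting) order_refl tensor_lift_le)
  then show ?thesis using assms(2) by (simp add: scalar_def)
qed

lemma le_if_split_le:
  assumes "\<And>b c. b \<otimes>\<^sub>S c \<le> \<Delta> a \<Longrightarrow> counit b \<Longrightarrow> c \<le> z" shows "a \<le> z"
proof -
  have "tensor_lift (\<lambda>a1 a2. counit a1 \<bullet> a2) (\<Delta> a) \<le> z"
    using assms by (auto simp: tensor_lift_le scalar_def)
  then show ?thesis by (simp add: counit_left)
qed

lemma le_if_split_le':
  assumes "\<And>b c. b \<otimes>\<^sub>S c \<le> \<Delta> a \<Longrightarrow> counit c \<Longrightarrow> b \<le> z" shows "a \<le> z"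
proof -
  have "tensor_lift (\<lambda>a1 a2. counit a2 \<bullet> a1) (\<Delta> a) \<le> z"
    using assms by (auto simp: tensor_lift_le scalar_def)
  then show ?thesis by (simp add: counit_right)
qed

lemma exists_split:
  assumes "counit a" obtains b c where "b \<otimes>\<^sub>S c \<le> \<Delta> a" "counit b" "counit c"
proof -
  have "counit (tensor_lift (\<lambda>a1 a2. counit a1 \<bullet> a2) (\<Delta> a))" using assms by (simp add: counit_left)
  then have "tensor_lift (\<lambda>a1 a2. counit (counit a1 \<bullet> a2)) (\<Delta> a)"
    by (simp add: join_preserving_tensor_lift[OF counit_join_preserving])
  then show ?thesis using that counit_Sup[of "{}"]
    by (auto simp: tensor_lift_bool scalar_def split: if_splits)
qed

lemma antipode_split_le:
  assumes "b \<otimes>\<^sub>S c \<le> \<Delta> a" shows "S b * c \<le> 1" "b * S c \<le> 1"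
proof -
  have "S b * c \<le> counit a \<bullet> 1"
    using assms antipode_left[of a] by (metis order_refl tensor_lift_le)
  moreover have "b * S c \<le> counit a \<bullet> 1"
    using assms antipode_right[of a] by (metis order_refl tensor_lift_le)
  ultimately show "S b * c \<le> 1" "b * S c \<le> 1"
    by (auto simp: scalar_def split: if_splits intro: order_trans[OF _ bot_least])
qed

text \<open>
  Apply the counit to the antipode axiom: the truth value of \<open>\<epsilon>(S b * c)\<close> is that of
  \<open>\<epsilon>(S (\<epsilon>(c) b))\<close>, and the elements \<open>\<epsilon>(c) b\<close> have join \<open>a\<close>.
\<close>

lemma counit_antipode: "counit (S a) = counit a"
proof -
  have "counit (S (tensor_lift (\<lambda>a1 a2. counit a2 \<bullet> a1) (\<Delta> a)))
      = tensor_lift (\<lambda>a1 a2. counit (S (counit a2 \<bullet> a1))) (\<Delta> a)"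
    by (simp add: join_preserving_tensor_lift[OF counit_join_preserving]
        join_preserving_tensor_lift[OF antipode_join_preserving])
  also have "(\<lambda>a1 a2. counit (S (counit a2 \<bullet> a1))) = (\<lambda>a1 a2. counit (S a1 * a2))"
  proof (intro ext)
    fix a b :: 'h
    have "S bot = bot"
      using antipode_join_preserving unfolding join_preserving_def by (metis Sup_empty image_empty)
    then show "counit (S (counit b \<bullet> a)) = counit (S a * b)"
      using counit_Sup[of "{} :: 'h set"] by (auto simp: scalar_def counit_mult)
  qed
  also have "tensor_lift (\<lambda>a1 a2. counit (S a1 * a2)) (\<Delta> a) = counit (counit a \<bullet> (1 :: 'h))"
    by (simp add: join_preserving_tensor_lift[OF counit_join_preserving, symmetric] antipode_left)
  also have "\<dots> = counit a"
    using counit_Sup[of "{} :: 'h set"] by (simp add: scalar_def counit_one)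
  finally show ?thesis by (simp only: counit_right)
qed

lemma antipode_one: "S 1 = 1"
proof -
  have "bi_join_preserving (\<lambda>x y. S x * (y::'h))"
    using antipode_join_preserving
    unfolding bi_join_preserving_def join_preserving_def
    by (simp add: Sup_mult mult_Sup image_image)
  then have "tensor_lift (\<lambda>x y. S x * y) (1 \<otimes>\<^sub>S 1) = S 1 * 1" by (rule tensor_universal)
  then show ?thesis using antipode_left[of 1] by (simp add: comult_one scalar_def counit_one)
qed

text \<open>
  Let \<open>b\<close> represent \<open>x\<close>. For a pure tensor \<open>c \<otimes> d\<close> below \<open>\<Delta> b\<close> on which the counits do not vanish, \<open>c\<close>
  lies below \<open>b\<close> and hence, modulo the kernel, below 1. Modulo the kernel, then, \<open>S c * d\<close> lies below \<open>d\<close>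
  and thus below \<open>b\<close>. The antipode axiom gives 1 as the join of the elements \<open>S c * d\<close>; therefore 1 lies below \<open>x\<close>.
\<close>

lemma one_atom_quotient:
  assumes "x \<le> 1" "x \<noteq> bot" shows "x = (1 :: 'h remnant_quotient)"
proof -
  obtain b where b: "x = remnant_proj b" by (rule proj_surj)
  have b1: "b \<le> sup_class.sup 1 kernel_top" and eb: "counit b"
    using assms by (auto simp: b proj_one proj_le_iff proj_eq_bot_iff)
  have "tensor_lift (\<lambda>a1 a2. S a1 * a2) (\<Delta> b) \<le> sup_class.sup b kernel_top"
    unfolding tensor_lift_le
  proof (intro allI impI)
    fix c d assume cd: "c \<otimes>\<^sub>S d \<le> \<Delta> b"
    show "S c * d \<le> sup_class.sup b kernel_top"
    proof (cases "counit c \<and> counit d")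
      case True
      then have "c \<le> b" "d \<le> b" using cd split_left_le split_right_le by blast+
      then have "S c \<le> S (sup_class.sup 1 kernel_top)"
        using b1 by (intro join_preserving_mono[OF antipode_join_preserving]) simp
      then have "S c \<le> sup_class.sup 1 (S kernel_top)"
        by (simp add: join_preserving_sup[OF antipode_join_preserving] antipode_one)
      also have "\<dots> \<le> sup_class.sup 1 kernel_top"
        by (intro sup_mono order_refl) (simp add: le_kernel_top_iff counit_antipode counit_kernel_top)
      finally have "S c * d \<le> sup_class.sup 1 kernel_top * d" by (rule suplat_mult_right_mono)
      also have "\<dots> = sup_class.sup d (kernel_top * d)" by (simp add: mult_sup_distrib)
      also have "\<dots> \<le> sup_class.sup b kernel_top"
        by (intro sup_mono \<open>d \<le> b\<close> mult_kernel_top_le)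
      finally show ?thesis .
    next
      case False
      then have "S c * d \<le> kernel_top" by (auto simp: le_kernel_top_iff counit_mult counit_antipode)
      then show ?thesis by (simp add: le_supI2)
    qed
  qed
  then have "1 \<le> x" by (simp add: antipode_left scalar_def eb b proj_one proj_le_iff)
  with assms show ?thesis by (simp add: antisym)
qed

text \<open>
  Multiplication by the inverse of \<open>g\<close> carries a nonzero element below \<open>g\<close> to one below 1.
\<close>

lemma quotient_unit_atom:
  assumes "g \<in> quotient_units" "x \<le> g" "x \<noteq> bot" shows "x = (g :: 'h remnant_quotient)"
proof -
  obtain h where h: "g * h = 1" "h * g = 1" using assms(1) unfolding quotient_units_def by blast
  have "x * h \<le> 1" using quotient_mult_right_mono[OF assms(2), of h] by (simp add: h)
  moreover have "x * h \<noteq> bot"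
    using assms(3) h quotient_one_neq_bot by (metis quotient_mult_eq_bot_iff)
  ultimately have "x * h = 1" by (rule one_atom_quotient)
  then show ?thesis using h by (metis quotient_mult_assoc quotient_mult_one)
qed

text \<open>
  Split \<open>a\<close> into \<open>a\<^sub>1 \<otimes> m \<otimes> a\<^sub>3\<close>. By the antipode axioms \<open>S a\<^sub>1 * m\<close> and \<open>m * S a\<^sub>3\<close> lie below 1; when no
  counit vanishes they are nonzero in the quotient and hence equal to the atom 1, so the class of
  \<open>m\<close> is a unit. By the counit law \<open>a\<close> is the join of the middle factors \<open>m\<close>.
\<close>

lemma quotient_Sup_units: "x = Sup {g \<in> quotient_units. g \<le> (x :: 'h remnant_quotient)}"
proof (rule antisym)
  obtain a where a: "x = remnant_proj a" by (rule proj_surj)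
  obtain c where c: "Sup {g \<in> quotient_units. g \<le> x} = remnant_proj c" by (rule proj_surj)
  have "a \<le> sup_class.sup c kernel_top"
  proof (rule le_if_split_le)
    fix a1 y assume y: "a1 \<otimes>\<^sub>S y \<le> \<Delta> a" "counit a1"
    show "y \<le> sup_class.sup c kernel_top"
    proof (rule le_if_split_le')
      fix m a3 assume m: "m \<otimes>\<^sub>S a3 \<le> \<Delta> y" "counit a3"
      show "m \<le> sup_class.sup c kernel_top"
      proof (cases "counit m")
        case True
        have my: "m \<le> y" using m split_left_le by blast
        have ya: "y \<le> a" using y split_right_le by blast
        have "a1 \<otimes>\<^sub>S m \<le> \<Delta> a" using y(1) my pure_tensor_mono order_refl order_trans by metis
        then have "S a1 * m \<le> 1" by (rule antipode_split_le)
        then have l: "remnant_proj (S a1) * remnant_proj m = 1"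
          using True y(2) unfolding proj_mult
          by (intro one_atom_quotient) (auto simp: proj_mono proj_one proj_eq_bot_iff counit_mult counit_antipode)
        have "m * S a3 \<le> 1" using m(1) by (rule antipode_split_le)
        then have r: "remnant_proj m * remnant_proj (S a3) = 1"
          using True m(2) unfolding proj_mult
          by (intro one_atom_quotient) (auto simp: proj_mono proj_one proj_eq_bot_iff counit_mult counit_antipode)
        have "remnant_proj (S a1) = remnant_proj (S a3)"
          using l r by (metis quotient_mult_assoc quotient_mult_one)
        then have "remnant_proj m \<in> quotient_units"
          using l r unfolding quotient_units_def by auto
        moreover have "remnant_proj m \<le> x" using my ya by (simp add: a proj_mono)
        ultimately have "remnant_proj m \<le> remnant_proj c"
          unfolding c[symmetric] by (intro Sup_upper) simp
        then show ?thesis by (simp add: proj_le_iff)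
      next
        case False
        then show ?thesis by (simp add: le_supI2 le_kernel_top_iff)
      qed
    qed
  qed
  then have "remnant_proj a \<le> remnant_proj c" by (simp add: proj_le_iff)
  then show "x \<le> Sup {g \<in> quotient_units. g \<le> x}" by (simp add: c flip: a)
qed (auto intro: Sup_least)

text \<open>
  This rules out lattices of atoms that are not distributive. The pairs on which the functional \<open>f\<close> of the
  proof is false are those with a component in the kernel and those whose two classes are the same
  element of \<open>A\<close>. They form a bi-ideal because elements of \<open>A\<close> are atoms. Both components of a
  split of a unit lie below that unit, so \<open>f\<close> vanishes on \<open>\<Delta> a\<close> when the class of \<open>a\<close> is in \<open>A\<close>, and hence
  on \<open>\<Delta> c\<close> for the representative \<open>c\<close> of \<open>g\<close>. Since \<open>c\<close> has a split with nonzero components, whose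
  classes can only be \<open>g\<close>, the unit \<open>g\<close> belongs to \<open>A\<close>.
\<close>

lemma quotient_unit_prime:
  assumes g: "g \<in> quotient_units" and A: "A \<subseteq> quotient_units" and le: "g \<le> Sup A"
  shows "g \<in> (A :: 'h remnant_quotient set)"
proof -
  define f where "f x y \<longleftrightarrow> counit x \<and> counit y \<and> \<not> (remnant_proj x = remnant_proj y \<and> remnant_proj x \<in> A)"
    for x y :: 'h
  have proj_Sup: "remnant_proj (Sup X) = Sup (remnant_proj ` X)" for X :: "'h set"
    using remnant_proj_join_preserving unfolding join_preserving_def by blast
  have key: "remnant_proj (Sup X) = h \<longleftrightarrow> (\<forall>x\<in>X. counit x \<longrightarrow> remnant_proj x = h)"
    if "h \<in> A" "counit (Sup X)" for X :: "'h set" and h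
  proof
    assume *: "remnant_proj (Sup X) = h"
    show "\<forall>x\<in>X. counit x \<longrightarrow> remnant_proj x = h"
    proof (intro ballI impI)
      fix x assume "x \<in> X" "counit x"
      then have "remnant_proj x \<le> h" using * by (auto intro!: proj_mono Sup_upper)
      then show "remnant_proj x = h"
        using quotient_unit_atom[of h] that(1) A \<open>counit x\<close> by (auto simp: proj_eq_bot_iff)
    qed
  next
    assume *: "\<forall>x\<in>X. counit x \<longrightarrow> remnant_proj x = h"
    have "remnant_proj x \<le> h" if "x \<in> X" for x
      using * that by (metis bot_least order_refl proj_eq_bot_iff)
    then have "remnant_proj (Sup X) \<le> h" by (auto simp: proj_Sup intro: Sup_least)
    then show "remnant_proj (Sup X) = h"
      using quotient_unit_atom[of h] that A by (auto simp: proj_eq_bot_iff)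
  qed
  have "bi_join_preserving f"
    unfolding bi_join_preserving_def join_preserving_bool
  proof (intro conjI allI)
    show "f (Sup X) b \<longleftrightarrow> (\<exists>a\<in>X. f a b)" for X b
      using key[of "remnant_proj b" X] unfolding f_def by (metis counit_Sup)
    show "f a (Sup X) \<longleftrightarrow> (\<exists>b\<in>X. f a b)" for X a
      using key[of "remnant_proj a" X] unfolding f_def by (metis counit_Sup)
  qed
  then have jp: "join_preserving (\<lambda>a. tensor_lift f (\<Delta> a))"
    using tensor_universal(1)[of f] comult_join_preserving
    unfolding join_preserving_def by (simp add: image_image)
  \<comment> \<open>The kernel is included because \<open>c\<close> lies below the join of representatives only modulo the kernel.\<close>
  let ?B = "insert kernel_top {a. remnant_proj a \<in> A}"
  obtain c where c: "g = remnant_proj c" by (rule proj_surj)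
  have "Sup A \<le> remnant_proj (Sup ?B)"
  proof (rule Sup_least)
    fix h assume "h \<in> A"
    moreover obtain a where "h = remnant_proj a" by (rule proj_surj)
    ultimately show "h \<le> remnant_proj (Sup ?B)" by (metis Sup_upper insertI2 mem_Collect_eq proj_mono)
  qed
  then have "remnant_proj c \<le> remnant_proj (Sup ?B)" using le c order_trans by metis
  then have "c \<le> sup_class.sup (Sup ?B) kernel_top" by (simp only: proj_le_iff)
  then have cB: "c \<le> Sup ?B" by (simp add: sup.absorb1)
  have "\<not> tensor_lift f (\<Delta> a)" if "a \<in> ?B" for a
  proof
    assume "tensor_lift f (\<Delta> a)"
    then obtain x y where xy: "x \<otimes>\<^sub>S y \<le> \<Delta> a" "f x y" by (auto simp: tensor_lift_bool)
    then have le: "x \<le> a" "y \<le> a" and e: "counit x" "counit y"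
      using split_left_le split_right_le by (auto simp: f_def)
    show False
    proof (cases "a = kernel_top")
      case True then show False using le e by (simp add: le_kernel_top_iff)
    next
      case False
      then have u: "remnant_proj a \<in> A" using that by simp
      have "remnant_proj x = remnant_proj a" "remnant_proj y = remnant_proj a"
        using quotient_unit_atom[of "remnant_proj a"] u A le e by (auto simp: proj_mono proj_eq_bot_iff)
      then show False using xy(2) u by (simp add: f_def)
    qed
  qed
  then have "\<not> tensor_lift f (\<Delta> (Sup ?B))" using jp unfolding join_preserving_bool by blast
  then have nf: "\<not> tensor_lift f (\<Delta> c)" using join_preserving_mono[OF jp cB] by auto
  have "counit c" using quotient_unit_neq_bot[OF g] by (simp add: c proj_eq_bot_iff)
  then obtain x y where xy: "x \<otimes>\<^sub>S y \<le> \<Delta> c" "counit x" "counit y" by (rule exists_split)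
  then have "remnant_proj x \<in> A" using nf by (auto simp: tensor_lift_bool f_def)
  moreover have "remnant_proj x = g"
    using quotient_unit_atom[OF g, of "remnant_proj x"] xy split_left_le
    by (auto simp: c proj_mono proj_eq_bot_iff)
  ultimately show ?thesis by simp
qed

text \<open>
  Joins of sets of units exhaust the quotient, and primeness recovers the set from its join.
\<close>

theorem basis_elements_eq_units: "basis_elements = (quotient_units :: 'h remnant_quotient set)"
proof -
  have "bij_betw Sup (Pow quotient_units) (UNIV :: 'h remnant_quotient set)"
  proof (rule bij_betw_imageI)
    have "X \<subseteq> Y" if "X \<subseteq> quotient_units" "Y \<subseteq> quotient_units" "Sup X = Sup Y"
      for X Y :: "'h remnant_quotient set"
    proof
      fix g assume "g \<in> X"
      then have "g \<le> Sup Y" using that(3) by (metis Sup_upper)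
      then show "g \<in> Y" using quotient_unit_prime[of g Y] that \<open>g \<in> X\<close> by blast
    qed
    then show "inj_on Sup (Pow quotient_units :: 'h remnant_quotient set set)"
      unfolding inj_on_def by (intro ballI impI subset_antisym) auto
    show "Sup ` Pow quotient_units = (UNIV :: 'h remnant_quotient set)"
    proof -
      have "x \<in> Sup ` Pow quotient_units" for x :: "'h remnant_quotient"
        using quotient_Sup_units[of x] by (rule image_eqI) auto
      then show ?thesis by blast
    qed
  qed
  then have "free_basis (quotient_units :: 'h remnant_quotient set)" by (simp add: free_basis_def)
  then show ?thesis unfolding basis_elements_def using free_basis_unique by auto
qed

lemma remnant_carrier: "carrier remnant = (quotient_units :: 'h remnant_quotient set)"
  by (simp add: remnant_def basis_elements_eq_units)

lemma remnant_mult: "x \<otimes>\<^bsub>remnant\<^esub> y = x * y"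
  by (simp add: remnant_def)

lemma remnant_one: "\<one>\<^bsub>remnant\<^esub> = 1"
  by (simp add: remnant_def)

lemma remnant_group: "group (remnant :: 'h remnant_quotient monoid)"
proof (rule groupI, unfold remnant_carrier remnant_mult remnant_one)
  fix x :: "'h remnant_quotient" assume "x \<in> quotient_units"
  then show "\<exists>y\<in>quotient_units. y * x = 1"
    unfolding quotient_units_def by auto
qed (simp_all add: quotient_units_mult one_mem_quotient_units quotient_mult_assoc quotient_mult_one)

end

section \<open>Convolution monoids and conjugation\<close>

text \<open>
  The powers of the Hopf algebra are treated uniformly as coalgebras given by their elements: tuples
  instead of tensors. \<open>Funs\<close> contains the functionals that are admitted, for tuples those
  that preserve joins in each variable, and \<open>Splits a\<close> the pairs of factors of the pure tensors below the
  comultiplication of \<open>a\<close>, taken componentwise for tuples. The points are the basis of the quotient by the kernel of the counit;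
  \<open>Coord p\<close> is the functional \<open>\<delta>\<^sub>p\<close> that tells whether \<open>p\<close> lies below the class of an element, and \<open>Rep p\<close> is an
  element whose class is \<open>p\<close>.
\<close>

record ('x, 'p) based_coalgebra =
  Funs :: "('x \<Rightarrow> bool) set"
  Splits :: "'x \<Rightarrow> ('x \<times> 'x) set"
  Counit :: "'x \<Rightarrow> bool"
  Points :: "'p set"
  Coord :: "'p \<Rightarrow> 'x \<Rightarrow> bool"
  Rep :: "'p \<Rightarrow> 'x"

lemma bex_pair: "(\<exists>(x, y)\<in>A. P x y) \<longleftrightarrow> (\<exists>x y. (x, y) \<in> A \<and> P x y)"
  by auto

definition conv :: "('x, 'p) based_coalgebra \<Rightarrow> ('x \<Rightarrow> bool) \<Rightarrow> ('x \<Rightarrow> bool) \<Rightarrow> 'x \<Rightarrow> bool" where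
  "conv C \<phi> \<psi> a \<longleftrightarrow> (\<exists>(a1, a2)\<in>Splits C a. \<phi> a1 \<and> \<psi> a2)"

text \<open>
  The last assumption carries the freeness of the quotient on its points: below the counit,
  functionals and sets of points are the same thing.
\<close>

locale based_coalgebra =
  fixes C :: "('x, 'p) based_coalgebra"
  assumes Funs_Ex: "\<Theta> \<subseteq> Funs C \<Longrightarrow> (\<lambda>a. \<exists>\<theta>\<in>\<Theta>. \<theta> a) \<in> Funs C"
    and Funs_split: "(\<And>y. (\<lambda>x. f x y) \<in> Funs C) \<Longrightarrow> (\<And>x. f x \<in> Funs C) \<Longrightarrow>
      (\<lambda>a. \<exists>(a1, a2)\<in>Splits C a. f a1 a2) \<in> Funs C"
    and split_assoc: "(\<And>y z. (\<lambda>x. h x y z) \<in> Funs C) \<Longrightarrow> (\<And>x z. (\<lambda>y. h x y z) \<in> Funs C) \<Longrightarrow>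
      (\<And>x y. h x y \<in> Funs C) \<Longrightarrow>
      (\<exists>(y, a3)\<in>Splits C a. \<exists>(a1, a2)\<in>Splits C y. h a1 a2 a3) \<longleftrightarrow>
      (\<exists>(a1, y)\<in>Splits C a. \<exists>(a2, a3)\<in>Splits C y. h a1 a2 a3)"
    and conv_Counit_left: "\<phi> \<in> Funs C \<Longrightarrow> conv C (Counit C) \<phi> = \<phi>"
    and conv_Counit_right: "\<phi> \<in> Funs C \<Longrightarrow> conv C \<phi> (Counit C) = \<phi>"
    and Counit_Funs: "Counit C \<in> Funs C"
    and Coord_Funs: "p \<in> Points C \<Longrightarrow> Coord C p \<in> Funs C"
    and Coord_le_Counit: "p \<in> Points C \<Longrightarrow> Coord C p \<le> Counit C"
    and Coord_Rep: "p \<in> Points C \<Longrightarrow> q \<in> Points C \<Longrightarrow> Coord C p (Rep C q) \<longleftrightarrow> p = q"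
    and expand: "\<phi> \<in> Funs C \<Longrightarrow> \<phi> \<le> Counit C \<Longrightarrow> \<phi> a \<longleftrightarrow> (\<exists>p\<in>Points C. Coord C p a \<and> \<phi> (Rep C p))"

definition conv_inverse :: "('x, 'p) based_coalgebra \<Rightarrow> ('x \<Rightarrow> bool) \<Rightarrow> ('x \<Rightarrow> bool) \<Rightarrow> bool" where
  "conv_inverse C K K' \<longleftrightarrow> K \<in> Funs C \<and> K' \<in> Funs C \<and>
     conv C K K' = Counit C \<and> conv C K' K = Counit C"

text \<open>
  The permutation of the points induced by conjugation with an invertible functional. The equation
  \<open>\<delta>\<^sub>p * K = K * \<delta>\<^sub>q\<close> avoids mentioning the inverse.
\<close>

definition point_map :: "('x, 'p) based_coalgebra \<Rightarrow> ('x \<Rightarrow> bool) \<Rightarrow> 'p \<Rightarrow> 'p" where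
  "point_map C K p = (THE q. q \<in> Points C \<and> conv C (Coord C p) K = conv C K (Coord C q))"

lemma conv_mono: "\<phi> \<le> \<phi>' \<Longrightarrow> \<psi> \<le> \<psi>' \<Longrightarrow> conv C \<phi> \<psi> \<le> conv C \<phi>' \<psi>'"
  unfolding le_fun_def conv_def bex_pair le_bool_def by blast

context based_coalgebra
begin

lemma Funs_Ex_image:
  assumes "\<And>i. i \<in> I \<Longrightarrow> f i \<in> Funs C" shows "(\<lambda>a. \<exists>i\<in>I. f i a) \<in> Funs C"
  using Funs_Ex[of "f ` I"] assms by (simp add: image_subset_iff)

lemma Funs_const_and: "\<phi> \<in> Funs C \<Longrightarrow> (\<lambda>a. c \<and> \<phi> a) \<in> Funs C"
  using Funs_Ex[of "if c then {\<phi>} else {}"] by (cases c) auto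

lemma Funs_and_const: "\<phi> \<in> Funs C \<Longrightarrow> (\<lambda>a. \<phi> a \<and> c) \<in> Funs C"
  using Funs_const_and[of \<phi> c] by (simp add: conj_commute)

lemma conv_Funs: "\<phi> \<in> Funs C \<Longrightarrow> \<psi> \<in> Funs C \<Longrightarrow> conv C \<phi> \<psi> \<in> Funs C"
  using Funs_split[of "\<lambda>x y. \<phi> x \<and> \<psi> y"] by (simp add: conv_def[abs_def] Funs_and_const Funs_const_and)

lemma conv_assoc:
  assumes "\<phi> \<in> Funs C" "\<psi> \<in> Funs C" "\<chi> \<in> Funs C"
  shows "conv C (conv C \<phi> \<psi>) \<chi> = conv C \<phi> (conv C \<psi> \<chi>)"
proof
  fix a
  have "conv C (conv C \<phi> \<psi>) \<chi> a \<longleftrightarrow>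
      (\<exists>(y, a3)\<in>Splits C a. \<exists>(a1, a2)\<in>Splits C y. \<phi> a1 \<and> \<psi> a2 \<and> \<chi> a3)"
    unfolding conv_def by auto
  also have "\<dots> \<longleftrightarrow> (\<exists>(a1, y)\<in>Splits C a. \<exists>(a2, a3)\<in>Splits C y. \<phi> a1 \<and> \<psi> a2 \<and> \<chi> a3)"
    by (rule split_assoc) (use assms in \<open>simp_all add: Funs_and_const Funs_const_and\<close>)
  also have "\<dots> \<longleftrightarrow> conv C \<phi> (conv C \<psi> \<chi>) a"
    unfolding conv_def by auto
  finally show "conv C (conv C \<phi> \<psi>) \<chi> a = conv C \<phi> (conv C \<psi> \<chi>) a" .
qed

lemma conv_le_left: "\<phi> \<in> Funs C \<Longrightarrow> \<psi> \<le> Counit C \<Longrightarrow> conv C \<phi> \<psi> \<le> \<phi>"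
  using conv_mono[of \<phi> \<phi> \<psi> "Counit C" C] by (simp add: conv_Counit_right)

lemma conv_le_right: "\<psi> \<in> Funs C \<Longrightarrow> \<phi> \<le> Counit C \<Longrightarrow> conv C \<phi> \<psi> \<le> \<psi>"
  using conv_mono[of \<phi> "Counit C" \<psi> \<psi> C] by (simp add: conv_Counit_left)

lemma Counit_Rep: "p \<in> Points C \<Longrightarrow> Counit C (Rep C p)"
  using Coord_Rep[of p p] Coord_le_Counit[of p] by (auto simp: le_fun_def)

lemma Coord_le: "\<phi> \<in> Funs C \<Longrightarrow> \<phi> \<le> Counit C \<Longrightarrow> p \<in> Points C \<Longrightarrow> \<phi> (Rep C p) \<Longrightarrow> Coord C p \<le> \<phi>"
  by (rule predicate1I, subst expand) blast+

text \<open>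
  Functionals of points are the minimal nonzero ones: every nonzero functional below the counit is
  true on the representative of some point.
\<close>

lemma le_Coord_eq:
  assumes "\<phi> \<in> Funs C" "p \<in> Points C" "\<phi> \<le> Coord C p" "\<phi> a"
  shows "\<phi> = Coord C p"
proof -
  have le: "\<phi> \<le> Counit C" using assms Coord_le_Counit by (metis order_trans)
  then obtain t where t: "t \<in> Points C" "\<phi> (Rep C t)" using assms(1,4) expand[of \<phi> a] by blast
  then have "Coord C p (Rep C t)" using assms(3) by (auto simp: le_fun_def)
  then have "t = p" using Coord_Rep assms(2) t(1) by blast
  then have "Coord C p \<le> \<phi>" using Coord_le[OF assms(1) le] t by blast
  then show ?thesis using assms(3) by (rule antisym[rotated])
qed

text \<open>
  Points are group-like: as the counit is idempotent, the representative of \<open>p\<close> has a split into two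
  elements with nonzero counit, and every point below one of them is \<open>p\<close>. Hence convolution of functionals
  below the counit is intersection of sets of points.
\<close>

lemma conv_Rep:
  assumes "\<phi> \<in> Funs C" "\<phi> \<le> Counit C" "\<psi> \<in> Funs C" "\<psi> \<le> Counit C" "p \<in> Points C"
  shows "conv C \<phi> \<psi> (Rep C p) \<longleftrightarrow> \<phi> (Rep C p) \<and> \<psi> (Rep C p)"
proof
  assume "conv C \<phi> \<psi> (Rep C p)"
  then show "\<phi> (Rep C p) \<and> \<psi> (Rep C p)"
    using predicate1D[OF conv_le_left[OF assms(1,4)]] predicate1D[OF conv_le_right[OF assms(3,2)]]
    by blast
next
  assume pt: "\<phi> (Rep C p) \<and> \<psi> (Rep C p)"
  have "conv C (Counit C) (Counit C) (Rep C p)"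
    using Counit_Rep assms(5) by (simp add: conv_Counit_left Counit_Funs)
  then obtain a1 a2 where a: "(a1, a2) \<in> Splits C (Rep C p)" "Counit C a1" "Counit C a2"
    unfolding conv_def by blast
  then obtain s t where st: "s \<in> Points C" "Coord C s a1" "t \<in> Points C" "Coord C t a2"
    using expand[of "Counit C"] Counit_Funs by blast
  then have "conv C (Coord C s) (Coord C t) (Rep C p)" using a unfolding conv_def by blast
  then have "Coord C s (Rep C p)" "Coord C t (Rep C p)"
    using predicate1D[OF conv_le_left[OF Coord_Funs[OF st(1)] Coord_le_Counit[OF st(3)]]]
      predicate1D[OF conv_le_right[OF Coord_Funs[OF st(3)] Coord_le_Counit[OF st(1)]]]
    by blast+
  then have "s = p" "t = p" using Coord_Rep st assms(5) by blast+
  then have "\<phi> a1" "\<psi> a2"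
    using st pt predicate1D[OF Coord_le[OF assms(1,2,5)]] predicate1D[OF Coord_le[OF assms(3-5)]]
    by blast+
  then show "conv C \<phi> \<psi> (Rep C p)" using a unfolding conv_def by blast
qed

lemma conv_Coord:
  assumes "\<phi> \<in> Funs C" "\<phi> \<le> Counit C" "p \<in> Points C"
  shows "conv C \<phi> (Coord C p) = Coord C p \<longleftrightarrow> \<phi> (Rep C p)"
proof
  assume "conv C \<phi> (Coord C p) = Coord C p"
  then show "\<phi> (Rep C p)" using conv_Rep[of \<phi> "Coord C p" p] Coord_Rep[of p p] assms
    by (simp add: Coord_Funs Coord_le_Counit)
next
  assume "\<phi> (Rep C p)"
  then have "conv C \<phi> (Coord C p) (Rep C p)"
    using assms by (simp add: conv_Rep Coord_Funs Coord_le_Counit Coord_Rep)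
  then show "conv C \<phi> (Coord C p) = Coord C p"
    using le_Coord_eq[of "conv C \<phi> (Coord C p)" p] conv_le_right[of "Coord C p" \<phi>] assms
    by (simp add: conv_Funs Coord_Funs)
qed

lemma conv_inverse_sym: "conv_inverse C K K' \<Longrightarrow> conv_inverse C K' K"
  by (simp add: conv_inverse_def)

lemma conv_cancel:
  assumes "conv_inverse C K K'" "\<phi> \<in> Funs C"
  shows "conv C K (conv C K' \<phi>) = \<phi>" "conv C K' (conv C K \<phi>) = \<phi>"
    "conv C (conv C \<phi> K) K' = \<phi>" "conv C (conv C \<phi> K') K = \<phi>"
  using assms conv_assoc[of K K' \<phi>] conv_assoc[of K' K \<phi>] conv_assoc[of \<phi> K K'] conv_assoc[of \<phi> K' K]
  by (simp_all add: conv_inverse_def conv_Counit_left conv_Counit_right)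

lemma conjugate_le_Counit:
  assumes "conv_inverse C K K'" "\<phi> \<le> Counit C"
  shows "conv C K (conv C \<phi> K') \<le> Counit C"
proof -
  have "conv C K (conv C \<phi> K') \<le> conv C K (conv C (Counit C) K')"
    by (intro conv_mono order_refl assms)
  then show ?thesis using assms(1) by (simp add: conv_inverse_def conv_Counit_left)
qed

lemma conv_bot: "conv C K (\<lambda>_. False) = (\<lambda>_. False)" "conv C (\<lambda>_. False) K = (\<lambda>_. False)"
  by (auto simp: conv_def)

text \<open>
  The conjugate \<open>\<theta>\<close> of \<open>\<delta>\<^sub>p\<close> lies below the counit and is nonzero, because conjugating back gives \<open>\<delta>\<^sub>p\<close>. For
  a point \<open>q\<close> in \<open>\<theta>\<close>, conjugating \<open>\<delta>\<^sub>q\<close> back gives a nonzero functional below \<open>\<delta>\<^sub>p\<close>, which is \<open>\<delta>\<^sub>p\<close> by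
  minimality; thus \<open>\<theta> = \<delta>\<^sub>q\<close>.
\<close>

lemma point_map_exists:
  assumes K: "conv_inverse C K K'" and p: "p \<in> Points C"
  obtains q where "q \<in> Points C" "conv C (Coord C p) K = conv C K (Coord C q)"
proof -
  let ?\<theta> = "conv C K' (conv C (Coord C p) K)"
  have KF: "K \<in> Funs C" "K' \<in> Funs C" using K by (auto simp: conv_inverse_def)
  note F = KF Coord_Funs conv_Funs
  have th: "?\<theta> \<in> Funs C" "?\<theta> \<le> Counit C"
    using p F by (auto intro!: conjugate_le_Counit[OF conv_inverse_sym[OF K]] Coord_le_Counit)
  have undo_conj: "conv C K (conv C ?\<theta> K') = Coord C p"
    using p F K by (simp add: conv_assoc conv_cancel[OF K] conv_inverse_def conv_Counit_right)
  have "\<exists>a. ?\<theta> a"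
  proof (rule ccontr)
    assume "\<nexists>a. ?\<theta> a"
    then have "?\<theta> = (\<lambda>_. False)" by auto
    then have "Coord C p = (\<lambda>_. False)" using undo_conj by (simp add: conv_bot)
    then show False using Coord_Rep[of p p] p by simp
  qed
  then obtain q where q: "q \<in> Points C" "?\<theta> (Rep C q)" using expand[OF th] by blast
  let ?\<omega> = "conv C K (conv C (Coord C q) K')"
  have "Coord C q \<le> ?\<theta>" using Coord_le th q by blast
  then have "?\<omega> \<le> conv C K (conv C ?\<theta> K')" by (intro conv_mono order_refl)
  then have le: "?\<omega> \<le> Coord C p" by (simp only: undo_conj)
  have "\<exists>a. ?\<omega> a"
  proof (rule ccontr)
    assume "\<nexists>a. ?\<omega> a"
    then have "?\<omega> = (\<lambda>_. False)" by auto
    moreover have "conv C K' (conv C ?\<omega> K) = Coord C q"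
      using q F K by (simp add: conv_assoc conv_cancel[OF K] conv_inverse_def conv_Counit_right)
    ultimately have "Coord C q = (\<lambda>_. False)" by (simp add: conv_bot)
    then show False using Coord_Rep[of q q] q by simp
  qed
  then have "?\<omega> = Coord C p" using le_Coord_eq[OF _ p le] F q by blast
  then have "conv C ?\<omega> K = conv C (Coord C p) K" by simp
  then have "conv C (Coord C p) K = conv C K (Coord C q)"
    using q F K by (simp add: conv_assoc conv_cancel[OF K] conv_inverse_def conv_Counit_right)
  with q(1) show ?thesis by (rule that)
qed

lemma Coord_inject: "p \<in> Points C \<Longrightarrow> q \<in> Points C \<Longrightarrow> Coord C p = Coord C q \<Longrightarrow> p = q"
  using Coord_Rep by metis

lemma point_map_eqI:
  assumes "conv_inverse C K K'" "q \<in> Points C" "conv C (Coord C p) K = conv C K (Coord C q)"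
  shows "point_map C K p = q"
  unfolding point_map_def
proof (rule the_equality)
  fix s assume s: "s \<in> Points C \<and> conv C (Coord C p) K = conv C K (Coord C s)"
  then have "conv C K' (conv C K (Coord C s)) = conv C K' (conv C K (Coord C q))" using assms by simp
  then have "Coord C s = Coord C q" using s assms by (simp add: conv_cancel Coord_Funs)
  then show "s = q" using s assms Coord_inject by blast
qed (use assms in blast)

lemma point_map:
  assumes "conv_inverse C K K'" "p \<in> Points C"
  shows "point_map C K p \<in> Points C"
    "conv C (Coord C p) K = conv C K (Coord C (point_map C K p))"
  using point_map_exists[OF assms] point_map_eqI[OF assms(1)] by metis+

lemma point_map_inverse:
  assumes "conv_inverse C K K'" "p \<in> Points C"
  shows "point_map C K' (point_map C K p) = p"
proof (rule point_map_eqI[OF conv_inverse_sym[OF assms(1)]])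
  let ?q = "point_map C K p"
  have F: "K \<in> Funs C" "K' \<in> Funs C" "Coord C p \<in> Funs C" "Coord C ?q \<in> Funs C"
    using assms point_map by (auto simp: conv_inverse_def Coord_Funs)
  have "conv C (Coord C ?q) K' = conv C K' (conv C (conv C K (Coord C ?q)) K')"
    using F by (simp add: conv_cancel[OF assms(1)] conv_assoc conv_Funs)
  also have "\<dots> = conv C K' (conv C (conv C (Coord C p) K) K')"
    using point_map(2)[OF assms] by simp
  also have "\<dots> = conv C K' (Coord C p)"
    using F by (simp add: conv_cancel[OF assms(1)])
  finally show "conv C (Coord C ?q) K' = conv C K' (Coord C p)" .
qed (use assms in simp)

lemma point_map_bij:
  assumes "conv_inverse C K K'"
  shows "bij_betw (point_map C K) (Points C) (Points C)"
proof (rule bij_betw_byWitness[where f' = "point_map C K'"])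
  note K' = conv_inverse_sym[OF assms]
  show "\<forall>p\<in>Points C. point_map C K' (point_map C K p) = p"
    using point_map_inverse[OF assms] by blast
  show "\<forall>p\<in>Points C. point_map C K (point_map C K' p) = p"
    using point_map_inverse[OF K'] by blast
  show "point_map C K ` Points C \<subseteq> Points C" using point_map(1)[OF assms] by blast
  show "point_map C K' ` Points C \<subseteq> Points C" using point_map(1)[OF K'] by blast
qed

lemma idempotent_invertible:
  assumes K: "conv_inverse C K K'" and "conv C K K = K" shows "K = Counit C"
  using conv_cancel(2)[OF K, of K] assms by (auto simp: conv_inverse_def)

lemma conv_inverse_conv:
  assumes "conv_inverse C K K'" "conv_inverse C L L'"
  shows "conv_inverse C (conv C K L) (conv C L' K')"
proof -
  have F: "K \<in> Funs C" "K' \<in> Funs C" "L \<in> Funs C" "L' \<in> Funs C"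
    using assms by (auto simp: conv_inverse_def)
  then show ?thesis using assms
    by (simp add: conv_inverse_def conv_Funs conv_assoc conv_cancel[OF assms(1)] conv_cancel[OF assms(2)])
qed

lemma point_map_conv:
  assumes K: "conv_inverse C K K'" and L: "conv_inverse C L L'" and p: "p \<in> Points C"
  shows "point_map C (conv C K L) p = point_map C L (point_map C K p)"
proof (rule point_map_eqI[OF conv_inverse_conv[OF K L]])
  let ?q = "point_map C K p" let ?s = "point_map C L ?q"
  note q = point_map[OF K p]
  note s = point_map[OF L q(1)]
  show "?s \<in> Points C" by (fact s)
  have F: "K \<in> Funs C" "L \<in> Funs C" "Coord C p \<in> Funs C" "Coord C ?q \<in> Funs C" "Coord C ?s \<in> Funs C"
    using K L p q s by (auto simp: conv_inverse_def Coord_Funs)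
  have "conv C (Coord C p) (conv C K L) = conv C (conv C K (Coord C ?q)) L"
    using F by (simp add: conv_assoc flip: q(2))
  also have "\<dots> = conv C (conv C K L) (Coord C ?s)"
    using F by (simp add: conv_assoc s(2))
  finally show "conv C (Coord C p) (conv C K L) = conv C (conv C K L) (Coord C ?s)" .
qed

lemma conv_inverse_Counit: "conv_inverse C (Counit C) (Counit C)"
  by (simp add: conv_inverse_def Counit_Funs conv_Counit_left)

lemma point_map_Counit: "p \<in> Points C \<Longrightarrow> point_map C (Counit C) p = p"
  by (rule point_map_eqI[OF conv_inverse_Counit]) (simp_all add: conv_Counit_left conv_Counit_right Coord_Funs)

text \<open>
  A functional \<open>\<phi>\<close> below the counit contains the point \<open>p\<close> if and only if \<open>\<phi> * \<delta>\<^sub>p = \<delta>\<^sub>p\<close>, and this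
  equation can be moved across \<open>K\<close>. The lemma transports identities that involve sets of points, such as
  fibres of the multiplication.
\<close>

lemma intertwined_iff:
  assumes K: "conv_inverse C K K'" and p: "p \<in> Points C"
    and \<phi>: "\<phi> \<in> Funs C" "\<phi> \<le> Counit C" and \<psi>: "\<psi> \<in> Funs C" "\<psi> \<le> Counit C"
    and eq: "conv C \<phi> K = conv C K \<psi>"
  shows "\<phi> (Rep C p) \<longleftrightarrow> \<psi> (Rep C (point_map C K p))"
proof -
  let ?q = "point_map C K p"
  note q = point_map[OF K p]
  have F: "K \<in> Funs C" "K' \<in> Funs C" "Coord C p \<in> Funs C" "Coord C ?q \<in> Funs C"
    using K p q by (auto simp: conv_inverse_def Coord_Funs)
  have *: "conv C (conv C \<phi> (Coord C p)) K = conv C K (conv C \<psi> (Coord C ?q))"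
    using F \<phi> \<psi> by (simp add: conv_assoc q(2)) (simp add: eq flip: conv_assoc)
  have "\<phi> (Rep C p) \<longleftrightarrow> conv C \<phi> (Coord C p) = Coord C p" using conv_Coord[OF \<phi> p] by simp
  also have "\<dots> \<longleftrightarrow> conv C (conv C \<phi> (Coord C p)) K = conv C (Coord C p) K"
    using F \<phi> by (metis conv_cancel(3)[OF K] conv_Funs)
  also have "\<dots> \<longleftrightarrow> conv C K (conv C \<psi> (Coord C ?q)) = conv C K (Coord C ?q)"
    by (simp add: * q(2))
  also have "\<dots> \<longleftrightarrow> conv C \<psi> (Coord C ?q) = Coord C ?q"
    using F \<psi> by (metis conv_cancel(2)[OF K] conv_Funs)
  also have "\<dots> \<longleftrightarrow> \<psi> (Rep C ?q)" using conv_Coord[OF \<psi> q(1)] by simp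
  finally show ?thesis .
qed

text \<open>
  The value of a conjugated coordinate functional, which is what the Sweedler expressions of
  the theorem compute, in terms of the permutation of points.
\<close>

lemma conjugate_Coord:
  assumes K: "conv_inverse C K K'" and q: "q \<in> Points C"
  shows "conv C K (conv C (Coord C q) K') a \<longleftrightarrow> (\<exists>p\<in>Points C. point_map C K p = q \<and> Coord C p a)"
proof -
  let ?p = "point_map C K' q"
  note K' = conv_inverse_sym[OF K]
  have p: "?p \<in> Points C" "point_map C K ?p = q"
    using point_map[OF K' q] point_map_inverse[OF K' q] by auto
  have F: "K \<in> Funs C" "K' \<in> Funs C" "Coord C q \<in> Funs C" "Coord C ?p \<in> Funs C"
    using K p q by (auto simp: conv_inverse_def Coord_Funs)
  have "conv C K (conv C (Coord C q) K') = Coord C ?p"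
    using F point_map(2)[OF K' q] by (simp add: conv_cancel[OF K])
  then show ?thesis using p point_map_inverse[OF K] by auto
qed

end

section \<open>Products\<close>

definition product :: "('x, 'p) based_coalgebra \<Rightarrow> ('y, 'q) based_coalgebra \<Rightarrow> ('x \<times> 'y, 'p \<times> 'q) based_coalgebra" where
  "product C D = \<lparr>Funs = {\<phi>. (\<forall>b. (\<lambda>a. \<phi> (a, b)) \<in> Funs C) \<and> (\<forall>a. (\<lambda>b. \<phi> (a, b)) \<in> Funs D)},
    Splits = (\<lambda>(a, b). {((a1, b1), (a2, b2)) | a1 b1 a2 b2. (a1, a2) \<in> Splits C a \<and> (b1, b2) \<in> Splits D b}),
    Counit = (\<lambda>(a, b). Counit C a \<and> Counit D b),
    Points = Points C \<times> Points D,
    Coord = (\<lambda>(p, q) (a, b). Coord C p a \<and> Coord D q b),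
    Rep = (\<lambda>(p, q). (Rep C p, Rep D q))\<rparr>"

lemma product_simps:
  "\<phi> \<in> Funs (product C D) \<longleftrightarrow> (\<forall>b. (\<lambda>a. \<phi> (a, b)) \<in> Funs C) \<and> (\<forall>a. (\<lambda>b. \<phi> (a, b)) \<in> Funs D)"
  "((a1, b1), (a2, b2)) \<in> Splits (product C D) (a, b) \<longleftrightarrow> (a1, a2) \<in> Splits C a \<and> (b1, b2) \<in> Splits D b"
  "Counit (product C D) (a, b) \<longleftrightarrow> Counit C a \<and> Counit D b"
  "Points (product C D) = Points C \<times> Points D"
  "Coord (product C D) (p, q) (a, b) \<longleftrightarrow> Coord C p a \<and> Coord D q b"
  "Rep (product C D) (p, q) = (Rep C p, Rep D q)"
  by (simp_all add: product_def)

lemma ex_Splits_product: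
  "(\<exists>(x, y)\<in>Splits (product C D) (a, b). P x y) \<longleftrightarrow>
    (\<exists>(a1, a2)\<in>Splits C a. \<exists>(b1, b2)\<in>Splits D b. P (a1, b1) (a2, b2))"
  unfolding bex_pair split_paired_Ex product_simps by blast

lemma ex_Splits_product':
  "(\<exists>(x, y)\<in>Splits (product C D) (a, b). P x y) \<longleftrightarrow>
    (\<exists>(b1, b2)\<in>Splits D b. \<exists>(a1, a2)\<in>Splits C a. P (a1, b1) (a2, b2))"
  unfolding bex_pair split_paired_Ex product_simps by blast

text \<open>
  Functionals of two variables need not be products of functionals of one variable, so convolution on
  a product is reduced to its factors one variable at a time, with the other variable frozen.
\<close>

lemma conv_product:
  "conv (product C D) \<phi> \<psi> (a, b) \<longleftrightarrow>
    (\<exists>(b1, b2)\<in>Splits D b. conv C (\<lambda>x. \<phi> (x, b1)) (\<lambda>x. \<psi> (x, b2)) a)"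
  "conv (product C D) \<phi> \<psi> (a, b) \<longleftrightarrow>
    (\<exists>(a1, a2)\<in>Splits C a. conv D (\<lambda>y. \<phi> (a1, y)) (\<lambda>y. \<psi> (a2, y)) b)"
  unfolding conv_def ex_Splits_product unfolding bex_pair by blast+

lemma conv_product_external:
  "conv (product C D) (\<lambda>(a, b). \<phi> a \<and> \<psi> b) (\<lambda>(a, b). \<phi>' a \<and> \<psi>' b) =
    (\<lambda>(a, b). conv C \<phi> \<phi>' a \<and> conv D \<psi> \<psi>' b)"
proof (intro ext, clarify)
  fix a b
  show "conv (product C D) (\<lambda>(a, b). \<phi> a \<and> \<psi> b) (\<lambda>(a, b). \<phi>' a \<and> \<psi>' b) (a, b) \<longleftrightarrow>
      conv C \<phi> \<phi>' a \<and> conv D \<psi> \<psi>' b"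
    unfolding conv_def ex_Splits_product unfolding bex_pair prod.case by blast
qed

lemma based_coalgebra_product:
  assumes "based_coalgebra C" "based_coalgebra D"
  shows "based_coalgebra (product C D)"
proof -
  interpret C: based_coalgebra C by fact
  interpret D: based_coalgebra D by fact
  show ?thesis
  proof
    fix \<Theta> assume "\<Theta> \<subseteq> Funs (product C D)"
    then show "(\<lambda>a. \<exists>\<theta>\<in>\<Theta>. \<theta> a) \<in> Funs (product C D)"
      unfolding product_simps
      by (intro conjI allI C.Funs_Ex_image D.Funs_Ex_image) (auto simp: product_simps)
  next
    fix f assume f: "\<And>y. (\<lambda>x. f x y) \<in> Funs (product C D)" "\<And>x. f x \<in> Funs (product C D)"
    have "(\<lambda>a. \<exists>(b1, b2)\<in>Splits D b. \<exists>(a1, a2)\<in>Splits C a. f (a1, b1) (a2, b2)) \<in> Funs C" for b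
      unfolding case_prod_unfold
      by (rule C.Funs_Ex_image, rule C.Funs_split[unfolded case_prod_unfold])
        (use f in \<open>auto simp: product_simps\<close>)
    moreover have "(\<lambda>b. \<exists>(a1, a2)\<in>Splits C a. \<exists>(b1, b2)\<in>Splits D b. f (a1, b1) (a2, b2)) \<in> Funs D" for a
      unfolding case_prod_unfold
      by (rule D.Funs_Ex_image, rule D.Funs_split[unfolded case_prod_unfold])
        (use f in \<open>auto simp: product_simps\<close>)
    ultimately show "(\<lambda>a. \<exists>(a1, a2)\<in>Splits (product C D) a. f a1 a2) \<in> Funs (product C D)"
      unfolding product_simps(1) ex_Splits_product' by (simp add: ex_Splits_product[symmetric] ex_Splits_product'[symmetric])
  next
    fix f and x :: "'a \<times> 'c"
    assume f: "\<And>y z. (\<lambda>x. f x y z) \<in> Funs (product C D)" "\<And>x z. (\<lambda>y. f x y z) \<in> Funs (product C D)"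
      "\<And>x y. f x y \<in> Funs (product C D)"
    obtain a b where x: "x = (a, b)" by (cases x)
    have "(\<exists>(y, a3)\<in>Splits (product C D) x. \<exists>(a1, a2)\<in>Splits (product C D) y. f a1 a2 a3) \<longleftrightarrow>
      (\<exists>(v, b3)\<in>Splits D b. \<exists>(b1, b2)\<in>Splits D v.
        \<exists>(u, a3)\<in>Splits C a. \<exists>(a1, a2)\<in>Splits C u. f (a1, b1) (a2, b2) (a3, b3))"
      unfolding x ex_Splits_product unfolding bex_pair split_paired_Ex product_simps by blast
    also have "\<dots> \<longleftrightarrow> (\<exists>(v, b3)\<in>Splits D b. \<exists>(b1, b2)\<in>Splits D v.
        \<exists>(a1, u)\<in>Splits C a. \<exists>(a2, a3)\<in>Splits C u. f (a1, b1) (a2, b2) (a3, b3))"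
      by (subst C.split_assoc) (use f in \<open>auto simp: product_simps\<close>)
    also have "\<dots> \<longleftrightarrow> (\<exists>(a1, u)\<in>Splits C a. \<exists>(a2, a3)\<in>Splits C u. 
        \<exists>(v, b3)\<in>Splits D b. \<exists>(b1, b2)\<in>Splits D v. f (a1, b1) (a2, b2) (a3, b3))"
      unfolding bex_pair by blast
    also have "\<dots> \<longleftrightarrow> (\<exists>(a1, u)\<in>Splits C a. \<exists>(a2, a3)\<in>Splits C u. 
        \<exists>(b1, v)\<in>Splits D b. \<exists>(b2, b3)\<in>Splits D v. f (a1, b1) (a2, b2) (a3, b3))"
      by (subst D.split_assoc) (use f in \<open>auto simp: product_simps\<close>)
    also have "\<dots> \<longleftrightarrow> (\<exists>(a1, y)\<in>Splits (product C D) x. \<exists>(a2, a3)\<in>Splits (product C D) y. f a1 a2 a3)"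
      unfolding x ex_Splits_product unfolding bex_pair split_paired_Ex product_simps by blast
    finally show "(\<exists>(y, a3)\<in>Splits (product C D) x. \<exists>(a1, a2)\<in>Splits (product C D) y. f a1 a2 a3) \<longleftrightarrow>
       (\<exists>(a1, y)\<in>Splits (product C D) x. \<exists>(a2, a3)\<in>Splits (product C D) y. f a1 a2 a3)" .
  next
    fix \<phi> assume \<phi>: "\<phi> \<in> Funs (product C D)"
    have "conv (product C D) (Counit (product C D)) \<phi> (a, b) = \<phi> (a, b)" for a b
    proof -
      have "conv (product C D) (Counit (product C D)) \<phi> (a, b) \<longleftrightarrow>
        (\<exists>(b1, b2)\<in>Splits D b. Counit D b1 \<and> conv C (Counit C) (\<lambda>x. \<phi> (x, b2)) a)"
        by (simp add: conv_product(1) product_simps) (simp add: conv_def, unfold bex_pair, blast)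
      also have "\<dots> \<longleftrightarrow> conv D (Counit D) (\<lambda>y. \<phi> (a, y)) b"
        using \<phi> by (simp add: product_simps C.conv_Counit_left) (simp add: conv_def)
      finally show ?thesis using \<phi> by (simp add: product_simps D.conv_Counit_left)
    qed
    then show "conv (product C D) (Counit (product C D)) \<phi> = \<phi>" by auto
    have "conv (product C D) \<phi> (Counit (product C D)) (a, b) = \<phi> (a, b)" for a b
    proof -
      have "conv (product C D) \<phi> (Counit (product C D)) (a, b) \<longleftrightarrow>
        (\<exists>(b1, b2)\<in>Splits D b. conv C (\<lambda>x. \<phi> (x, b1)) (Counit C) a \<and> Counit D b2)"
        by (simp add: conv_product(1) product_simps) (simp add: conv_def, unfold bex_pair, blast)
      also have "\<dots> \<longleftrightarrow> conv D (\<lambda>y. \<phi> (a, y)) (Counit D) b"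
        using \<phi> by (simp add: product_simps C.conv_Counit_right) (simp add: conv_def)
      finally show ?thesis using \<phi> by (simp add: product_simps D.conv_Counit_right)
    qed
    then show "conv (product C D) \<phi> (Counit (product C D)) = \<phi>" by auto
  next
    show "Counit (product C D) \<in> Funs (product C D)"
      by (simp add: product_simps C.Funs_and_const D.Funs_const_and C.Counit_Funs D.Counit_Funs)
    fix p assume "p \<in> Points (product C D)"
    then obtain s t where p: "p = (s, t)" "s \<in> Points C" "t \<in> Points D" by (auto simp: product_simps)
    then show "Coord (product C D) p \<in> Funs (product C D)"
      by (simp add: product_simps C.Funs_and_const D.Funs_const_and C.Coord_Funs D.Coord_Funs)
    show "Coord (product C D) p \<le> Counit (product C D)"
      using C.Coord_le_Counit[of s] D.Coord_le_Counit[of t] p by (auto simp: le_fun_def product_simps)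
    fix q assume "q \<in> Points (product C D)"
    then show "Coord (product C D) p (Rep (product C D) q) = (p = q)"
      using p by (auto simp: product_simps C.Coord_Rep D.Coord_Rep)
  next
    fix \<phi> and x :: "'a \<times> 'c"
    assume \<phi>: "\<phi> \<in> Funs (product C D)" and le: "\<phi> \<le> Counit (product C D)"
    obtain a b where x: "x = (a, b)" by (cases x)
    have leC: "(\<lambda>a. \<phi> (a, b)) \<le> Counit C" and leD: "(\<lambda>b. \<phi> (a, b)) \<le> Counit D" for a b
      using le by (auto simp: le_fun_def product_simps)
    have "\<phi> (a, b) \<longleftrightarrow> (\<exists>p\<in>Points C. Coord C p a \<and> \<phi> (Rep C p, b))"
      by (rule C.expand[OF _ leC]) (use \<phi> in \<open>simp add: product_simps\<close>)
    also have "\<dots> \<longleftrightarrow> (\<exists>p\<in>Points C. Coord C p a \<and> (\<exists>q\<in>Points D. Coord D q b \<and> \<phi> (Rep C p, Rep D q)))"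
      using D.expand[OF _ leD] \<phi> unfolding product_simps by blast
    finally show "\<phi> x \<longleftrightarrow> (\<exists>p\<in>Points (product C D). Coord (product C D) p x \<and> \<phi> (Rep (product C D) p))"
      by (auto simp: x product_simps)
  qed
qed

text \<open>
  A functional of the last variables, extended by the counit, acts on these variables only.
\<close>

lemma point_map_extend:
  assumes C: "based_coalgebra C" and D: "based_coalgebra D" and K: "conv_inverse D K K'"
  shows "conv_inverse (product C D) (\<lambda>(a, b). Counit C a \<and> K b) (\<lambda>(a, b). Counit C a \<and> K' b)"
    (is "conv_inverse _ ?L ?L'")
    and "p \<in> Points C \<Longrightarrow> q \<in> Points D \<Longrightarrow>
      point_map (product C D) (\<lambda>(a, b). Counit C a \<and> K b) (p, q) = (p, point_map D K q)"
proof -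
  interpret C: based_coalgebra C by fact
  interpret D: based_coalgebra D by fact
  interpret P: based_coalgebra "product C D" by (intro based_coalgebra_product C D)
  have K': "K \<in> Funs D" "K' \<in> Funs D" "conv D K K' = Counit D" "conv D K' K = Counit D"
    using K by (auto simp: conv_inverse_def)
  have e: "Counit (product C D) = (\<lambda>(a, b). Counit C a \<and> Counit D b)"
    by (simp add: product_def)
  have c: "Coord (product C D) (p, q) = (\<lambda>(a, b). Coord C p a \<and> Coord D q b)" for p q
    by (simp add: product_def)
  show inv: "conv_inverse (product C D) ?L ?L'"
    unfolding conv_inverse_def e conv_product_external
    using K' by (simp add: product_simps C.conv_Counit_left C.Funs_and_const D.Funs_const_and C.Counit_Funs)
  assume p: "p \<in> Points C" and q: "q \<in> Points D"
  show "point_map (product C D) ?L (p, q) = (p, point_map D K q)"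
  proof (rule P.point_map_eqI[OF inv])
    show "(p, point_map D K q) \<in> Points (product C D)"
      using p D.point_map(1)[OF K q] by (simp add: product_simps)
    show "conv (product C D) (Coord (product C D) (p, q)) ?L
      = conv (product C D) ?L (Coord (product C D) (p, point_map D K q))"
      unfolding c conv_product_external
      using p D.point_map(2)[OF K q] by (simp add: C.conv_Counit_left C.conv_Counit_right C.Coord_Funs)
  qed
qed

lemma conv_extend_left:
  assumes "based_coalgebra C" "\<psi> \<in> Funs (product C D)"
  shows "conv (product C D) (\<lambda>(a, b). Counit C a \<and> K b) \<psi> (a, b) \<longleftrightarrow> conv D K (\<lambda>b. \<psi> (a, b)) b"
proof -
  interpret C: based_coalgebra C by fact
  have "conv C (\<lambda>x. Counit C x \<and> K b1) (\<lambda>x. \<psi> (x, b2)) a \<longleftrightarrow> K b1 \<and> \<psi> (a, b2)" for b1 b2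
    using C.conv_Counit_left[of "\<lambda>x. \<psi> (x, b2)"] assms(2)
    by (cases "K b1") (simp_all add: product_simps C.conv_bot)
  then show ?thesis by (simp add: conv_product(1) conv_def[of D])
qed

lemma conv_extend_right:
  assumes "based_coalgebra C" "\<phi> \<in> Funs (product C D)"
  shows "conv (product C D) \<phi> (\<lambda>(a, b). Counit C a \<and> K b) (a, b) \<longleftrightarrow> conv D (\<lambda>b. \<phi> (a, b)) K b"
proof -
  interpret C: based_coalgebra C by fact
  have "conv C (\<lambda>x. \<phi> (x, b1)) (\<lambda>x. Counit C x \<and> K b2) a \<longleftrightarrow> \<phi> (a, b1) \<and> K b2" for b1 b2
    using C.conv_Counit_right[of "\<lambda>x. \<phi> (x, b1)"] assms(2)
    by (cases "K b2") (simp_all add: product_simps C.conv_bot)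
  then show ?thesis by (simp add: conv_product(1) conv_def[of D])
qed

section \<open>Coalgebra maps and naturality\<close>

text \<open>
  Compatibility with convolution is required of pulled back functionals only, not of \<open>Splits\<close>: a split
  of the product \<open>a b\<close> is in general not a product of splits of \<open>a\<close> and \<open>b\<close>, but it lies below joins of
  such products.
\<close>

definition coalgebra_map where
  "coalgebra_map C D f g \<longleftrightarrow>
     (\<forall>\<phi>\<in>Funs D. \<phi> \<circ> f \<in> Funs C) \<and>
     (\<forall>\<phi>\<in>Funs D. \<forall>\<psi>\<in>Funs D. conv C (\<phi> \<circ> f) (\<psi> \<circ> f) = conv D \<phi> \<psi> \<circ> f) \<and>
     Counit D \<circ> f = Counit C \<and>
     g ` Points C \<subseteq> Points D \<and>
     (\<forall>p\<in>Points C. \<forall>q\<in>Points D. Coord D q (f (Rep C p)) \<longleftrightarrow> q = g p)"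

lemma coalgebra_mapD:
  assumes "coalgebra_map C D f g"
  shows "\<phi> \<in> Funs D \<Longrightarrow> \<phi> \<circ> f \<in> Funs C"
    "\<phi> \<in> Funs D \<Longrightarrow> \<psi> \<in> Funs D \<Longrightarrow> conv C (\<phi> \<circ> f) (\<psi> \<circ> f) = conv D \<phi> \<psi> \<circ> f"
    "Counit D \<circ> f = Counit C"
    "p \<in> Points C \<Longrightarrow> g p \<in> Points D"
    "p \<in> Points C \<Longrightarrow> q \<in> Points D \<Longrightarrow> Coord D q (f (Rep C p)) \<longleftrightarrow> q = g p"
  using assms unfolding coalgebra_map_def by auto

lemma conv_inverse_pullback:
  assumes "coalgebra_map C D f g" "conv_inverse D K K'"
  shows "conv_inverse C (K \<circ> f) (K' \<circ> f)"
  using assms unfolding conv_inverse_def coalgebra_map_def by metis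

text \<open>
  Pull the equation \<open>\<delta>\<^sub>q * K = K * \<delta>\<^sub>s\<close> with \<open>q = g p\<close> back along \<open>f\<close>. The pullback of \<open>\<delta>\<^sub>q\<close> is the fibre of \<open>g\<close>
  over \<open>q\<close>, so the equation intertwines two fibres of \<open>g\<close>.
\<close>

lemma point_map_natural:
  assumes C: "based_coalgebra C" and D: "based_coalgebra D" and f: "coalgebra_map C D f g"
    and K: "conv_inverse D K K'" and p: "p \<in> Points C"
  shows "g (point_map C (K \<circ> f) p) = point_map D K (g p)"
proof -
  interpret C: based_coalgebra C by fact
  interpret D: based_coalgebra D by fact
  note f = coalgebra_mapD[OF f]
  note Kf = conv_inverse_pullback[OF assms(3) K]
  let ?q = "point_map D K (g p)"
  have q: "?q \<in> Points D" "conv D (Coord D (g p)) K = conv D K (Coord D ?q)"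
    using D.point_map[OF K] f(4)[OF p] by auto
  have KD: "K \<in> Funs D" using K by (simp add: conv_inverse_def)
  have le: "Coord D s \<circ> f \<le> Counit C" if "s \<in> Points D" for s
    using D.Coord_le_Counit[OF that] f(3) by (auto simp: le_fun_def fun_eq_iff)
  have "conv C (Coord D (g p) \<circ> f) (K \<circ> f) = conv C (K \<circ> f) (Coord D ?q \<circ> f)"
    using q KD D.Coord_Funs f(4)[OF p] by (simp add: f(2))
  then have "(Coord D (g p) \<circ> f) (Rep C p) \<longleftrightarrow> (Coord D ?q \<circ> f) (Rep C (point_map C (K \<circ> f) p))"
    by (intro C.intertwined_iff[OF Kf p] f(1) D.Coord_Funs le f(4)[OF p] q(1))
  then show ?thesis using f(5) p q f(4)[OF p] C.point_map[OF Kf p] by simp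
qed

lemma coalgebra_map_comp:
  assumes "coalgebra_map C D f g" "coalgebra_map D E f' g'" "based_coalgebra D" "based_coalgebra E"
    and fp: "\<And>p. p \<in> Points C \<Longrightarrow> f (Rep C p) = Rep D (g p)"
  shows "coalgebra_map C E (f' \<circ> f) (g' \<circ> g)"
  unfolding coalgebra_map_def
proof (intro conjI ballI)
  note f = coalgebra_mapD[OF assms(1)]
  note f' = coalgebra_mapD[OF assms(2)]
  fix \<phi> assume \<phi>: "\<phi> \<in> Funs E"
  show "\<phi> \<circ> (f' \<circ> f) \<in> Funs C" using f(1)[OF f'(1)[OF \<phi>]] by (simp add: comp_assoc)
  fix \<psi> assume \<psi>: "\<psi> \<in> Funs E"
  show "conv C (\<phi> \<circ> (f' \<circ> f)) (\<psi> \<circ> (f' \<circ> f)) = conv E \<phi> \<psi> \<circ> (f' \<circ> f)"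
    using f(2)[OF f'(1)[OF \<phi>] f'(1)[OF \<psi>]] f'(2)[OF \<phi> \<psi>] by (simp add: comp_assoc)
next
  note f = coalgebra_mapD[OF assms(1)]
  note f' = coalgebra_mapD[OF assms(2)]
  show "Counit E \<circ> (f' \<circ> f) = Counit C" using f(3) f'(3) by (simp flip: comp_assoc)
  show "(g' \<circ> g) ` Points C \<subseteq> Points E" using f(4) f'(4) by auto
  fix p q assume "p \<in> Points C" "q \<in> Points E"
  then show "Coord E q ((f' \<circ> f) (Rep C p)) \<longleftrightarrow> q = (g' \<circ> g) p"
    using f'(5)[OF f(4)] by (simp add: fp)
qed

text \<open>
  Criterion for maps that only permute or regroup variables; these map splits to splits exactly.
\<close>

lemma coalgebra_map_rearrange:
  assumes "based_coalgebra D"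
    and "\<And>\<phi>. \<phi> \<in> Funs D \<Longrightarrow> (\<lambda>x. \<phi> (f x)) \<in> Funs C"
    and splits: "\<And>P a. (\<exists>(x, y)\<in>Splits D (f a). P x y) \<longleftrightarrow> (\<exists>(x, y)\<in>Splits C a. P (f x) (f y))"
    and "\<And>a. Counit D (f a) \<longleftrightarrow> Counit C a"
    and points: "\<And>p. p \<in> Points C \<Longrightarrow> g p \<in> Points D"
    and rep: "\<And>p. p \<in> Points C \<Longrightarrow> f (Rep C p) = Rep D (g p)"
  shows "coalgebra_map C D f g"
  unfolding coalgebra_map_def
proof (intro conjI ballI)
  interpret D: based_coalgebra D by fact
  show "Coord D q (f (Rep C p)) \<longleftrightarrow> q = g p" if "p \<in> Points C" "q \<in> Points D" for p q
    using that points rep D.Coord_Rep by simp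
qed (use assms(2,4) points in \<open>auto simp: comp_def fun_eq_iff conv_def splits\<close>)

lemma coalgebra_map_rotate:
  assumes "based_coalgebra C" "based_coalgebra D" "based_coalgebra E"
  shows "coalgebra_map (product C (product D E)) (product E (product C D))
    (\<lambda>(a, b, c). (c, a, b)) (\<lambda>(a, b, c). (c, a, b))"
proof (rule coalgebra_map_rearrange, goal_cases)
  case (3 P a)
  obtain x y z where "a = (x, y, z)" by (cases a)
  then show ?case
    by (simp only: prod.case ex_Splits_product) (unfold bex_pair, blast)
qed (use assms in \<open>auto simp: product_simps intro!: based_coalgebra_product\<close>)

lemma coalgebra_map_swap12:
  assumes "based_coalgebra C" "based_coalgebra D" "based_coalgebra E"
  shows "coalgebra_map (product C (product D E)) (product D (product C E))
    (\<lambda>(a, b, c). (b, a, c)) (\<lambda>(a, b, c). (b, a, c))"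
proof (rule coalgebra_map_rearrange, goal_cases)
  case (3 P a)
  obtain x y z where "a = (x, y, z)" by (cases a)
  then show ?case
    by (simp only: prod.case ex_Splits_product) (unfold bex_pair, blast)
qed (use assms in \<open>auto simp: product_simps intro!: based_coalgebra_product\<close>)

lemma coalgebra_map_swap23:
  assumes "based_coalgebra C" "based_coalgebra D" "based_coalgebra E"
  shows "coalgebra_map (product C (product D E)) (product C (product E D))
    (\<lambda>(a, b, c). (a, c, b)) (\<lambda>(a, b, c). (a, c, b))"
proof (rule coalgebra_map_rearrange, goal_cases)
  case (3 P a)
  obtain x y z where "a = (x, y, z)" by (cases a)
  then show ?case
    by (simp only: prod.case ex_Splits_product) (unfold bex_pair, blast)
qed (use assms in \<open>auto simp: product_simps intro!: based_coalgebra_product\<close>)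

lemma coalgebra_map_assoc:
  assumes "based_coalgebra C" "based_coalgebra D" "based_coalgebra E"
  shows "coalgebra_map (product C (product D E)) (product (product C D) E)
    (\<lambda>(a, b, c). ((a, b), c)) (\<lambda>(a, b, c). ((a, b), c))"
proof (rule coalgebra_map_rearrange, goal_cases)
  case (3 P a)
  obtain x y z where "a = (x, y, z)" by (cases a)
  then show ?case
    by (simp only: prod.case ex_Splits_product)
qed (use assms in \<open>auto simp: product_simps intro!: based_coalgebra_product\<close>)

lemma coalgebra_map_product_left:
  assumes f: "coalgebra_map C C' f g" and D: "based_coalgebra D"
  shows "coalgebra_map (product C D) (product C' D) (map_prod f id) (map_prod g id)"
  unfolding coalgebra_map_def
proof (intro conjI ballI)
  interpret D: based_coalgebra D by fact
  note f = coalgebra_mapD[OF f]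
  fix \<phi> assume \<phi>: "\<phi> \<in> Funs (product C' D)"
  then show "\<phi> \<circ> map_prod f id \<in> Funs (product C D)"
    using f(1)[of "\<lambda>x. \<phi> (x, _)"] by (simp add: product_simps comp_def)
  fix \<psi> assume \<psi>: "\<psi> \<in> Funs (product C' D)"
  show "conv (product C D) (\<phi> \<circ> map_prod f id) (\<psi> \<circ> map_prod f id) = conv (product C' D) \<phi> \<psi> \<circ> map_prod f id"
  proof (rule ext, clarify)
    fix a b
    have "conv C (\<lambda>x. \<phi> (f x, b1)) (\<lambda>x. \<psi> (f x, b2)) a = conv C' (\<lambda>x. \<phi> (x, b1)) (\<lambda>x. \<psi> (x, b2)) (f a)" for b1 b2
      using f(2)[of "\<lambda>x. \<phi> (x, b1)" "\<lambda>x. \<psi> (x, b2)"] \<phi> \<psi> by (simp add: product_simps comp_def fun_eq_iff)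
    then show "conv (product C D) (\<phi> \<circ> map_prod f id) (\<psi> \<circ> map_prod f id) (a, b) = (conv (product C' D) \<phi> \<psi> \<circ> map_prod f id) (a, b)"
      by (simp add: conv_product(1))
  qed
next
  interpret D: based_coalgebra D by fact
  note f = coalgebra_mapD[OF f]
  show "Counit (product C' D) \<circ> map_prod f id = Counit (product C D)"
    using f(3) by (auto simp: product_simps fun_eq_iff)
  show "map_prod g id ` Points (product C D) \<subseteq> Points (product C' D)"
    using f(4) by (auto simp: product_simps)
  fix p q assume "p \<in> Points (product C D)" "q \<in> Points (product C' D)"
  then show "Coord (product C' D) q (map_prod f id (Rep (product C D) p)) \<longleftrightarrow> q = map_prod g id p"
    using f(5) by (auto simp: product_simps D.Coord_Rep)
qed

lemma coalgebra_map_product_right: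
  assumes f: "coalgebra_map C C' f g" and D: "based_coalgebra D"
  shows "coalgebra_map (product D C) (product D C') (map_prod id f) (map_prod id g)"
  unfolding coalgebra_map_def
proof (intro conjI ballI)
  interpret D: based_coalgebra D by fact
  note f = coalgebra_mapD[OF f]
  fix \<phi> assume \<phi>: "\<phi> \<in> Funs (product D C')"
  then show "\<phi> \<circ> map_prod id f \<in> Funs (product D C)"
    using f(1)[of "\<lambda>x. \<phi> (_, x)"] by (simp add: product_simps comp_def)
  fix \<psi> assume \<psi>: "\<psi> \<in> Funs (product D C')"
  show "conv (product D C) (\<phi> \<circ> map_prod id f) (\<psi> \<circ> map_prod id f) = conv (product D C') \<phi> \<psi> \<circ> map_prod id f"
  proof (rule ext, clarify)
    fix b a
    have "conv C (\<lambda>x. \<phi> (b1, f x)) (\<lambda>x. \<psi> (b2, f x)) a = conv C' (\<lambda>x. \<phi> (b1, x)) (\<lambda>x. \<psi> (b2, x)) (f a)" for b1 b2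
      using f(2)[of "\<lambda>x. \<phi> (b1, x)" "\<lambda>x. \<psi> (b2, x)"] \<phi> \<psi> by (simp add: product_simps comp_def fun_eq_iff)
    then show "conv (product D C) (\<phi> \<circ> map_prod id f) (\<psi> \<circ> map_prod id f) (b, a) = (conv (product D C') \<phi> \<psi> \<circ> map_prod id f) (b, a)"
      by (simp add: conv_product(2))
  qed
next
  interpret D: based_coalgebra D by fact
  note f = coalgebra_mapD[OF f]
  show "Counit (product D C') \<circ> map_prod id f = Counit (product D C)"
    using f(3) by (auto simp: product_simps fun_eq_iff)
  show "map_prod id g ` Points (product D C) \<subseteq> Points (product D C')"
    using f(4) by (auto simp: product_simps)
  fix p q assume "p \<in> Points (product D C)" "q \<in> Points (product D C')"
  then show "Coord (product D C') q (map_prod id f (Rep (product D C) p)) \<longleftrightarrow> q = map_prod id g p"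
    using f(5) by (auto simp: product_simps D.Coord_Rep)
qed

text \<open>
  The unit of the Hopf algebra, with point 1, is the example to which this is applied: inserting a
  group-like element in one variable is a coalgebra map.
\<close>

definition grouplike where
  "grouplike E u e \<longleftrightarrow> (\<forall>\<phi>\<in>Funs E. \<forall>\<psi>\<in>Funs E. conv E \<phi> \<psi> u \<longleftrightarrow> \<phi> u \<and> \<psi> u) \<and> Counit E u \<and>
     e \<in> Points E \<and> (\<forall>q\<in>Points E. Coord E q u \<longleftrightarrow> q = e)"

lemma coalgebra_map_insert_left:
  assumes u: "grouplike E u e" and C: "based_coalgebra C"
  shows "coalgebra_map C (product E C) (Pair u) (Pair e)"
  unfolding coalgebra_map_def
proof (intro conjI ballI)
  fix \<phi> assume \<phi>: "\<phi> \<in> Funs (product E C)"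
  then show "\<phi> \<circ> Pair u \<in> Funs C" by (simp add: product_simps comp_def)
  fix \<psi> assume \<psi>: "\<psi> \<in> Funs (product E C)"
  show "conv C (\<phi> \<circ> Pair u) (\<psi> \<circ> Pair u) = conv (product E C) \<phi> \<psi> \<circ> Pair u"
    using u \<phi> \<psi> by (auto simp: fun_eq_iff conv_product(1) grouplike_def product_simps conv_def[of C])
next
  interpret C: based_coalgebra C by fact
  show "Counit (product E C) \<circ> Pair u = Counit C" "Pair e ` Points C \<subseteq> Points (product E C)"
    using u by (auto simp: fun_eq_iff grouplike_def product_simps)
  fix p q assume "p \<in> Points C" "q \<in> Points (product E C)"
  then show "Coord (product E C) q (Pair u (Rep C p)) \<longleftrightarrow> q = Pair e p"
    using u by (auto simp: grouplike_def product_simps C.Coord_Rep)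
qed

lemma coalgebra_map_insert_right:
  assumes u: "grouplike E u e" and C: "based_coalgebra C"
  shows "coalgebra_map C (product C E) (\<lambda>a. (a, u)) (\<lambda>p. (p, e))"
  unfolding coalgebra_map_def
proof (intro conjI ballI)
  fix \<phi> assume \<phi>: "\<phi> \<in> Funs (product C E)"
  then show "\<phi> \<circ> (\<lambda>a. (a, u)) \<in> Funs C" by (simp add: product_simps comp_def)
  fix \<psi> assume \<psi>: "\<psi> \<in> Funs (product C E)"
  show "conv C (\<phi> \<circ> (\<lambda>a. (a, u))) (\<psi> \<circ> (\<lambda>a. (a, u))) = conv (product C E) \<phi> \<psi> \<circ> (\<lambda>a. (a, u))"
    using u \<phi> \<psi> by (auto simp: fun_eq_iff conv_product(2) grouplike_def product_simps conv_def[of C])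
next
  interpret C: based_coalgebra C by fact
  show "Counit (product C E) \<circ> (\<lambda>a. (a, u)) = Counit C" "(\<lambda>p. (p, e)) ` Points C \<subseteq> Points (product C E)"
    using u by (auto simp: fun_eq_iff grouplike_def product_simps)
  fix p q assume "p \<in> Points C" "q \<in> Points (product C E)"
  then show "Coord (product C E) q (Rep C p, u) \<longleftrightarrow> q = (p, e)"
    using u by (auto simp: grouplike_def product_simps C.Coord_Rep)
qed

section \<open>Functionals on powers of a Hopf algebra\<close>

definition hopf_coalgebra ::
  "('h::suplat_augmented_algebra \<Rightarrow> ('h, 'h) tensor) \<Rightarrow> ('h, 'h remnant_quotient) based_coalgebra" where
  "hopf_coalgebra \<Delta> = \<lparr>Funs = {\<phi>. join_preserving \<phi>}, Splits = (\<lambda>a. {(b, c). b \<otimes>\<^sub>S c \<le> \<Delta> a}),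
    Counit = counit, Points = carrier remnant, Coord = (\<lambda>p a. p \<le> remnant_proj a), Rep = remnant_rep\<rparr>"

lemma hopf_coalgebra_simps:
  "Funs (hopf_coalgebra \<Delta>) = {\<phi>. join_preserving \<phi>}"
  "(b, c) \<in> Splits (hopf_coalgebra \<Delta>) a \<longleftrightarrow> b \<otimes>\<^sub>S c \<le> \<Delta> a"
  "Counit (hopf_coalgebra \<Delta>) = counit"
  "Points (hopf_coalgebra \<Delta>) = carrier remnant"
  "Coord (hopf_coalgebra \<Delta>) p a \<longleftrightarrow> p \<le> remnant_proj a"
  "Rep (hopf_coalgebra \<Delta>) = remnant_rep"
  by (simp_all add: hopf_coalgebra_def)

lemma tensor_lift_Splits:
  "tensor_lift f (\<Delta> a) \<longleftrightarrow> (\<exists>(b, c)\<in>Splits (hopf_coalgebra \<Delta>) a. f b c)"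
  unfolding bex_pair hopf_coalgebra_simps tensor_lift_bool by (rule refl)

lemma sweedler_Splits:
  "sweedler \<Delta> a f \<longleftrightarrow> (\<exists>(b, c)\<in>Splits (hopf_coalgebra \<Delta>) a. f b c)"
  by (simp add: sweedler_def tensor_lift_Splits)

lemma conv_hopf: "conv (hopf_coalgebra \<Delta>) \<phi> \<psi> a \<longleftrightarrow> tensor_lift (\<lambda>b c. \<phi> b \<and> \<psi> c) (\<Delta> a)"
  by (simp add: conv_def tensor_lift_Splits)

context suplat_hopf_algebra
begin

lemma remnant_atom:
  assumes "remnant_proj (a :: 'h) \<in> carrier remnant" "p \<in> carrier remnant"
  shows "p \<le> remnant_proj a \<longleftrightarrow> p = remnant_proj a"
  using quotient_unit_atom[of "remnant_proj a" p] quotient_unit_neq_bot[of p] assms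
  by (auto simp: remnant_carrier)

text \<open>
  Both sides are values of the extension of \<open>f\<close> to the triple tensor product, on the two sides of the
  coassociativity axiom.
\<close>

lemma comult_coassoc_functional:
  assumes f: "\<And>y z. join_preserving (\<lambda>x. f x y z)" "\<And>x z. join_preserving (\<lambda>y. f x y z)"
    "\<And>x y. join_preserving (f x y :: 'h \<Rightarrow> bool)"
  shows "tensor_lift (\<lambda>y a3. tensor_lift (\<lambda>a1 a2. f a1 a2 a3) (\<Delta> y)) (\<Delta> a) \<longleftrightarrow>
    tensor_lift (\<lambda>a1 y. tensor_lift (\<lambda>a2 a3. f a1 a2 a3) (\<Delta> y)) (\<Delta> a)"
proof -
  define L where "L = (\<lambda>t c. tensor_lift (\<lambda>a b. f a b c) t)"
  define M where "M = (\<lambda>a t. tensor_lift (f a) t)"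
  have bi: "bi_join_preserving (\<lambda>a b. f a b c)" "bi_join_preserving (f a)" for a c
    using f unfolding bi_join_preserving_def by auto
  have L: "bi_join_preserving L"
    unfolding bi_join_preserving_def
  proof (intro conjI allI)
    show "join_preserving (\<lambda>t. L t c)" for c unfolding L_def by (rule tensor_universal(1)[OF bi(1)])
    show "join_preserving (L t)" for t
      unfolding L_def tensor_lift_bool using f(3) by (auto simp: join_preserving_bool)
  qed
  have M: "bi_join_preserving M"
    unfolding bi_join_preserving_def
  proof (intro conjI allI)
    show "join_preserving (M a)" for a unfolding M_def by (rule tensor_universal(1)[OF bi(2)])
    show "join_preserving (\<lambda>a. M a t)" for t
      unfolding M_def tensor_lift_bool using f(1) by (auto simp: join_preserving_bool)
  qed
  note MU = tensor_universal[OF M] and LU = tensor_universal[OF L]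
  have "tensor_lift M (tensor_assoc u) = tensor_lift L u" for u
  proof -
    have "tensor_lift M (tensor_assoc u)
      = tensor_lift (\<lambda>t c. tensor_lift (\<lambda>a b. tensor_lift M (a \<otimes>\<^sub>S b \<otimes>\<^sub>S c)) t) u"
      unfolding tensor_assoc_def by (simp add: join_preserving_tensor_lift[OF MU(1)])
    also have "(\<lambda>t c. tensor_lift (\<lambda>a b. tensor_lift M (a \<otimes>\<^sub>S b \<otimes>\<^sub>S c)) t) = L"
      by (simp only: MU(2)) (simp add: L_def M_def tensor_universal(2)[OF bi(2)])
    finally show ?thesis .
  qed
  from this[of "tensor_map \<Delta> id (\<Delta> a)"]
  have "tensor_lift M (tensor_map id \<Delta> (\<Delta> a)) = tensor_lift L (tensor_map \<Delta> id (\<Delta> a))"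
    by (simp only: comult_coassoc)
  then show ?thesis
    unfolding tensor_map_def
    by (simp add: join_preserving_tensor_lift[OF MU(1)] join_preserving_tensor_lift[OF LU(1)] MU(2) LU(2))
      (simp add: L_def M_def)
qed

text \<open>
  Below the counit, \<open>\<phi>\<close> vanishes on the kernel and so depends only on the class of \<open>a\<close>, which is the
  join of the units below it.
\<close>

lemma functional_expand:
  assumes \<phi>: "join_preserving \<phi>" and le: "\<phi> \<le> counit"
  shows "\<phi> (a :: 'h) \<longleftrightarrow> (\<exists>p\<in>carrier remnant. p \<le> remnant_proj a \<and> \<phi> (remnant_rep p))"
proof -
  have nk: "\<not> \<phi> kernel_top" using le counit_kernel_top by (auto simp: le_fun_def)
  have mono: "\<phi> b \<Longrightarrow> \<phi> c" if "remnant_proj b \<le> remnant_proj c" for b c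
  proof -
    assume "\<phi> b"
    then have "\<phi> (sup_class.sup c kernel_top)"
      using join_preserving_mono[OF \<phi>, of b "sup_class.sup c kernel_top"] that by (simp add: proj_le_iff)
    then show "\<phi> c" using nk by (simp add: join_preserving_sup[OF \<phi>])
  qed
  let ?P = "{g \<in> quotient_units. g \<le> remnant_proj a}"
  have "remnant_proj a = Sup ?P" by (rule quotient_Sup_units)
  also have "?P = remnant_proj ` (remnant_rep ` ?P)" by (simp add: image_image)
  also have "Sup \<dots> = remnant_proj (Sup (remnant_rep ` ?P))"
    using remnant_proj_join_preserving unfolding join_preserving_def by metis
  finally have "remnant_proj a = remnant_proj (Sup (remnant_rep ` ?P))" .
  then have "\<phi> a \<longleftrightarrow> \<phi> (Sup (remnant_rep ` ?P))" using mono by (metis order_refl)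
  also have "\<dots> \<longleftrightarrow> (\<exists>p\<in>?P. \<phi> (remnant_rep p))" using \<phi> by (simp add: join_preserving_bool)
  finally show ?thesis by (auto simp: remnant_carrier)
qed

abbreviation "H \<equiv> hopf_coalgebra \<Delta>"
abbreviation "H2 \<equiv> product H H"
abbreviation "H3 \<equiv> product H H2"

lemma based_coalgebra_H: "based_coalgebra H"
proof
  fix \<Theta> assume "\<Theta> \<subseteq> Funs H"
  then show "(\<lambda>a. \<exists>\<theta>\<in>\<Theta>. \<theta> a) \<in> Funs H"
    using join_preserving_bex[of \<Theta> "\<lambda>\<theta>. \<theta>"] by (auto simp: hopf_coalgebra_simps)
next
  fix f assume "\<And>y. (\<lambda>x. f x y) \<in> Funs H" "\<And>x. f x \<in> Funs H"
  then have "bi_join_preserving f" by (simp add: hopf_coalgebra_simps bi_join_preserving_def)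
  then have "join_preserving (\<lambda>a. tensor_lift f (\<Delta> a))"
    by (rule join_preserving_comp[OF tensor_universal(1) comult_join_preserving])
  then show "(\<lambda>a. \<exists>(a1, a2)\<in>Splits H a. f a1 a2) \<in> Funs H"
    by (simp add: hopf_coalgebra_simps tensor_lift_Splits)
next
  fix f a assume "\<And>y z. (\<lambda>x. f x y z) \<in> Funs H" "\<And>x z. (\<lambda>y. f x y z) \<in> Funs H" "\<And>x y. f x y \<in> Funs H"
  then show "(\<exists>(y, a3)\<in>Splits H a. \<exists>(a1, a2)\<in>Splits H y. f a1 a2 a3) \<longleftrightarrow>
      (\<exists>(a1, y)\<in>Splits H a. \<exists>(a2, a3)\<in>Splits H y. f a1 a2 a3)"
    using comult_coassoc_functional[of f a] by (simp add: hopf_coalgebra_simps tensor_lift_Splits)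
next
  fix \<phi> assume "\<phi> \<in> Funs H"
  then have \<phi>: "join_preserving \<phi>" by (simp add: hopf_coalgebra_simps)
  then have "\<not> \<phi> bot" by (metis Sup_empty empty_iff join_preserving_bool)
  then have s: "\<phi> (c \<bullet> x) \<longleftrightarrow> c \<and> \<phi> x" for c x by (simp add: scalar_def)
  show "conv H (Counit H) \<phi> = \<phi>"
    using join_preserving_tensor_lift[OF \<phi>, symmetric, where f = "\<lambda>(a1 :: 'h) a2. counit a1 \<bullet> a2"]
    by (intro ext) (simp add: conv_hopf hopf_coalgebra_simps counit_left s)
  show "conv H \<phi> (Counit H) = \<phi>"
    using join_preserving_tensor_lift[OF \<phi>, symmetric, where f = "\<lambda>a1 (a2 :: 'h). counit a2 \<bullet> a1"]
    by (intro ext) (simp add: conv_hopf hopf_coalgebra_simps counit_right s conj_commute)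
next
  show "Counit H \<in> Funs H" by (simp add: hopf_coalgebra_simps counit_join_preserving)
  fix p assume "p \<in> Points H"
  then have p: "p \<in> quotient_units" by (simp add: hopf_coalgebra_simps remnant_carrier)
  have "join_preserving (\<lambda>a. p \<le> remnant_proj a)"
    unfolding join_preserving_bool
  proof (intro allI iffI)
    fix A :: "'h set" assume "p \<le> remnant_proj (Sup A)"
    let ?U = "{g \<in> quotient_units. \<exists>a\<in>A. g \<le> remnant_proj a}"
    have "remnant_proj (Sup A) = Sup (remnant_proj ` A)"
      using remnant_proj_join_preserving unfolding join_preserving_def by blast
    also have "\<dots> \<le> Sup ?U"
    proof (rule Sup_least)
      fix x assume "x \<in> remnant_proj ` A"
      then have "Sup {g \<in> quotient_units. g \<le> x} \<le> Sup ?U" by (intro Sup_subset_mono) auto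
      then show "x \<le> Sup ?U" using quotient_Sup_units[of x] by simp
    qed
    finally have "p \<le> Sup ?U" using \<open>p \<le> remnant_proj (Sup A)\<close> by simp
    then have "p \<in> ?U" by (intro quotient_unit_prime[OF p]) auto
    then show "\<exists>a\<in>A. p \<le> remnant_proj a" by blast
  next
    fix A :: "'h set" assume "\<exists>a\<in>A. p \<le> remnant_proj a"
    then show "p \<le> remnant_proj (Sup A)" by (meson Sup_upper order_trans proj_mono)
  qed
  then show "Coord H p \<in> Funs H" by (simp add: hopf_coalgebra_def)
  show "Coord H p \<le> Counit H"
  proof (rule predicate1I)
    fix a assume "Coord H p a"
    then have "remnant_proj a \<noteq> bot"
      using quotient_unit_neq_bot[OF p] by (metis bot_unique hopf_coalgebra_simps(5))
    then show "Counit H a" by (simp add: proj_eq_bot_iff hopf_coalgebra_simps)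
  qed
  fix q assume "q \<in> Points H"
  then show "Coord H p (Rep H q) \<longleftrightarrow> p = q"
    using \<open>p \<in> Points H\<close> remnant_atom[of "remnant_rep q" p] by (simp add: hopf_coalgebra_simps)
next
  fix \<phi> a assume "\<phi> \<in> Funs H" "\<phi> \<le> Counit H"
  then show "\<phi> a \<longleftrightarrow> (\<exists>p\<in>Points H. Coord H p a \<and> \<phi> (Rep H p))"
    unfolding hopf_coalgebra_simps mem_Collect_eq by (rule functional_expand)
qed

lemma based_coalgebra_H2: "based_coalgebra H2" and based_coalgebra_H3: "based_coalgebra H3"
  by (intro based_coalgebra_product based_coalgebra_H)+

text \<open>
  Compatibility with convolution expresses that the comultiplication is multiplicative; compatibility
  with the points holds because a product of units is a unit, and hence an atom.
\<close>

lemma coalgebra_map_mult: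
  "coalgebra_map H2 H (\<lambda>(a, b). a * b) (\<lambda>(p, q). p * q)"
  unfolding coalgebra_map_def
proof (intro conjI ballI)
  fix \<phi> :: "'h \<Rightarrow> bool" assume "\<phi> \<in> Funs H"
  then have \<phi>: "join_preserving \<phi>" by (simp add: hopf_coalgebra_simps)
  then show "\<phi> \<circ> (\<lambda>(a, b). a * b) \<in> Funs H2"
    by (simp add: product_simps hopf_coalgebra_simps join_preserving_comp[of \<phi>] mult_join_preserving)
  fix \<psi> :: "'h \<Rightarrow> bool" assume "\<psi> \<in> Funs H"
  then have \<psi>: "join_preserving \<psi>" by (simp add: hopf_coalgebra_simps)
  show "conv H2 (\<phi> \<circ> (\<lambda>(a, b). a * b)) (\<psi> \<circ> (\<lambda>(a, b). a * b)) = conv H \<phi> \<psi> \<circ> (\<lambda>(a, b). a * b)"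
  proof (rule ext, clarify)
    fix a b
    let ?t = "tensor_lift (\<lambda>b c. \<phi> b \<and> \<psi> c)"
    note bi = bi_join_preserving_bool_and[OF \<phi> \<psi>]
    have "conv H \<phi> \<psi> (a * b) \<longleftrightarrow> tensor_lift (\<lambda>a1 a2. tensor_lift (\<lambda>b1 b2. \<phi> (a1 * b1) \<and> \<psi> (a2 * b2)) (\<Delta> b)) (\<Delta> a)"
      by (simp add: conv_hopf comult_mult join_preserving_tensor_lift[OF tensor_universal(1)[OF bi]]
          tensor_universal(2)[OF bi])
    then show "conv H2 (\<phi> \<circ> (\<lambda>(a, b). a * b)) (\<psi> \<circ> (\<lambda>(a, b). a * b)) (a, b) = (conv H \<phi> \<psi> \<circ> (\<lambda>(a, b). a * b)) (a, b)"
      by (simp add: conv_def[of H2] ex_Splits_product tensor_lift_Splits)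
  qed
next
  show "Counit H \<circ> (\<lambda>(a, b). a * b) = Counit H2"
    by (auto simp: product_simps hopf_coalgebra_simps counit_mult)
  show "(\<lambda>(p, q). p * q) ` Points H2 \<subseteq> Points H"
    by (auto simp: product_simps hopf_coalgebra_simps remnant_carrier quotient_units_mult)
  fix p q assume p: "p \<in> Points H2" and q: "q \<in> Points H"
  obtain s t where st: "p = (s, t)" by (cases p)
  have "remnant_proj (remnant_rep s * remnant_rep t) = s * t" by (simp flip: proj_mult)
  then show "Coord H q ((\<lambda>(a, b). a * b) (Rep H2 p)) \<longleftrightarrow> q = (\<lambda>(p, q). p * q) p"
    using p q remnant_atom[of "remnant_rep s * remnant_rep t" q]
    by (simp add: st product_simps hopf_coalgebra_simps remnant_carrier quotient_units_mult)
qed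

lemma coalgebra_map_m23:
  "coalgebra_map H3 H2 (\<lambda>(a, b, c). (a, b * c)) (\<lambda>(p, q, r). (p, q * r))"
  using coalgebra_map_product_right[OF coalgebra_map_mult based_coalgebra_H]
  by (simp add: map_prod_def case_prod_unfold)

lemma coalgebra_map_m12:
  "coalgebra_map H3 H2 (\<lambda>(a, b, c). (a * b, c)) (\<lambda>(p, q, r). (p * q, r))"
proof -
  have "coalgebra_map H3 H2 (map_prod (\<lambda>(a, b). a * b) id \<circ> (\<lambda>(a, b, c). ((a, b), c)))
     (map_prod (\<lambda>(p, q). p * q) id \<circ> (\<lambda>(p, q, r). ((p, q), r)))"
    by (rule coalgebra_map_comp[OF coalgebra_map_assoc coalgebra_map_product_left[OF coalgebra_map_mult]])
      (auto intro!: based_coalgebra_product based_coalgebra_H simp: product_simps)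
  then show ?thesis by (simp add: comp_def case_prod_unfold)
qed

lemma grouplike_one: "grouplike H 1 1"
proof -
  have "conv H \<phi> \<psi> 1 \<longleftrightarrow> \<phi> 1 \<and> \<psi> 1" if "\<phi> \<in> Funs H" "\<psi> \<in> Funs H" for \<phi> \<psi>
    using that bi_join_preserving_bool_and[of \<phi> \<psi>, THEN tensor_universal(2)]
    by (simp add: conv_hopf comult_one hopf_coalgebra_simps)
  moreover have "q \<le> remnant_proj 1 \<longleftrightarrow> q = 1" if "q \<in> carrier remnant" for q :: "'h remnant_quotient"
    using remnant_atom[of 1 q] that one_mem_quotient_units by (simp add: remnant_carrier flip: proj_one)
  ultimately show ?thesis
    by (simp add: grouplike_def hopf_coalgebra_simps counit_one remnant_carrier one_mem_quotient_units)
qed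

definition form :: "(('h, 'h) tensor \<Rightarrow> bool) \<Rightarrow> 'h \<times> 'h \<Rightarrow> bool" where
  "form K = (\<lambda>(a, b). K (a \<otimes>\<^sub>S b))"

lemma form_inverse:
  assumes "join_preserving K" "join_preserving K'" "convolution_inverse \<Delta> K K'"
  shows "conv_inverse H2 (form K) (form K')"
proof -
  have "form K \<in> Funs H2" "form K' \<in> Funs H2"
    using assms(1,2)[THEN join_preserving_comp, OF pure_tensor_join_preserving(1)]
      assms(1,2)[THEN join_preserving_comp, OF pure_tensor_join_preserving(2)]
    by (simp_all add: form_def product_simps hopf_coalgebra_simps)
  moreover have "conv H2 (form K) (form K') = Counit H2" "conv H2 (form K') (form K) = Counit H2"
    using assms(3) unfolding convolution_inverse_def sweedler_Splits
    by (auto simp: fun_eq_iff conv_def ex_Splits_product form_def product_simps hopf_coalgebra_simps(3))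
  ultimately show ?thesis by (simp add: conv_inverse_def)
qed

definition on12_form :: "('h \<times> 'h \<Rightarrow> bool) \<Rightarrow> 'h \<times> 'h \<times> 'h \<Rightarrow> bool" where
  "on12_form K = (\<lambda>(a, b, c). K (a, b) \<and> counit c)"
definition on13_form :: "('h \<times> 'h \<Rightarrow> bool) \<Rightarrow> 'h \<times> 'h \<times> 'h \<Rightarrow> bool" where
  "on13_form K = (\<lambda>(a, b, c). K (a, c) \<and> counit b)"
definition on23_form :: "('h \<times> 'h \<Rightarrow> bool) \<Rightarrow> 'h \<times> 'h \<times> 'h \<Rightarrow> bool" where
  "on23_form K = (\<lambda>(a, b, c). K (b, c) \<and> counit a)"

lemma on23_form_eq: "on23_form K = (\<lambda>(a, x). Counit H a \<and> K x)"
  by (auto simp: on23_form_def hopf_coalgebra_simps)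
lemma on12_form_eq: "on12_form K = on23_form K \<circ> (\<lambda>(a, b, c). (c, a, b))"
  by (auto simp: on12_form_def on23_form_def)
lemma on13_form_eq: "on13_form K = on23_form K \<circ> (\<lambda>(a, b, c). (b, a, c))"
  by (auto simp: on13_form_def on23_form_def)

lemmas coalgebra_map_H_rotate = coalgebra_map_rotate[OF based_coalgebra_H based_coalgebra_H based_coalgebra_H]
lemmas coalgebra_map_H_swap12 = coalgebra_map_swap12[OF based_coalgebra_H based_coalgebra_H based_coalgebra_H]
lemmas coalgebra_map_H_swap23 = coalgebra_map_swap23[OF based_coalgebra_H based_coalgebra_H based_coalgebra_H]

lemma on_form_inverse:
  assumes "conv_inverse H2 K K'"
  shows "conv_inverse H3 (on12_form K) (on12_form K')" "conv_inverse H3 (on13_form K) (on13_form K')"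
    "conv_inverse H3 (on23_form K) (on23_form K')"
proof -
  show *: "conv_inverse H3 (on23_form K) (on23_form K')"
    using point_map_extend(1)[OF based_coalgebra_H based_coalgebra_H2 assms] by (simp add: on23_form_eq)
  show "conv_inverse H3 (on12_form K) (on12_form K')"
    unfolding on12_form_eq by (rule conv_inverse_pullback[OF coalgebra_map_H_rotate *])
  show "conv_inverse H3 (on13_form K) (on13_form K')"
    unfolding on13_form_eq by (rule conv_inverse_pullback[OF coalgebra_map_H_swap12 *])
qed

text \<open>
  The last two variables are covered by the extension of a functional by the counit; naturality under
  permutations of the variables transports this to the other positions.
\<close>

lemma point_map_on_form:
  assumes K: "conv_inverse H2 K K'" and xyz: "x \<in> carrier remnant" "y \<in> carrier remnant" "z \<in> carrier remnant"
  shows "point_map H3 (on12_form K) (x, y, z) = (case point_map H2 K (x, y) of (u, v) \<Rightarrow> (u, v, z))"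
    "point_map H3 (on13_form K) (x, y, z) = (case point_map H2 K (x, z) of (u, v) \<Rightarrow> (u, y, v))"
    "point_map H3 (on23_form K) (x, y, z) = (case point_map H2 K (y, z) of (u, v) \<Rightarrow> (x, u, v))"
proof -
  have *: "point_map H3 (on23_form K) (p, q, r) = (p, point_map H2 K (q, r))"
    if "p \<in> carrier remnant" "q \<in> carrier remnant" "r \<in> carrier remnant" for p q r
    using point_map_extend(2)[OF based_coalgebra_H based_coalgebra_H2 K, of p "(q, r)"] that
    by (simp add: on23_form_eq product_simps hopf_coalgebra_simps)
  show "point_map H3 (on23_form K) (x, y, z) = (case point_map H2 K (y, z) of (u, v) \<Rightarrow> (x, u, v))"
    using * xyz by (simp split: prod.split)
  have P: "(x, y, z) \<in> Points H3" using xyz by (simp add: product_simps hopf_coalgebra_simps)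
  note nat = point_map_natural[OF based_coalgebra_H3 based_coalgebra_H3 _ on_form_inverse(3)[OF K] P]
  show "point_map H3 (on12_form K) (x, y, z) = (case point_map H2 K (x, y) of (u, v) \<Rightarrow> (u, v, z))"
    using nat[OF coalgebra_map_H_rotate] * xyz
    by (cases "point_map H3 (on12_form K) (x, y, z)") (auto simp flip: on12_form_eq split: prod.split)
  show "point_map H3 (on13_form K) (x, y, z) = (case point_map H2 K (x, z) of (u, v) \<Rightarrow> (u, y, v))"
    using nat[OF coalgebra_map_H_swap12] * xyz
    by (cases "point_map H3 (on13_form K) (x, y, z)") (auto simp flip: on13_form_eq split: prod.split)
qed

text \<open>
  The counit in the first variable absorbs the splits of this variable.
\<close>

lemma conv_on23_form:
  assumes "\<phi> \<in> Funs H3"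
  shows "conv H3 (on23_form K) \<phi> (a, b, c) \<longleftrightarrow> conv H2 K (\<lambda>(b, c). \<phi> (a, b, c)) (b, c)"
    "conv H3 \<phi> (on23_form K) (a, b, c) \<longleftrightarrow> conv H2 (\<lambda>(b, c). \<phi> (a, b, c)) K (b, c)"
  using conv_extend_left[OF based_coalgebra_H assms, of K a "(b, c)"] conv_extend_right[OF based_coalgebra_H assms, of K a "(b, c)"]
  by (simp_all add: on23_form_eq case_prod_unfold)

lemma conv_on12_form:
  assumes "\<phi> \<in> Funs H3"
  shows "conv H3 (on12_form K) \<phi> (a, b, c) \<longleftrightarrow> conv H2 K (\<lambda>(a, b). \<phi> (a, b, c)) (a, b)"
    "conv H3 \<phi> (on12_form K) (a, b, c) \<longleftrightarrow> conv H2 (\<lambda>(a, b). \<phi> (a, b, c)) K (a, b)"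
proof -
  have e: "conv H \<chi> (\<lambda>c. P \<and> counit c) c \<longleftrightarrow> \<chi> c \<and> P" "conv H (\<lambda>c. P \<and> counit c) \<chi> c \<longleftrightarrow> P \<and> \<chi> c"
    if "\<chi> \<in> Funs H" for P \<chi>
    using based_coalgebra.conv_Counit_right[OF based_coalgebra_H that] based_coalgebra.conv_Counit_left[OF based_coalgebra_H that]
    by (cases P; simp add: hopf_coalgebra_simps based_coalgebra.conv_bot[OF based_coalgebra_H])+
  have \<phi>: "(\<lambda>c. \<phi> (a, b, c)) \<in> Funs H" for a b using assms by (simp add: product_simps)
  show "conv H3 (on12_form K) \<phi> (a, b, c) \<longleftrightarrow> conv H2 K (\<lambda>(a, b). \<phi> (a, b, c)) (a, b)"
    unfolding conv_product(2) by (simp add: on12_form_def e[OF \<phi>]) (simp add: conv_def)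
  show "conv H3 \<phi> (on12_form K) (a, b, c) \<longleftrightarrow> conv H2 (\<lambda>(a, b). \<phi> (a, b, c)) K (a, b)"
    unfolding conv_product(2) by (simp add: on12_form_def e[OF \<phi>]) (simp add: conv_def)
qed

end

section \<open>Sweedler expressions that are conjugations\<close>

context suplat_hopf_algebra
begin

lemma join_preserving_le_iff:
  fixes f :: "'h remnant_quotient \<Rightarrow> 'c::complete_lattice"
  assumes "join_preserving f"
  shows "f x \<le> c \<longleftrightarrow> (\<forall>p\<in>carrier remnant. p \<le> x \<longrightarrow> f p \<le> c)"
proof -
  have "f x = f (Sup {g \<in> quotient_units. g \<le> x})" using quotient_Sup_units[of x] by (rule arg_cong)
  also have "\<dots> = Sup (f ` {g \<in> quotient_units. g \<le> x})"
    using assms unfolding join_preserving_def by blast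
  finally show ?thesis by (auto simp: Sup_le_iff remnant_carrier)
qed

lemma pure_tensor_le_iff:
  fixes t :: "('h remnant_quotient, 'h remnant_quotient) tensor"
  shows "x \<otimes>\<^sub>S y \<le> t \<longleftrightarrow>
    (\<forall>p\<in>carrier remnant. \<forall>q\<in>carrier remnant. p \<le> x \<longrightarrow> q \<le> y \<longrightarrow> p \<otimes>\<^sub>S q \<le> t)"
  unfolding join_preserving_le_iff[OF pure_tensor_join_preserving(1)[of y], of x]
  using join_preserving_le_iff[OF pure_tensor_join_preserving(2), of _ y t] by blast

lemma pure_tensor3_le_iff:
  fixes t :: "('h remnant_quotient, ('h remnant_quotient, 'h remnant_quotient) tensor) tensor"
  shows "x \<otimes>\<^sub>S y \<otimes>\<^sub>S z \<le> t \<longleftrightarrow>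
    (\<forall>p\<in>carrier remnant. \<forall>q\<in>carrier remnant. \<forall>r\<in>carrier remnant.
      p \<le> x \<longrightarrow> q \<le> y \<longrightarrow> r \<le> z \<longrightarrow> p \<otimes>\<^sub>S q \<otimes>\<^sub>S r \<le> t)"
proof -
  have y: "p \<otimes>\<^sub>S y \<otimes>\<^sub>S z \<le> t \<longleftrightarrow> (\<forall>q\<in>carrier remnant. q \<le> y \<longrightarrow> p \<otimes>\<^sub>S q \<otimes>\<^sub>S z \<le> t)" for p
    by (rule join_preserving_le_iff)
      (intro join_preserving_comp[OF pure_tensor_join_preserving(2)] pure_tensor_join_preserving)
  have z: "p \<otimes>\<^sub>S q \<otimes>\<^sub>S z \<le> t \<longleftrightarrow> (\<forall>r\<in>carrier remnant. r \<le> z \<longrightarrow> p \<otimes>\<^sub>S q \<otimes>\<^sub>S r \<le> t)" for p q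
    by (rule join_preserving_le_iff)
      (intro join_preserving_comp[OF pure_tensor_join_preserving(2)] pure_tensor_join_preserving)
  show ?thesis
    unfolding join_preserving_le_iff[OF pure_tensor_join_preserving(1)[of "y \<otimes>\<^sub>S z"], of x]
    unfolding y unfolding z by blast
qed

text \<open>
  The functional that is true on \<open>(x, y)\<close> unless \<open>x\<close> lies below \<open>u'\<close> or \<open>y\<close> is zero vanishes on \<open>u' \<otimes> v'\<close>;
  hence it vanishes on \<open>u \<otimes> v\<close>, which gives \<open>u \<le> u'\<close>. The second component is similar. Without this
  the description of the braiding operator by pure tensors would not determine its values.
\<close>

lemma pure_tensor_inject:
  fixes u v u' v' :: "'h remnant_quotient"
  assumes "u \<in> carrier remnant" "v \<in> carrier remnant" "u' \<in> carrier remnant" "v' \<in> carrier remnant"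
    and eq: "u \<otimes>\<^sub>S v = u' \<otimes>\<^sub>S v'"
  shows "u = u' \<and> v = v'"
proof -
  have f: "u1 \<le> u2 \<and> v1 \<le> v2"
    if uv: "u1 \<otimes>\<^sub>S v1 = u2 \<otimes>\<^sub>S v2" "u1 \<noteq> bot" "v1 \<noteq> bot" for u1 v1 u2 v2 :: "'h remnant_quotient"
  proof -
    have j: "join_preserving (\<lambda>x. \<not> x \<le> w)" for w :: "'h remnant_quotient"
      by (auto simp: join_preserving_bool Sup_le_iff)
    have "bi_join_preserving (\<lambda>x (y :: 'h remnant_quotient). \<not> x \<le> u2 \<and> \<not> y \<le> bot)" "bi_join_preserving (\<lambda>(x :: 'h remnant_quotient) y. \<not> x \<le> bot \<and> \<not> y \<le> v2)"
      by (intro bi_join_preserving_bool_and j)+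
    note l = this[THEN tensor_universal(2)]
    show ?thesis using l[of u1 v1] l[of u2 v2] uv bot_unique by auto
  qed
  have "u \<noteq> bot" "v \<noteq> bot" using assms quotient_unit_neq_bot by (auto simp: remnant_carrier)
  then have "u \<le> u'" "v \<le> v'" using f[OF eq] by auto
  then show ?thesis
    using quotient_unit_atom[of u' u] quotient_unit_atom[of v' v] \<open>u \<noteq> bot\<close> \<open>v \<noteq> bot\<close> assms
    by (auto simp: remnant_carrier)
qed

lemma sweedler3_le_iff:
  "sweedler3 \<Delta> a f \<le> t \<longleftrightarrow> (\<forall>a1 y a2 a3. (a1, y) \<in> Splits H a \<longrightarrow> (a2, a3) \<in> Splits H y \<longrightarrow> f a1 a2 a3 \<le> t)"
  unfolding sweedler3_def sweedler_def tensor_lift_le hopf_coalgebra_simps by blast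

lemma scalar_le_iff: "s \<bullet> x \<le> t \<longleftrightarrow> (s \<longrightarrow> x \<le> t)"
  by (simp add: scalar_def)

lemma conv_conv_Splits:
  "conv C K (conv C \<delta> K') a \<longleftrightarrow>
    (\<exists>a1 y a2 a3. (a1, y) \<in> Splits C a \<and> (a2, a3) \<in> Splits C y \<and> K a1 \<and> \<delta> a2 \<and> K' a3)"
  unfolding conv_def bex_pair by blast

text \<open>
  An upper bound \<open>t\<close> of the expression is an upper bound of \<open>h p q\<close> for those points at which the
  conjugated coordinate functional of \<open>(p, q)\<close> is true on \<open>(a, b)\<close>. As the classes of \<open>a\<close> and \<open>b\<close> are
  points, this singles out the image of these classes under the permutation. The function \<open>h\<close> is
  the pure tensor, with its factors exchanged in the case of the braiding.
\<close>

lemma conjugation_expr2_eq: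
  fixes h :: "'h remnant_quotient \<Rightarrow> 'h remnant_quotient \<Rightarrow> 'c::complete_lattice"
  assumes K: "conv_inverse H2 (\<lambda>(a, b). K a b) (\<lambda>(a, b). K' a b)"
    and g: "\<And>a b t. g a b \<le> t \<longleftrightarrow> (\<forall>p\<in>carrier remnant. \<forall>q\<in>carrier remnant.
      p \<le> remnant_proj a \<longrightarrow> q \<le> remnant_proj b \<longrightarrow> h p q \<le> t)"
    and ab: "remnant_proj a \<in> carrier remnant" "remnant_proj b \<in> carrier remnant"
  shows "sweedler3 \<Delta> a (\<lambda>a1 a2 a3. sweedler3 \<Delta> b (\<lambda>b1 b2 b3. K a1 b1 \<bullet> K' a3 b3 \<bullet> g a2 b2))
    = case_prod h (point_map H2 (\<lambda>(a, b). K a b) (remnant_proj a, remnant_proj b))" (is "?E = _")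
proof -
  let ?f = "point_map H2 (\<lambda>(a, b). K a b)"
  have "?E \<le> t \<longleftrightarrow> case_prod h (?f (remnant_proj a, remnant_proj b)) \<le> t" for t
  proof -
    have "?E \<le> t \<longleftrightarrow> (\<forall>p\<in>carrier remnant. \<forall>q\<in>carrier remnant.
      conv H2 (\<lambda>(a, b). K a b) (conv H2 (Coord H2 (p, q)) (\<lambda>(a, b). K' a b)) (a, b) \<longrightarrow> h p q \<le> t)"
      unfolding sweedler3_le_iff scalar_le_iff g conv_conv_Splits split_paired_Ex product_simps(2,5)
        hopf_coalgebra_simps(5) prod.case by blast
    also have "\<dots> \<longleftrightarrow> (\<forall>p\<in>carrier remnant. \<forall>q\<in>carrier remnant.
      ?f (remnant_proj a, remnant_proj b) = (p, q) \<longrightarrow> h p q \<le> t)"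
    proof (intro ball_cong refl)
      fix p q :: "'h remnant_quotient" assume "p \<in> carrier remnant" "q \<in> carrier remnant"
      then have "conv H2 (\<lambda>(a, b). K a b) (conv H2 (Coord H2 (p, q)) (\<lambda>(a, b). K' a b)) (a, b) \<longleftrightarrow>
        ?f (remnant_proj a, remnant_proj b) = (p, q)"
        using ab remnant_atom by (subst based_coalgebra.conjugate_Coord[OF based_coalgebra_H2 K])
          (auto simp: product_simps hopf_coalgebra_simps)
      then show "(conv H2 (\<lambda>(a, b). K a b) (conv H2 (Coord H2 (p, q)) (\<lambda>(a, b). K' a b)) (a, b) \<longrightarrow> h p q \<le> t)
        \<longleftrightarrow> (?f (remnant_proj a, remnant_proj b) = (p, q) \<longrightarrow> h p q \<le> t)" by simp
    qed
    also have "\<dots> \<longleftrightarrow> case_prod h (?f (remnant_proj a, remnant_proj b)) \<le> t"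
      using based_coalgebra.point_map(1)[OF based_coalgebra_H2 K, of "(remnant_proj a, remnant_proj b)"] ab
      by (auto simp: product_simps hopf_coalgebra_simps split: prod.split)
    finally show ?thesis .
  qed
  then show ?thesis by (meson order.antisym order.refl)
qed

lemma conjugation_expr3_eq:
  fixes h :: "'h remnant_quotient \<Rightarrow> 'h remnant_quotient \<Rightarrow> 'h remnant_quotient \<Rightarrow> 'c::complete_lattice"
  assumes K: "conv_inverse H3 (\<lambda>(a, b, c). K a b c) (\<lambda>(a, b, c). K' a b c)"
    and g: "\<And>a b c t. g a b c \<le> t \<longleftrightarrow> (\<forall>p\<in>carrier remnant. \<forall>q\<in>carrier remnant. \<forall>r\<in>carrier remnant.
      p \<le> remnant_proj a \<longrightarrow> q \<le> remnant_proj b \<longrightarrow> r \<le> remnant_proj c \<longrightarrow> h p q r \<le> t)"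
    and abc: "remnant_proj a \<in> carrier remnant" "remnant_proj b \<in> carrier remnant" "remnant_proj c \<in> carrier remnant"
  shows "sweedler3 \<Delta> a (\<lambda>a1 a2 a3. sweedler3 \<Delta> b (\<lambda>b1 b2 b3. sweedler3 \<Delta> c (\<lambda>c1 c2 c3.
      K a1 b1 c1 \<bullet> K' a3 b3 c3 \<bullet> g a2 b2 c2)))
    = (case point_map H3 (\<lambda>(a, b, c). K a b c) (remnant_proj a, remnant_proj b, remnant_proj c) of
        (u, v, w) \<Rightarrow> h u v w)" (is "?E = ?V")
proof -
  let ?f = "point_map H3 (\<lambda>(a, b, c). K a b c)"
  let ?x = "(remnant_proj a, remnant_proj b, remnant_proj c)"
  have "?E \<le> t \<longleftrightarrow> ?V \<le> t" for t
  proof -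
    have "?E \<le> t \<longleftrightarrow> (\<forall>p\<in>carrier remnant. \<forall>q\<in>carrier remnant. \<forall>r\<in>carrier remnant.
      conv H3 (\<lambda>(a, b, c). K a b c) (conv H3 (Coord H3 (p, q, r)) (\<lambda>(a, b, c). K' a b c)) (a, b, c) \<longrightarrow> h p q r \<le> t)"
      unfolding sweedler3_le_iff scalar_le_iff g conv_conv_Splits split_paired_Ex product_simps(2,5)
        hopf_coalgebra_simps(5) prod.case by blast
    also have "\<dots> \<longleftrightarrow> (\<forall>p\<in>carrier remnant. \<forall>q\<in>carrier remnant. \<forall>r\<in>carrier remnant.
      ?f ?x = (p, q, r) \<longrightarrow> h p q r \<le> t)"
    proof (intro ball_cong refl)
      fix p q r :: "'h remnant_quotient"
      assume "p \<in> carrier remnant" "q \<in> carrier remnant" "r \<in> carrier remnant"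
      then have "conv H3 (\<lambda>(a, b, c). K a b c) (conv H3 (Coord H3 (p, q, r)) (\<lambda>(a, b, c). K' a b c)) (a, b, c) \<longleftrightarrow>
        ?f ?x = (p, q, r)"
        using abc remnant_atom by (subst based_coalgebra.conjugate_Coord[OF based_coalgebra_H3 K])
          (auto simp: product_simps hopf_coalgebra_simps)
      then show "(conv H3 (\<lambda>(a, b, c). K a b c) (conv H3 (Coord H3 (p, q, r)) (\<lambda>(a, b, c). K' a b c)) (a, b, c) \<longrightarrow> h p q r \<le> t)
        \<longleftrightarrow> (?f ?x = (p, q, r) \<longrightarrow> h p q r \<le> t)" by simp
    qed
    also have "\<dots> \<longleftrightarrow> ?V \<le> t"
      using based_coalgebra.point_map(1)[OF based_coalgebra_H3 K, of ?x] abc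
      by (auto simp: product_simps hopf_coalgebra_simps split: prod.split)
    finally show ?thesis .
  qed
  then show ?thesis by (meson order.antisym order.refl)
qed

lemma conjugation_induces3:
  assumes K: "conv_inverse H3 (\<lambda>(a, b, c). K a b c) (\<lambda>(a, b, c). K' a b c)"
  shows "induces3 (\<lambda>a b c. sweedler3 \<Delta> a (\<lambda>a1 a2 a3. sweedler3 \<Delta> b (\<lambda>b1 b2 b3. sweedler3 \<Delta> c (\<lambda>c1 c2 c3.
      K a1 b1 c1 \<bullet> K' a3 b3 c3 \<bullet> (remnant_proj a2 \<otimes>\<^sub>S remnant_proj b2 \<otimes>\<^sub>S remnant_proj c2)))))
    (point_map H3 (\<lambda>(a, b, c). K a b c))"
  unfolding induces3_def
proof (intro allI impI)
  fix a b c :: 'h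
  let ?x = "(remnant_proj a, remnant_proj b, remnant_proj c)"
  assume abc: "remnant_proj a \<in> carrier remnant \<and> remnant_proj b \<in> carrier remnant \<and>
    remnant_proj c \<in> carrier remnant"
  obtain u v w where uvw: "point_map H3 (\<lambda>(a, b, c). K a b c) ?x = (u, v, w)"
    using prod_cases3 by blast
  have "u \<in> carrier remnant" "v \<in> carrier remnant" "w \<in> carrier remnant"
    using based_coalgebra.point_map(1)[OF based_coalgebra_H3 K, of ?x] abc uvw
    by (auto simp: product_simps hopf_coalgebra_simps)
  then show "\<exists>u\<in>carrier remnant. \<exists>v\<in>carrier remnant. \<exists>w\<in>carrier remnant.
      point_map H3 (\<lambda>(a, b, c). K a b c) ?x = (u, v, w) \<and>
      sweedler3 \<Delta> a (\<lambda>a1 a2 a3. sweedler3 \<Delta> b (\<lambda>b1 b2 b3. sweedler3 \<Delta> c (\<lambda>c1 c2 c3.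
        K a1 b1 c1 \<bullet> K' a3 b3 c3 \<bullet> (remnant_proj a2 \<otimes>\<^sub>S remnant_proj b2 \<otimes>\<^sub>S remnant_proj c2))))
      = u \<otimes>\<^sub>S v \<otimes>\<^sub>S w"
    using conjugation_expr3_eq[OF K pure_tensor3_le_iff, of a b c] abc uvw by auto
qed

end

section \<open>The braiding operator of a co-quasitriangular structure\<close>

locale coquasitriangular_hopf_algebra = suplat_hopf_algebra \<Delta> S
  for \<Delta> :: "'h::suplat_augmented_algebra \<Rightarrow> ('h, 'h) tensor" and S :: "'h \<Rightarrow> 'h" +
  fixes R R' :: "('h, 'h) tensor \<Rightarrow> bool"
  assumes cqt: "co_quasitriangular \<Delta> R R'"
begin

lemma R_inverse: "conv_inverse H2 (form R) (form R')"
  using cqt unfolding co_quasitriangular_def by (intro form_inverse) auto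

lemma R_Funs: "form R \<in> Funs H2"
  using R_inverse by (simp add: conv_inverse_def)

text \<open>
  The functional form of the relation \<open>R(b\<^sub>1, a\<^sub>1) a\<^sub>2 b\<^sub>2 = b\<^sub>1 a\<^sub>1 R(b\<^sub>2, a\<^sub>2)\<close>, to be applied to the
  coordinate functionals of \<open>G\<close> and to the co-twist with one argument fixed.
\<close>

lemma braided_commutativity:
  assumes \<phi>: "join_preserving \<phi>"
  shows "conv H2 (\<lambda>(a, b). \<phi> (a * b)) (form R) = conv H2 (form R) (\<lambda>(a, b). \<phi> (b * a))"
proof (rule ext, clarify)
  fix b a
  have "\<not> \<phi> bot" using \<phi> by (metis Sup_empty empty_iff join_preserving_bool)
  then have s: "\<phi> (c \<bullet> x) \<longleftrightarrow> c \<and> \<phi> x" for c x by (simp add: scalar_def)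
  have "sweedler \<Delta> a (\<lambda>a1 a2. sweedler \<Delta> b (\<lambda>b1 b2. R (b1 \<otimes>\<^sub>S a1) \<bullet> (a2 * b2)))
      = sweedler \<Delta> a (\<lambda>a1 a2. sweedler \<Delta> b (\<lambda>b1 b2. R (b2 \<otimes>\<^sub>S a2) \<bullet> (b1 * a1)))"
    using cqt unfolding co_quasitriangular_def by blast
  then have "\<phi> (sweedler \<Delta> a (\<lambda>a1 a2. sweedler \<Delta> b (\<lambda>b1 b2. R (b1 \<otimes>\<^sub>S a1) \<bullet> (a2 * b2))))
      = \<phi> (sweedler \<Delta> a (\<lambda>a1 a2. sweedler \<Delta> b (\<lambda>b1 b2. R (b2 \<otimes>\<^sub>S a2) \<bullet> (b1 * a1))))"
    by (rule arg_cong)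
  then have "(\<exists>(a1, a2)\<in>Splits H a. \<exists>(b1, b2)\<in>Splits H b. R (b1 \<otimes>\<^sub>S a1) \<and> \<phi> (a2 * b2)) \<longleftrightarrow>
      (\<exists>(a1, a2)\<in>Splits H a. \<exists>(b1, b2)\<in>Splits H b. R (b2 \<otimes>\<^sub>S a2) \<and> \<phi> (b1 * a1))"
    unfolding sweedler_def join_preserving_tensor_lift[OF \<phi>] s tensor_lift_Splits .
  then show "conv H2 (\<lambda>(a, b). \<phi> (a * b)) (form R) (b, a) = conv H2 (form R) (\<lambda>(a, b). \<phi> (b * a)) (b, a)"
    unfolding conv_def ex_Splits_product' form_def prod.case by (simp add: conj_commute)
qed

text \<open>
  This is the braiding operator followed by a flip.
\<close>

abbreviation "R_map \<equiv> point_map H2 (form R)"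

lemma R_map_closed:
  assumes "x \<in> carrier remnant" "y \<in> carrier remnant" "R_map (x, y) = (u, v)"
  shows "u \<in> carrier remnant" "v \<in> carrier remnant"
  using based_coalgebra.point_map(1)[OF based_coalgebra_H2 R_inverse, of "(x, y)"] assms
  by (auto simp: product_simps hopf_coalgebra_simps)

lemma braiding_expr_eq:
  assumes "remnant_proj a \<in> carrier remnant" "remnant_proj b \<in> carrier remnant"
  shows "braiding_expr \<Delta> R R' a b = (case R_map (remnant_proj a, remnant_proj b) of (u, v) \<Rightarrow> v \<otimes>\<^sub>S u)"
proof -
  have g: "remnant_proj b \<otimes>\<^sub>S remnant_proj a \<le> t \<longleftrightarrow> (\<forall>p\<in>carrier remnant. \<forall>q\<in>carrier remnant.
      p \<le> remnant_proj a \<longrightarrow> q \<le> remnant_proj b \<longrightarrow> q \<otimes>\<^sub>S p \<le> t)"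
    for a b :: 'h and t by (subst pure_tensor_le_iff) blast
  show ?thesis unfolding braiding_expr_def form_def
    by (rule conjugation_expr2_eq[OF _ g assms]) (use R_inverse in \<open>simp add: form_def\<close>)
qed

text \<open>
  The description of the braiding by pure tensors has a unique solution because pure tensors of points
  determine their factors.
\<close>

lemma remnant_braiding_eq:
  assumes xy: "x \<in> carrier remnant" "y \<in> carrier remnant"
  shows "remnant_braiding \<Delta> R R' (x, y) = prod.swap (R_map (x, y))"
proof -
  obtain v u where vu: "R_map (x, y) = (v, u)" by force
  have c: "v \<in> carrier remnant" "u \<in> carrier remnant" using R_map_closed[OF xy vu] by auto
  have "(THE (u, v). u \<in> carrier remnant \<and> v \<in> carrier remnant \<and>
     (\<forall>a b. remnant_proj a = x \<and> remnant_proj b = y \<longrightarrow> braiding_expr \<Delta> R R' a b = u \<otimes>\<^sub>S v)) = (u, v)"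
  proof (rule the_equality, goal_cases)
    case 1
    then show ?case using c vu xy braiding_expr_eq by auto
  next
    case (2 s)
    obtain u' v' where s: "s = (u', v')" by (cases s)
    have "braiding_expr \<Delta> R R' (remnant_rep x) (remnant_rep y) = u' \<otimes>\<^sub>S v'"
      using 2 by (simp add: s)
    then have "u \<otimes>\<^sub>S v = u' \<otimes>\<^sub>S v'"
      using braiding_expr_eq[of "remnant_rep x" "remnant_rep y"] xy by (simp add: vu)
    then show ?case using pure_tensor_inject[of u v u' v'] c 2 by (simp add: s)
  qed
  then show ?thesis by (simp add: remnant_braiding_def vu)
qed

lemma braiding_induced: "induces2 (braiding_expr \<Delta> R R') (remnant_braiding \<Delta> R R')"
  unfolding induces2_def
proof (intro allI impI)
  fix a b :: 'h
  assume ab: "remnant_proj a \<in> carrier remnant \<and> remnant_proj b \<in> carrier remnant"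
  obtain v u where vu: "R_map (remnant_proj a, remnant_proj b) = (v, u)" by force
  show "\<exists>u\<in>carrier remnant. \<exists>v\<in>carrier remnant.
      remnant_braiding \<Delta> R R' (remnant_proj a, remnant_proj b) = (u, v) \<and>
      braiding_expr \<Delta> R R' a b = u \<otimes>\<^sub>S v"
    using R_map_closed[OF _ _ vu] ab by (auto simp: braiding_expr_eq remnant_braiding_eq vu)
qed

text \<open>
  The first multiplicativity axiom as a factorisation \<open>R\<^sub>2\<^sub>3 * R\<^sub>1\<^sub>3\<close> of the pullback of \<open>R\<close> along the
  multiplication of the first two variables; the next lemma is the second axiom, with \<open>R\<^sub>1\<^sub>2 * R\<^sub>1\<^sub>3\<close>.
\<close>

lemma R_mult_left: "form R \<circ> (\<lambda>(a, b, c). (a * b, c)) = conv H3 (on23_form (form R)) (on13_form (form R))"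
proof (rule ext, clarify)
  fix a b c
  have "conv H3 (on23_form (form R)) (on13_form (form R)) (a, b, c) \<longleftrightarrow>
      conv H2 (form R) (\<lambda>(b, c). counit b \<and> R (a \<otimes>\<^sub>S c)) (b, c)"
    using on_form_inverse(2)[OF R_inverse]
    by (simp add: conv_on23_form conv_inverse_def) (simp add: on13_form_def form_def conj_commute)
  also have "\<dots> \<longleftrightarrow> conv H (\<lambda>c. R (b \<otimes>\<^sub>S c)) (\<lambda>c. R (a \<otimes>\<^sub>S c)) c"
    using conv_extend_right[OF based_coalgebra_H R_Funs, of "\<lambda>c. R (a \<otimes>\<^sub>S c)" b c]
    by (simp add: hopf_coalgebra_simps form_def)
  also have "\<dots> \<longleftrightarrow> R ((a * b) \<otimes>\<^sub>S c)"
    using cqt unfolding co_quasitriangular_def by (simp add: conv_def sweedler_Splits)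
  finally show "(form R \<circ> (\<lambda>(a, b, c). (a * b, c))) (a, b, c) = conv H3 (on23_form (form R)) (on13_form (form R)) (a, b, c)"
    by (simp add: form_def)
qed

lemma R_mult_right: "form R \<circ> (\<lambda>(a, b, c). (a, b * c)) = conv H3 (on12_form (form R)) (on13_form (form R))"
proof (rule ext, clarify)
  fix a b c
  have "conv H3 (on12_form (form R)) (on13_form (form R)) (a, b, c) \<longleftrightarrow>
      conv H2 (form R) (\<lambda>(a, b). R (a \<otimes>\<^sub>S c) \<and> counit b) (a, b)"
    using on_form_inverse(2)[OF R_inverse]
    by (simp add: conv_on12_form conv_inverse_def) (simp add: on13_form_def form_def)
  also have "\<dots> \<longleftrightarrow> (\<exists>(a1, a2)\<in>Splits H a. R (a1 \<otimes>\<^sub>S b) \<and> R (a2 \<otimes>\<^sub>S c))"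
  proof -
    have \<chi>: "(\<lambda>y. R (a1 \<otimes>\<^sub>S y)) \<in> Funs H" for a1 using R_Funs by (simp add: product_simps form_def)
    have "conv H (\<lambda>y. R (a1 \<otimes>\<^sub>S y)) (\<lambda>y. P \<and> counit y) b \<longleftrightarrow> R (a1 \<otimes>\<^sub>S b) \<and> P" for a1 P
      using based_coalgebra.conv_Counit_right[OF based_coalgebra_H \<chi>]
      by (cases P; simp add: hopf_coalgebra_simps based_coalgebra.conv_bot[OF based_coalgebra_H])
    then show ?thesis by (simp add: conv_product(2) form_def)
  qed
  also have "\<dots> \<longleftrightarrow> R (a \<otimes>\<^sub>S (b * c))"
    using cqt unfolding co_quasitriangular_def by (simp add: sweedler_Splits)
  finally show "(form R \<circ> (\<lambda>(a, b, c). (a, b * c))) (a, b, c) = conv H3 (on12_form (form R)) (on13_form (form R)) (a, b, c)"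
    by (simp add: form_def)
qed

text \<open>
  Multiplicativity makes the functional \<open>R(1, -)\<close> idempotent, and it is invertible as a pullback of \<open>R\<close>.
\<close>

lemma R_one: "form R \<circ> Pair 1 = Counit H" "form R \<circ> (\<lambda>a. (a, 1)) = Counit H"
proof -
  interpret H: based_coalgebra H by (rule based_coalgebra_H)
  note l = coalgebra_map_insert_left[OF grouplike_one based_coalgebra_H]
  note r = coalgebra_map_insert_right[OF grouplike_one based_coalgebra_H]
  show "form R \<circ> Pair 1 = Counit H"
  proof (rule H.idempotent_invertible[OF conv_inverse_pullback[OF l R_inverse]], rule ext)
    fix c
    have "R ((1 * 1) \<otimes>\<^sub>S c) = sweedler \<Delta> c (\<lambda>c1 c2. R (1 \<otimes>\<^sub>S c1) \<and> R (1 \<otimes>\<^sub>S c2))"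
      using cqt unfolding co_quasitriangular_def by blast
    then show "conv H (form R \<circ> Pair 1) (form R \<circ> Pair 1) c = (form R \<circ> Pair 1) c"
      by (simp add: conv_def form_def sweedler_Splits)
  qed
  show "form R \<circ> (\<lambda>a. (a, 1)) = Counit H"
  proof (rule H.idempotent_invertible[OF conv_inverse_pullback[OF r R_inverse]], rule ext)
    fix a
    have "R (a \<otimes>\<^sub>S (1 * 1)) = sweedler \<Delta> a (\<lambda>a1 a2. R (a1 \<otimes>\<^sub>S 1) \<and> R (a2 \<otimes>\<^sub>S 1))"
      using cqt unfolding co_quasitriangular_def by blast
    then show "conv H (form R \<circ> (\<lambda>a. (a, 1))) (form R \<circ> (\<lambda>a. (a, 1))) a = (form R \<circ> (\<lambda>a. (a, 1))) a"
      by (simp add: conv_def form_def sweedler_Splits)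
  qed
qed

lemma R_map_one:
  assumes "x \<in> carrier remnant" shows "R_map (1, x) = (1, x)" "R_map (x, 1) = (x, 1)"
proof -
  interpret H: based_coalgebra H by (rule based_coalgebra_H)
  have x: "x \<in> Points H" using assms by (simp add: hopf_coalgebra_simps)
  note l = coalgebra_map_insert_left[OF grouplike_one based_coalgebra_H]
  note r = coalgebra_map_insert_right[OF grouplike_one based_coalgebra_H]
  show "R_map (1, x) = (1, x)"
    using point_map_natural[OF based_coalgebra_H based_coalgebra_H2 l R_inverse x] by (simp add: R_one H.point_map_Counit[OF x])
  show "R_map (x, 1) = (x, 1)"
    using point_map_natural[OF based_coalgebra_H based_coalgebra_H2 r R_inverse x] by (simp add: R_one H.point_map_Counit[OF x])
qed

text \<open>
  By braided commutativity, \<open>R\<close> intertwines the fibre of the multiplication over \<open>x y\<close> with that of the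
  opposite multiplication.
\<close>

lemma R_map_mult:
  assumes xy: "x \<in> carrier remnant" "y \<in> carrier remnant" and "R_map (x, y) = (u, v)"
  shows "v * u = x * y"
proof -
  interpret H: based_coalgebra H by (rule based_coalgebra_H)
  interpret H2: based_coalgebra H2 by (rule based_coalgebra_H2)
  note uv = R_map_closed[OF assms]
  have xy': "x * y \<in> carrier remnant" "v * u \<in> carrier remnant"
    using xy uv by (simp_all add: remnant_carrier quotient_units_mult)
  let ?\<delta> = "Coord H (x * y)"
  have \<delta>: "?\<delta> \<in> Funs H" "?\<delta> \<le> Counit H"
    using xy'(1) H.Coord_Funs H.Coord_le_Counit unfolding hopf_coalgebra_simps(4) by blast+
  then have "conv H2 (\<lambda>(a, b). ?\<delta> (a * b)) (form R) = conv H2 (form R) (\<lambda>(a, b). ?\<delta> (b * a))"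
    by (intro braided_commutativity) (simp add: hopf_coalgebra_simps(1))
  moreover have "(\<lambda>(a, b). ?\<delta> (a * b)) \<in> Funs H2" "(\<lambda>(a, b). ?\<delta> (b * a)) \<in> Funs H2"
    using \<delta>(1) by (simp_all add: product_simps hopf_coalgebra_simps(1) join_preserving_comp[of ?\<delta>] mult_join_preserving)
  moreover have "(\<lambda>(a, b). ?\<delta> (a * b)) \<le> Counit H2" "(\<lambda>(a, b). ?\<delta> (b * a)) \<le> Counit H2"
    using \<delta>(2) by (auto simp: le_fun_def product_simps hopf_coalgebra_simps(3) counit_mult)
  ultimately have "(\<lambda>(a, b). ?\<delta> (a * b)) (Rep H2 (x, y)) \<longleftrightarrow> (\<lambda>(a, b). ?\<delta> (b * a)) (Rep H2 (R_map (x, y)))"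
    by (intro H2.intertwined_iff[OF R_inverse]) (use xy in \<open>auto simp: product_simps hopf_coalgebra_simps\<close>)
  then show ?thesis
    using xy' remnant_atom[of "remnant_rep v * remnant_rep u" "x * y"]
    by (simp add: assms(3) product_simps hopf_coalgebra_simps flip: proj_mult)
qed

text \<open>
  The factorisation \<open>R\<^sub>2\<^sub>3 * R\<^sub>1\<^sub>3\<close>, read as a composition of permutations of \<open>G\<^sup>3\<close>: the left factor acts
  first.
\<close>

lemma R_map_mult_left:
  assumes "x \<in> carrier remnant" "y \<in> carrier remnant" "z \<in> carrier remnant"
    and "R_map (y, z) = (a, b)" "R_map (x, b) = (c, d)"
  shows "R_map (x * y, z) = (c * a, d)"
proof -
  interpret H3: based_coalgebra H3 by (rule based_coalgebra_H3)
  have P: "(x, y, z) \<in> Points H3" using assms by (simp add: product_simps hopf_coalgebra_simps)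
  have ab: "a \<in> carrier remnant" "b \<in> carrier remnant" using R_map_closed assms by blast+
  have "point_map H3 (form R \<circ> (\<lambda>(a, b, c). (a * b, c))) (x, y, z) = (c, a, d)"
    unfolding R_mult_left H3.point_map_conv[OF on_form_inverse(3)[OF R_inverse] on_form_inverse(2)[OF R_inverse] P]
    using assms ab by (simp add: point_map_on_form[OF R_inverse])
  then show ?thesis
    using point_map_natural[OF based_coalgebra_H3 based_coalgebra_H2 coalgebra_map_m12 R_inverse P] by simp
qed

lemma R_map_mult_right:
  assumes "x \<in> carrier remnant" "y \<in> carrier remnant" "z \<in> carrier remnant"
    and "R_map (x, y) = (a, b)" "R_map (a, z) = (c, d)"
  shows "R_map (x, y * z) = (c, b * d)"
proof -
  interpret H3: based_coalgebra H3 by (rule based_coalgebra_H3)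
  have P: "(x, y, z) \<in> Points H3" using assms by (simp add: product_simps hopf_coalgebra_simps)
  have ab: "a \<in> carrier remnant" "b \<in> carrier remnant" using R_map_closed assms by blast+
  have "point_map H3 (form R \<circ> (\<lambda>(a, b, c). (a, b * c))) (x, y, z) = (c, b, d)"
    unfolding R_mult_right H3.point_map_conv[OF on_form_inverse(1)[OF R_inverse] on_form_inverse(2)[OF R_inverse] P]
    using assms ab by (simp add: point_map_on_form[OF R_inverse])
  then show ?thesis
    using point_map_natural[OF based_coalgebra_H3 based_coalgebra_H2 coalgebra_map_m23 R_inverse P] by simp
qed

theorem remnant_braided_group: "braided_group remnant (remnant_braiding \<Delta> R R')"
proof -
  let ?r = "remnant_braiding \<Delta> R R'"
  interpret group "remnant :: 'h remnant_quotient monoid" by (rule remnant_group)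
  have one: "1 \<in> carrier (remnant :: 'h remnant_quotient monoid)"
    by (simp add: remnant_carrier one_mem_quotient_units)
  have mult: "x * y \<in> carrier remnant" if "x \<in> carrier remnant" "y \<in> carrier remnant"
    for x y :: "'h remnant_quotient" using that by (simp add: remnant_carrier quotient_units_mult)
  show ?thesis
  proof
    show "?r \<in> carrier2 remnant \<rightarrow> carrier2 remnant"
    proof
      fix p assume "p \<in> carrier2 (remnant :: 'h remnant_quotient monoid)"
      then obtain x y where p: "p = (x, y)" "x \<in> carrier remnant" "y \<in> carrier remnant" by auto
      obtain u v where uv: "R_map (x, y) = (u, v)" by force
      show "?r p \<in> carrier2 remnant" using R_map_closed[OF p(2,3) uv] p by (simp add: remnant_braiding_eq uv)
    qed
    fix g assume "g \<in> carrier (remnant :: 'h remnant_quotient monoid)"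
    then show "?r (\<one>\<^bsub>remnant\<^esub>, g) = (g, \<one>\<^bsub>remnant\<^esub>)" "?r (g, \<one>\<^bsub>remnant\<^esub>) = (\<one>\<^bsub>remnant\<^esub>, g)"
      using one by (simp_all add: remnant_one remnant_braiding_eq R_map_one)
  next
    fix t assume "t \<in> carrier3 (remnant :: 'h remnant_quotient monoid)"
    then obtain x y z where t: "t = (x, y, z)"
      and xyz: "x \<in> carrier remnant" "y \<in> carrier remnant" "z \<in> carrier remnant" by auto
    obtain a b where ab: "R_map (y, z) = (a, b)" by force
    obtain c d where cd: "R_map (x, b) = (c, d)" by force
    have "a \<in> carrier remnant" "b \<in> carrier remnant" using R_map_closed[OF xyz(2,3) ab] by auto
    then show "?r (mult12 remnant t) = mult23 remnant (on12 ?r (on23 ?r t))"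
      using xyz mult R_map_mult_left[OF xyz ab cd] ab cd
      by (simp add: t mult12_def mult23_def on12_def on23_def remnant_mult remnant_braiding_eq)
    obtain a b where ab: "R_map (x, y) = (a, b)" by force
    obtain c d where cd: "R_map (a, z) = (c, d)" by force
    have "a \<in> carrier remnant" "b \<in> carrier remnant" using R_map_closed[OF xyz(1,2) ab] by auto
    then show "?r (mult23 remnant t) = mult12 remnant (on23 ?r (on12 ?r t))"
      using xyz mult R_map_mult_right[OF xyz ab cd] ab cd
      by (simp add: t mult12_def mult23_def on12_def on23_def remnant_mult remnant_braiding_eq)
  next
    fix p assume "p \<in> carrier2 (remnant :: 'h remnant_quotient monoid)"
    then obtain x y where p: "p = (x, y)" "x \<in> carrier remnant" "y \<in> carrier remnant" by auto
    obtain u v where uv: "R_map (x, y) = (u, v)" by force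
    show "(case ?r p of (u, v) \<Rightarrow> u \<otimes>\<^bsub>remnant\<^esub> v) = (case p of (x, y) \<Rightarrow> x \<otimes>\<^bsub>remnant\<^esub> y)"
      using p R_map_mult[OF p(2,3) uv] by (simp add: remnant_braiding_eq uv remnant_mult)
  qed
qed

end

section \<open>The Drinfeld twist of a co-twist\<close>

locale cotwisted_hopf_algebra = coquasitriangular_hopf_algebra \<Delta> S R R'
  for \<Delta> :: "'h::suplat_augmented_algebra \<Rightarrow> ('h, 'h) tensor" and S :: "'h \<Rightarrow> 'h" and R R' +
  fixes F F' :: "('h, 'h) tensor \<Rightarrow> bool"
  assumes cotwist: "drinfeld_cotwist \<Delta> F F'"
begin

lemma F_inverse: "conv_inverse H2 (form F) (form F')"
  using cotwist unfolding drinfeld_cotwist_def by (intro form_inverse) auto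

lemma F_Funs: "form F \<in> Funs H2"
  using F_inverse by (simp add: conv_inverse_def)

definition "F_left K = form K \<circ> (\<lambda>(a, b, c). (a * b, c))"
definition "F_right K = form K \<circ> (\<lambda>(a, b, c). (a, b * c))"

lemma F_left_inverse: "conv_inverse H3 (F_left F) (F_left F')"
  unfolding F_left_def by (rule conv_inverse_pullback[OF coalgebra_map_m12 F_inverse])

lemma F_right_inverse: "conv_inverse H3 (F_right F) (F_right F')"
  unfolding F_right_def by (rule conv_inverse_pullback[OF coalgebra_map_m23 F_inverse])

abbreviation "F_map \<equiv> point_map H2 (form F)"
abbreviation "Phi_map \<equiv> point_map H3 (F_right F)"
abbreviation "Psi_map \<equiv> point_map H3 (F_left F)"

text \<open>
  On both sides the counit absorbs the splits of one variable, of \<open>c\<close> and of \<open>a\<close> respectively; this leaves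
  the cocycle condition.
\<close>

lemma F_cocycle: "conv H3 (F_left F) (on12_form (form F)) = conv H3 (F_right F) (on23_form (form F))"
proof (rule ext, clarify)
  fix a b c
  have "sweedler \<Delta> a (\<lambda>a1 a2. sweedler \<Delta> b (\<lambda>b1 b2. F ((a1 * b1) \<otimes>\<^sub>S c) \<and> F (a2 \<otimes>\<^sub>S b2)))
      = sweedler \<Delta> b (\<lambda>b1 b2. sweedler \<Delta> c (\<lambda>c1 c2. F (a \<otimes>\<^sub>S (b1 * c1)) \<and> F (b2 \<otimes>\<^sub>S c2)))"
    using cotwist unfolding drinfeld_cotwist_def by blast
  then show "conv H3 (F_left F) (on12_form (form F)) (a, b, c) = conv H3 (F_right F) (on23_form (form F)) (a, b, c)"
    using F_left_inverse F_right_inverse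
    by (simp add: conv_on12_form conv_on23_form conv_inverse_def)
      (simp add: F_left_def F_right_def conv_def ex_Splits_product form_def sweedler_Splits)
qed

text \<open>
  Braided commutativity for the functional \<open>F(a, -)\<close>. Under \<open>point_map\<close> this identity becomes the commutation of
  \<open>\<Phi>\<close> with the braiding of the last two variables.
\<close>

lemma F_right_commute:
  "conv H3 (F_right F) (on23_form (form R)) =
    conv H3 (on23_form (form R)) (F_right F \<circ> (\<lambda>(a, b, c). (a, c, b)))"
proof (rule ext, clarify)
  fix a b c
  have \<phi>: "join_preserving (\<lambda>x. F (a \<otimes>\<^sub>S x))"
    using F_Funs by (simp add: product_simps hopf_coalgebra_simps form_def)
  have "F_right F \<circ> (\<lambda>(a, b, c). (a, c, b)) \<in> Funs H3"
    using F_right_inverse coalgebra_mapD(1)[OF coalgebra_map_H_swap23] by (simp add: conv_inverse_def)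
  then show "conv H3 (F_right F) (on23_form (form R)) (a, b, c) =
    conv H3 (on23_form (form R)) (F_right F \<circ> (\<lambda>(a, b, c). (a, c, b))) (a, b, c)"
    using F_right_inverse fun_cong[OF braided_commutativity[OF \<phi>], of "(b, c)"]
    by (simp add: conv_on23_form conv_inverse_def) (simp add: F_right_def form_def)
qed

text \<open>
  Braided commutativity for the functional \<open>F(-, c)\<close>.
\<close>

lemma F_left_commute:
  "conv H3 (F_left F) (on12_form (form R)) =
    conv H3 (on12_form (form R)) (F_left F \<circ> (\<lambda>(a, b, c). (b, a, c)))"
proof (rule ext, clarify)
  fix a b c
  have \<phi>: "join_preserving (\<lambda>x. F (x \<otimes>\<^sub>S c))"
    using F_Funs by (simp add: product_simps hopf_coalgebra_simps form_def)
  have "F_left F \<circ> (\<lambda>(a, b, c). (b, a, c)) \<in> Funs H3"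
    using F_left_inverse coalgebra_mapD(1)[OF coalgebra_map_H_swap12] by (simp add: conv_inverse_def)
  then show "conv H3 (F_left F) (on12_form (form R)) (a, b, c) =
    conv H3 (on12_form (form R)) (F_left F \<circ> (\<lambda>(a, b, c). (b, a, c))) (a, b, c)"
    using F_left_inverse fun_cong[OF braided_commutativity[OF \<phi>], of "(a, b)"]
    by (simp add: conv_on12_form conv_inverse_def) (simp add: F_left_def form_def)
qed

lemma twist_induced:
  "induces2 (twist_F_expr \<Delta> F F') F_map"
  "induces3 (twist_Phi_expr \<Delta> F F') Phi_map"
  "induces3 (twist_Psi_expr \<Delta> F F') Psi_map"
proof -
  have F: "conv_inverse H2 (\<lambda>(a, b). F (a \<otimes>\<^sub>S b)) (\<lambda>(a, b). F' (a \<otimes>\<^sub>S b))"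
    using F_inverse by (simp add: form_def)
  have r: "F_right K = (\<lambda>(a, b, c). K (a \<otimes>\<^sub>S (b * c)))" and l: "F_left K = (\<lambda>(a, b, c). K ((a * b) \<otimes>\<^sub>S c))" for K
    by (auto simp: F_right_def F_left_def form_def)
  show "induces2 (twist_F_expr \<Delta> F F') F_map"
    unfolding induces2_def
  proof (intro allI impI)
    fix a b :: 'h
    assume ab: "remnant_proj a \<in> carrier remnant \<and> remnant_proj b \<in> carrier remnant"
    obtain u v where uv: "F_map (remnant_proj a, remnant_proj b) = (u, v)" by force
    have "u \<in> carrier remnant" "v \<in> carrier remnant"
      using based_coalgebra.point_map(1)[OF based_coalgebra_H2 F_inverse, of "(remnant_proj a, remnant_proj b)"] ab uv
      by (auto simp: product_simps hopf_coalgebra_simps)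
    moreover have "twist_F_expr \<Delta> F F' a b = u \<otimes>\<^sub>S v"
      unfolding twist_F_expr_def using conjugation_expr2_eq[OF F pure_tensor_le_iff] ab uv by (simp add: form_def)
    ultimately show "\<exists>u\<in>carrier remnant. \<exists>v\<in>carrier remnant.
        F_map (remnant_proj a, remnant_proj b) = (u, v) \<and> twist_F_expr \<Delta> F F' a b = u \<otimes>\<^sub>S v"
      using uv by blast
  qed
  show "induces3 (twist_Phi_expr \<Delta> F F') Phi_map"
    unfolding twist_Phi_expr_def[abs_def] r
    by (rule conjugation_induces3[OF F_right_inverse[unfolded r]])
  show "induces3 (twist_Psi_expr \<Delta> F F') Psi_map"
    unfolding twist_Psi_expr_def[abs_def] l
    by (rule conjugation_induces3[OF F_left_inverse[unfolded l]])
qed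

theorem remnant_drinfeld_twist:
  "drinfeld_twist remnant (remnant_braiding \<Delta> R R') F_map Phi_map Psi_map"
proof -
  let ?r = "remnant_braiding \<Delta> R R'"
  interpret H2: based_coalgebra H2 by (rule based_coalgebra_H2)
  interpret H3: based_coalgebra H3 by (rule based_coalgebra_H3)
  interpret braided_group remnant ?r by (rule remnant_braided_group)
  have P1: "Points H = carrier remnant" and P2: "Points H2 = carrier2 remnant" and P3: "Points H3 = carrier3 remnant"
    by (simp_all add: product_simps hopf_coalgebra_simps)
  note right = coalgebra_map_insert_right[OF grouplike_one] and left = coalgebra_map_insert_left[OF grouplike_one]
  have on12: "on12 F_map t = point_map H3 (on12_form (form F)) t" "on23 F_map t = point_map H3 (on23_form (form F)) t"
    if "t \<in> carrier3 remnant" for t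
    using that by (auto simp: on12_def on23_def point_map_on_form[OF F_inverse])
  have r12: "on12 ?r t = (\<lambda>(a, b, c). (b, a, c)) (point_map H3 (on12_form (form R)) t)"
    and r23: "on23 ?r t = (\<lambda>(a, b, c). (a, c, b)) (point_map H3 (on23_form (form R)) t)"
    if "t \<in> carrier3 remnant" for t
    using that by (auto simp: on12_def on23_def point_map_on_form[OF R_inverse] remnant_braiding_eq case_prod_unfold prod_eq_iff)
  show ?thesis
  proof
    show "bij_betw F_map (carrier2 remnant) (carrier2 remnant)"
      using H2.point_map_bij[OF F_inverse] by (simp add: P2)
    show "bij_betw Phi_map (carrier3 remnant) (carrier3 remnant)" "bij_betw Psi_map (carrier3 remnant) (carrier3 remnant)"
      using H3.point_map_bij[OF F_right_inverse] H3.point_map_bij[OF F_left_inverse] by (simp_all add: P3)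
    fix t assume t: "t \<in> carrier3 (remnant :: 'h remnant_quotient monoid)"
    then have tP: "t \<in> Points H3" by (simp add: P3)
    have Phi: "Phi_map t \<in> carrier3 remnant" and Psi: "Psi_map t \<in> carrier3 remnant"
      using H3.point_map(1)[OF F_right_inverse tP] H3.point_map(1)[OF F_left_inverse tP] by (simp_all add: P3)
    show "on12 F_map (Psi_map t) = on23 F_map (Phi_map t)"
      unfolding on12(1)[OF Psi] on12(2)[OF Phi]
        H3.point_map_conv[OF F_left_inverse on_form_inverse(1)[OF F_inverse] tP, symmetric]
        H3.point_map_conv[OF F_right_inverse on_form_inverse(3)[OF F_inverse] tP, symmetric] F_cocycle ..
    show "mult23 remnant (Phi_map t) = F_map (mult23 remnant t)"
      using point_map_natural[OF based_coalgebra_H3 based_coalgebra_H2 coalgebra_map_m23 F_inverse tP]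
      by (simp add: mult23_def remnant_mult F_right_def)
    show "mult12 remnant (Psi_map t) = F_map (mult12 remnant t)"
      using point_map_natural[OF based_coalgebra_H3 based_coalgebra_H2 coalgebra_map_m12 F_inverse tP]
      by (simp add: mult12_def remnant_mult F_left_def)
    show "Phi_map (on23 ?r t) = on23 ?r (Phi_map t)"
    proof -
      \<comment> \<open>Naturality moves the flip of the last two variables across \<open>\<Phi>\<close>; what remains is the convolution
        identity for \<open>R\<^sub>2\<^sub>3\<close> and \<open>F(a, b c)\<close>.\<close>
      let ?s = "\<lambda>(a, b, c). (a, c, b)" and ?R = "on23_form (form R)"
      note R = on_form_inverse(3)[OF R_inverse]
      have q: "point_map H3 ?R t \<in> Points H3" by (rule H3.point_map(1)[OF R tP])
      have "Phi_map (on23 ?r t) = Phi_map (?s (point_map H3 ?R t))" by (simp only: r23[OF t])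
      also have "\<dots> = ?s (point_map H3 (F_right F \<circ> ?s) (point_map H3 ?R t))"
        by (rule point_map_natural[OF based_coalgebra_H3 based_coalgebra_H3 coalgebra_map_H_swap23 F_right_inverse q, symmetric])
      also have "\<dots> = ?s (point_map H3 (conv H3 ?R (F_right F \<circ> ?s)) t)"
        by (simp only: H3.point_map_conv[OF R conv_inverse_pullback[OF coalgebra_map_H_swap23 F_right_inverse] tP])
      also have "\<dots> = ?s (point_map H3 (conv H3 (F_right F) ?R) t)"
        by (simp only: F_right_commute)
      also have "\<dots> = ?s (point_map H3 ?R (Phi_map t))"
        by (simp only: H3.point_map_conv[OF F_right_inverse R tP])
      finally show ?thesis by (simp only: r23[OF Phi])
    qed
    show "Psi_map (on12 ?r t) = on12 ?r (Psi_map t)"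
    proof -
      let ?s = "\<lambda>(a, b, c). (b, a, c)" and ?R = "on12_form (form R)"
      note R = on_form_inverse(1)[OF R_inverse]
      have q: "point_map H3 ?R t \<in> Points H3" by (rule H3.point_map(1)[OF R tP])
      have "Psi_map (on12 ?r t) = Psi_map (?s (point_map H3 ?R t))" by (simp only: r12[OF t])
      also have "\<dots> = ?s (point_map H3 (F_left F \<circ> ?s) (point_map H3 ?R t))"
        by (rule point_map_natural[OF based_coalgebra_H3 based_coalgebra_H3 coalgebra_map_H_swap12 F_left_inverse q, symmetric])
      also have "\<dots> = ?s (point_map H3 (conv H3 ?R (F_left F \<circ> ?s)) t)"
        by (simp only: H3.point_map_conv[OF R conv_inverse_pullback[OF coalgebra_map_H_swap12 F_left_inverse] tP])
      also have "\<dots> = ?s (point_map H3 (conv H3 (F_left F) ?R) t)"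
        by (simp only: F_left_commute)
      also have "\<dots> = ?s (point_map H3 ?R (Psi_map t))"
        by (simp only: H3.point_map_conv[OF F_left_inverse R tP])
      finally show ?thesis by (simp only: r12[OF Psi])
    qed
  next
    interpret H: based_coalgebra H by (rule based_coalgebra_H)
    have F1: "F (a \<otimes>\<^sub>S 1) = counit a" "F (1 \<otimes>\<^sub>S a) = counit a" for a
      using cotwist unfolding drinfeld_cotwist_def by blast+
    fix x assume x: "x \<in> carrier (remnant :: 'h remnant_quotient monoid)"
    then have xP: "x \<in> Points H" by (simp add: P1)
    have "form F \<circ> Pair 1 = Counit H" "form F \<circ> (\<lambda>a. (a, 1)) = Counit H"
      by (auto simp: form_def F1 hopf_coalgebra_simps)
    then show "F_map (\<one>\<^bsub>remnant\<^esub>, x) = (\<one>\<^bsub>remnant\<^esub>, x)" "F_map (x, \<one>\<^bsub>remnant\<^esub>) = (x, \<one>\<^bsub>remnant\<^esub>)"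
      using point_map_natural[OF based_coalgebra_H based_coalgebra_H2 left[OF based_coalgebra_H] F_inverse xP]
        point_map_natural[OF based_coalgebra_H based_coalgebra_H2 right[OF based_coalgebra_H] F_inverse xP]
      by (simp_all add: remnant_one H.point_map_Counit[OF xP])
    fix y assume y: "y \<in> carrier (remnant :: 'h remnant_quotient monoid)"
    have xyP: "(x, y) \<in> Points H2" using x y by (simp add: P2)
    have "F_right F \<circ> Pair 1 = Counit H2"
      by (auto simp: F_right_def form_def F1 product_simps hopf_coalgebra_simps counit_mult)
    then show "Phi_map (\<one>\<^bsub>remnant\<^esub>, x, y) = (\<one>\<^bsub>remnant\<^esub>, x, y)"
      using point_map_natural[OF based_coalgebra_H2 based_coalgebra_H3 left[OF based_coalgebra_H2] F_right_inverse xyP]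
      by (simp add: remnant_one H2.point_map_Counit[OF xyP])
    let ?i = "map_prod id (\<lambda>a. (a, 1))"
    have "F_left F \<circ> ?i = Counit H2"
      by (auto simp: F_left_def form_def F1 product_simps hopf_coalgebra_simps counit_mult)
    then show "Psi_map (x, y, \<one>\<^bsub>remnant\<^esub>) = (x, y, \<one>\<^bsub>remnant\<^esub>)"
      using point_map_natural[OF based_coalgebra_H2 based_coalgebra_H3 coalgebra_map_product_right[OF right[OF based_coalgebra_H] based_coalgebra_H] F_left_inverse xyP]
      by (simp add: remnant_one H2.point_map_Counit[OF xyP])
  qed
qed

end

theorem theorem3p1:
  fixes \<Delta> :: "'h::suplat_augmented_algebra \<Rightarrow> ('h, 'h) tensor"
    and S :: "'h \<Rightarrow> 'h"
    and R R' \<F> \<F>' :: "('h, 'h) tensor \<Rightarrow> bool"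
  assumes "suplat_hopf_algebra \<Delta> S"
    and "co_quasitriangular \<Delta> R R'"
    and "drinfeld_cotwist \<Delta> \<F> \<F>'"
  shows "induces2 (braiding_expr \<Delta> R R') (remnant_braiding \<Delta> R R') \<and>
    (\<exists>F \<Phi> \<Psi>.
       induces2 (twist_F_expr \<Delta> \<F> \<F>') F \<and>
       induces3 (twist_Phi_expr \<Delta> \<F> \<F>') \<Phi> \<and>
       induces3 (twist_Psi_expr \<Delta> \<F> \<F>') \<Psi> \<and>
       drinfeld_twist remnant (remnant_braiding \<Delta> R R') F \<Phi> \<Psi>)"
proof -
  interpret cotwisted_hopf_algebra \<Delta> S R R' \<F> \<F>'
    using assms
    by (intro cotwisted_hopf_algebra.intro coquasitriangular_hopf_algebra.intro
        coquasitriangular_hopf_algebra_axioms.intro cotwisted_hopf_algebra_axioms.intro)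
  show ?thesis using braiding_induced twist_induced remnant_drinfeld_twist by blast
qed

end
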